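(* Let $X_t$ be any process in $\mathbb{R}^d$ with additive components, and let $y_t(r)$ be its associated function (see context). Let $\phi$ be a quasiconvex function and let $b\in(0,\infty)$ be a constant. Let $v$ be the nondecreasing function defined by the equation $y_{v(t)}(b)=\phi(t)$, and let $u$ be its (continuous) inverse. Define $$\delta_1=\inf\Big\{\eta>0:\liminf_{r\to0}y_{v(r)}(r^{1/\eta})=0\Big\},$$ $$\delta_2=\sup\Big\{\eta>0:\sum_n y_{v(\sigma_n)}(\sigma_n^{1/\eta})^{-1}<\infty\text{ for some }\Sigma\text{-sequence }\sigma_n\downarrow0\Big\},$$ $$\beta_1=\sup\Big\{\eta>0:\liminf_{r\to0}y_{v(r)}(r^{1/\eta})^{-1}=0\Big\},$$ $$\beta_2=\inf\Big\{\eta>0:\sum_n y_{v(\sigma_n)}(\sigma_n^{1/\eta})<\infty\text{ for some }\Sigma\text{-sequence }\sigma_n\downarrow0\Big\}.$$ Then, almost surely, $$\liminf_{t\to0}u(t)^{-1/\eta}X_t^*=\begin{cases}0,&\text{if }\eta>\delta_1,\\ \infty,&\text{if }\eta<\delta_2,\end{cases}\qquad \limsup_{t\to0}u(t)^{-1/\eta}X_t^*=\begin{cases}0,&\text{if }\eta>\beta_2,\\ \infty,&\text{if }\eta<\beta_1.\end{cases}$$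
   Context: $X_t^*=\sup_{0\le s\le t}|X_s|$. "Inverse" means right-continuous inverse, $u(t)=\inf\{s>0:v(s)>t\}$. Additive process: a process with independent increments, right-continuous paths with left limits, continuous in probability, with $X_0=0$. A process $X_t=(X_t^{(1)},\dots,X_t^{(d)})$ in $\mathbb{R}^d$ has additive components if each $X_t^{(i)}$ is a real additive process (the vector process itself need not have independent increments). A real additive process has characteristics $(B_t,C_t,\nu_t)$: $E e^{i\lambda X_t}=\exp\{i\lambda B_t-\tfrac12\lambda^2C_t+\int(e^{i\lambda x}-1-i\lambda x1(|x|\le1))\nu_t(dx)\}$, with $B_t$ continuous, $B_0=0$, $C_t$ nondecreasing continuous, $C_0=0$, $\nu_t$ a Lévy measure for each $t$, nondecreasing and continuous in $t$, $\nu_0=0$. For such a process put, for $r>0,t\ge0$, $$G_t(r)=\int_{|x|>r}\nu_t(dx),\quad K_t(r)=r^{-2}\Big[C_t+\int_{|x|\le r}x^2\nu_t(dx)\Big],$$ $$M_t(r)=r^{-1}\Big|B_t+\int_{1<|x|\le r\vee1}x\,\nu_t(dx)-\int_{r\wedge1<|x|\le1}x\,\nu_t(dx)\Big|,\quad M_t^*(r)=\max_{0\le s\le t}M_s(r),$$ and $y_t(r)=G_t(r)+K_t(r)+M_t^*(r)$. For a process in $\mathbb{R}^d$ with additive components, $y_t(r)=\sum_{i=1}^dy_t^{(i)}(r)$, where $y_t^{(i)}(r)$ is this function for $X_t^{(i)}$. For fixed $r$, $y_t(r)$ is nondecreasing and continuous in $t$ with $y_0(r)=0$. Quasiconvex function: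 a nondecreasing right-continuous function $\phi$ with $\phi(0)=0$, $\phi(t)>0$ for $t>0$, for which there are constants $\rho,\sigma\in(0,\infty)$ with $\phi(t_2)/\phi(t_1)\ge\rho(t_2/t_1)^\sigma$ whenever $0<t_1<t_2$. $\Sigma$-sequence: a sequence $\sigma_n\downarrow0$ with $\frac{\sigma_{n-1}}{\sigma_n}\sigma_n^\eta\to0$ as $n\to\infty$ for every $\eta>0$. *)

theory Defs
  imports "HOL-Probability.Probability"
begin

text \<open>Processes have time set \<open>[0,\<infinity>)\<close>; a process is a function on the type \<^typ>\<open>real\<close> whose
  values at negative times are ignored. The same applies to \<open>\<phi>\<close>, \<open>v\<close> and the characteristics.\<close>

definition indep_increments :: "'w measure \<Rightarrow> (real \<Rightarrow> 'w \<Rightarrow> real) \<Rightarrow> bool" where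
  "indep_increments M X \<longleftrightarrow>
     (\<forall>n. \<forall>\<tau>::nat \<Rightarrow> real. 0 \<le> \<tau> 0 \<and> mono \<tau> \<longrightarrow>
        prob_space.indep_vars M (\<lambda>_. borel)
          (\<lambda>i \<omega>. X (\<tau> (Suc i)) \<omega> - X (\<tau> i) \<omega>) {..<n})"

definition continuous_in_probability :: "'w measure \<Rightarrow> (real \<Rightarrow> 'w \<Rightarrow> real) \<Rightarrow> bool" where
  "continuous_in_probability M X \<longleftrightarrow>
     (\<forall>t\<ge>0. \<forall>\<epsilon>>0.
        ((\<lambda>s. measure M {\<omega> \<in> space M. \<epsilon> < \<bar>X s \<omega> - X t \<omega>\<bar>}) \<longlongrightarrow> 0) (at t within {0..}))"

definition additive_process :: "'w measure \<Rightarrow> (real \<Rightarrow> 'w \<Rightarrow> real) \<Rightarrow> bool" where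
  "additive_process M X \<longleftrightarrow>
     (\<forall>t\<ge>0. X t \<in> borel_measurable M) \<and>
     indep_increments M X \<and>
     (\<forall>\<omega>\<in>space M. \<forall>t\<ge>0. continuous (at_right t) (\<lambda>s. X s \<omega>)) \<and>
     (\<forall>\<omega>\<in>space M. \<forall>t>0. \<exists>l. ((\<lambda>s. X s \<omega>) \<longlongrightarrow> l) (at_left t)) \<and>
     continuous_in_probability M X \<and>
     (\<forall>\<omega>\<in>space M. X 0 \<omega> = 0)"

definition levy_measure :: "real measure \<Rightarrow> bool" where
  "levy_measure \<nu> \<longleftrightarrow>
     sets \<nu> = sets borel \<and> emeasure \<nu> {0} = 0 \<and> (\<integral>\<^sup>+x. ennreal (min 1 (x\<^sup>2)) \<partial>\<nu>) < \<infinity>"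

text \<open>Continuity of \<open>t \<mapsto> \<nu>\<^sub>t\<close> is setwise, on Borel sets bounded away from the origin
  (the sets on which a Levy measure is necessarily finite).\<close>

definition levy_family :: "(real \<Rightarrow> real measure) \<Rightarrow> bool" where
  "levy_family \<nu> \<longleftrightarrow>
     (\<forall>t\<ge>0. levy_measure (\<nu> t)) \<and>
     (\<forall>s t A. 0 \<le> s \<and> s \<le> t \<and> A \<in> sets borel \<longrightarrow> emeasure (\<nu> s) A \<le> emeasure (\<nu> t) A) \<and>
     (\<forall>A\<in>sets borel. \<forall>\<epsilon>>0. A \<subseteq> {x. \<epsilon> < \<bar>x\<bar>} \<longrightarrow> continuous_on {0..} (\<lambda>t. measure (\<nu> t) A)) \<and>
     (\<forall>A\<in>sets borel. emeasure (\<nu> 0) A = 0)"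

definition has_characteristics ::
  "'w measure \<Rightarrow> (real \<Rightarrow> 'w \<Rightarrow> real) \<Rightarrow> (real \<Rightarrow> real) \<Rightarrow> (real \<Rightarrow> real) \<Rightarrow> (real \<Rightarrow> real measure) \<Rightarrow> bool"
where
  "has_characteristics M X B C \<nu> \<longleftrightarrow>
     continuous_on {0..} B \<and> B 0 = 0 \<and>
     mono_on {0..} C \<and> continuous_on {0..} C \<and> C 0 = 0 \<and>
     levy_family \<nu> \<and>
     (\<forall>t\<ge>0. \<forall>l::real.
        (CLINT \<omega>|M. iexp (l * X t \<omega>)) =
        exp (\<i> * of_real (l * B t) - of_real (l\<^sup>2 * C t / 2)
          + (CLINT x|\<nu> t. iexp (l * x) - 1 - \<i> * of_real (l * x * indicator {x. \<bar>x\<bar> \<le> 1} x))))"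

definition G_fun :: "(real \<Rightarrow> real measure) \<Rightarrow> real \<Rightarrow> real \<Rightarrow> real" where
  "G_fun \<nu> t r = measure (\<nu> t) {x. r < \<bar>x\<bar>}"

definition K_fun :: "(real \<Rightarrow> real) \<Rightarrow> (real \<Rightarrow> real measure) \<Rightarrow> real \<Rightarrow> real \<Rightarrow> real" where
  "K_fun C \<nu> t r = (C t + (LINT x:{x. \<bar>x\<bar> \<le> r}|\<nu> t. x\<^sup>2)) / r\<^sup>2"

definition M_fun :: "(real \<Rightarrow> real) \<Rightarrow> (real \<Rightarrow> real measure) \<Rightarrow> real \<Rightarrow> real \<Rightarrow> real" where
  "M_fun B \<nu> t r =
     \<bar>B t + (LINT x:{x. 1 < \<bar>x\<bar> \<and> \<bar>x\<bar> \<le> max r 1}|\<nu> t. x)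
          - (LINT x:{x. min r 1 < \<bar>x\<bar> \<and> \<bar>x\<bar> \<le> 1}|\<nu> t. x)\<bar> / r"

definition M_star :: "(real \<Rightarrow> real) \<Rightarrow> (real \<Rightarrow> real measure) \<Rightarrow> real \<Rightarrow> real \<Rightarrow> real" where
  "M_star B \<nu> t r = (SUP s\<in>{0..t}. M_fun B \<nu> s r)"

definition y_real ::
  "(real \<Rightarrow> real) \<Rightarrow> (real \<Rightarrow> real) \<Rightarrow> (real \<Rightarrow> real measure) \<Rightarrow> real \<Rightarrow> real \<Rightarrow> real" where
  "y_real B C \<nu> t r = G_fun \<nu> t r + K_fun C \<nu> t r + M_star B \<nu> t r"

definition y_fun ::
  "('d::finite \<Rightarrow> real \<Rightarrow> real) \<Rightarrow> ('d \<Rightarrow> real \<Rightarrow> real) \<Rightarrow> ('d \<Rightarrow> real \<Rightarrow> real measure)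
    \<Rightarrow> real \<Rightarrow> real \<Rightarrow> real" where
  "y_fun B C \<nu> t r = (\<Sum>i\<in>UNIV. y_real (B i) (C i) (\<nu> i) t r)"

definition quasiconvex :: "(real \<Rightarrow> real) \<Rightarrow> bool" where
  "quasiconvex \<phi> \<longleftrightarrow>
     mono_on {0..} \<phi> \<and> (\<forall>t\<ge>0. continuous (at_right t) \<phi>) \<and> \<phi> 0 = 0 \<and> (\<forall>t>0. 0 < \<phi> t) \<and>
     (\<exists>\<rho> \<sigma>. 0 < \<rho> \<and> 0 < \<sigma> \<and>
        (\<forall>t1 t2. 0 < t1 \<and> t1 < t2 \<longrightarrow> \<rho> * (t2 / t1) powr \<sigma> \<le> \<phi> t2 / \<phi> t1))"

definition Sigma_sequence :: "(nat \<Rightarrow> real) \<Rightarrow> bool" where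
  "Sigma_sequence \<sigma> \<longleftrightarrow>
     (\<forall>n. 0 < \<sigma> n) \<and> decseq \<sigma> \<and> \<sigma> \<longlonglongrightarrow> 0 \<and>
     (\<forall>\<eta>>0. (\<lambda>n. \<sigma> n / \<sigma> (Suc n) * \<sigma> (Suc n) powr \<eta>) \<longlonglongrightarrow> 0)"

text \<open>The function \<open>t \<mapsto> y\<^sub>t(b)\<close> may be bounded, so \<open>y\<^sub>v\<^sub>(\<^sub>t\<^sub>)(b) = \<phi>(t)\<close> need not be solvable for
  large \<open>t\<close>; \<open>v\<close> is defined on the set of those \<open>t\<close> for which it is. As \<open>\<phi>(0+) = 0\<close> and
  \<open>y\<^sub>t(b)\<close> is continuous in \<open>t\<close>, this set is an interval, and a neighbourhood of \<open>0\<close> in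
  \<open>[0,\<infinity>)\<close> unless \<open>y\<^sub>t(b)\<close> vanishes identically. Where \<open>y\<^sub>t(b)\<close> has flat stretches,
  \<open>v\<close> is any nondecreasing solution.\<close>

definition tc_domain :: "(real \<Rightarrow> real \<Rightarrow> real) \<Rightarrow> real \<Rightarrow> (real \<Rightarrow> real) \<Rightarrow> real set" where
  "tc_domain y b \<phi> = {t. 0 \<le> t \<and> (\<exists>s\<ge>0. y s b = \<phi> t)}"

definition is_time_change ::
  "(real \<Rightarrow> real \<Rightarrow> real) \<Rightarrow> real \<Rightarrow> (real \<Rightarrow> real) \<Rightarrow> (real \<Rightarrow> real) \<Rightarrow> bool" where
  "is_time_change y b \<phi> v \<longleftrightarrow>
     mono_on (tc_domain y b \<phi>) v \<and>
     (\<forall>t\<in>tc_domain y b \<phi>. 0 \<le> v t \<and> y (v t) b = \<phi> t)"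

definition right_inverse_on :: "real set \<Rightarrow> (real \<Rightarrow> real) \<Rightarrow> real \<Rightarrow> real" where
  "right_inverse_on D v t = Inf {s \<in> D. 0 < s \<and> t < v s}"

definition sup_process :: "(real \<Rightarrow> 'w \<Rightarrow> real ^ 'd) \<Rightarrow> real \<Rightarrow> 'w \<Rightarrow> real" where
  "sup_process X t \<omega> = (SUP s\<in>{0..t}. norm (X s \<omega>))"

text \<open>The indices take values in \<open>[0,\<infinity>]\<close>, with \<open>inf {} = \<infinity>\<close> and \<open>sup {} = 0\<close>.\<close>

definition delta1 :: "(real \<Rightarrow> real \<Rightarrow> real) \<Rightarrow> (real \<Rightarrow> real) \<Rightarrow> ennreal" where
  "delta1 y v = Inf {ennreal \<eta> | \<eta>. 0 < \<eta> \<and>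
     Liminf (at_right 0) (\<lambda>r. ennreal (y (v r) (r powr (1 / \<eta>)))) = 0}"

definition delta2 :: "(real \<Rightarrow> real \<Rightarrow> real) \<Rightarrow> (real \<Rightarrow> real) \<Rightarrow> ennreal" where
  "delta2 y v = Sup {ennreal \<eta> | \<eta>. 0 < \<eta> \<and>
     (\<exists>\<sigma>. Sigma_sequence \<sigma> \<and>
        (\<Sum>n. inverse (ennreal (y (v (\<sigma> n)) (\<sigma> n powr (1 / \<eta>))))) < \<infinity>)}"

definition beta1 :: "(real \<Rightarrow> real \<Rightarrow> real) \<Rightarrow> (real \<Rightarrow> real) \<Rightarrow> ennreal" where
  "beta1 y v = Sup {ennreal \<eta> | \<eta>. 0 < \<eta> \<and>
     Liminf (at_right 0) (\<lambda>r. inverse (ennreal (y (v r) (r powr (1 / \<eta>))))) = 0}"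

definition beta2 :: "(real \<Rightarrow> real \<Rightarrow> real) \<Rightarrow> (real \<Rightarrow> real) \<Rightarrow> ennreal" where
  "beta2 y v = Inf {ennreal \<eta> | \<eta>. 0 < \<eta> \<and>
     (\<exists>\<sigma>. Sigma_sequence \<sigma> \<and>
        (\<Sum>n. ennreal (y (v (\<sigma> n)) (\<sigma> n powr (1 / \<eta>)))) < \<infinity>)}"

end

theory Submission
  imports Defs
begin

text \<open>For every component, \<open>P(X\<^sup>*\<^sub>t > r) \<le> c y\<^sub>t(r)\<close> and \<open>P(X\<^sup>*\<^sub>t \<le> r) \<le> c / y\<^sub>t(r)\<close>. With the drift
  recentred at truncation level \<open>r\<close>, the characteristic exponent \<open>\<psi>\<^sub>t\<close> is bounded by \<open>y\<^sub>t(r)\<close> at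
  frequencies of order \<open>1/r\<close>; averaging \<open>1 - Re exp \<psi>\<^sub>t\<close> over these bounds the tail of \<open>X\<^sub>t\<close>, and
  Etemadi's inequality passes to the maximum. Conversely, split \<open>[0,t]\<close> at times where \<open>G + K\<close> has
  increased by a fixed constant, or where \<open>Im \<psi>\<close>, which tracks the drift, has moved by \<open>\<pi>\<close>: on each
  piece the increment of \<open>X\<close> leaves \<open>[-2r,2r]\<close> with probability at least 1/4, so the chance that
  \<open>X\<^sup>*\<close> stays below \<open>r\<close> decays geometrically in the number of pieces, without any use of
  the Levy--Ito decomposition.

  At the times \<open>v(\<sigma>\<^sub>n)\<close> the Borel--Cantelli lemma then compares \<open>X\<^sup>*\<close> with \<open>\<sigma>\<^sub>n\<close> to the power \<open>1/\<eta>\<close>.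
  A \<open>\<Sigma>\<close>-sequence is dense enough to interpolate between consecutive times by monotonicity,
  and for the two one-sided statements a subsequence suffices.\<close>

section \<open>Integration against a family of Levy measures\<close>

text \<open>The process is known only through the characteristic functions of its marginals, so both
  probability estimates are read off from the exponent \<open>psi\<close>. The lower estimate is the
  delicate one, because the ingredients of y behave differently. G + K is a Gaussian term plus one
  integral of the weight \<open>min 1 ((x / r)^2)\<close>; it is nondecreasing in time and shows in
  the modulus of the characteristic function of an increment. The drift is not monotone, and at a
  fixed frequency it shows only as a phase, that is modulo 2 pi, so a large drift at a single time
  is invisible by itself. What helps is continuity in time: on its way to a large value the phase
  passes through all intermediate multiples of pi. Frequencies up to 1/(4r) are used, since for them
  an increment in [-2r,2r] turns the phase by at most 1/2.

  Increments of the Levy measures are handled through monotone integrals only; the difference of two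
  of them is never formed. Numerical constants are generous: they cancel in Borel-Cantelli, and the
  strict inequality between \<eta> and an index leaves a power of the scale to spare.\<close>

abbreviation levy_weight :: "real \<Rightarrow> real" where
  "levy_weight x \<equiv> min 1 (x\<^sup>2)"

lemma levy_measure_weight_integrable:
  assumes "levy_measure \<mu>"
  shows "integrable \<mu> levy_weight"
proof -
  have [measurable_cong]: "sets \<mu> = sets borel"
    using assms by (simp add: levy_measure_def)
  show ?thesis
    using assms by (intro integrableI_nonneg) (auto simp: levy_measure_def)
qed

lemma levy_measure_integrable:
  fixes f :: "real \<Rightarrow> 'b::{banach, second_countable_topology}"
  assumes "levy_measure \<mu>" and f: "f \<in> borel_measurable borel"
    and bound: "\<And>x. norm (f x) \<le> c * levy_weight x"
  shows "integrable \<mu> f"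
proof (rule Bochner_Integration.integrable_bound)
  show "integrable \<mu> (\<lambda>x. c * levy_weight x)"
    by (intro integrable_mult_right levy_measure_weight_integrable assms)
  have [measurable_cong]: "sets \<mu> = sets borel"
    using assms by (simp add: levy_measure_def)
  show "f \<in> borel_measurable \<mu>" using f by measurable
  show "AE x in \<mu>. norm (f x) \<le> norm (c * levy_weight x)"
    using bound by (intro AE_I2) (metis abs_ge_self order_trans real_norm_def)
qed

lemma levy_weight_ge:
  assumes "0 < \<epsilon>" and "\<epsilon> < \<bar>x\<bar>"
  shows "1 \<le> (1 / levy_weight \<epsilon>) * levy_weight x"
proof -
  have "\<epsilon>\<^sup>2 \<le> x\<^sup>2" using assms by (simp add: abs_le_square_iff[symmetric])
  then have "levy_weight \<epsilon> \<le> levy_weight x" by linarith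
  moreover have "0 < levy_weight \<epsilon>" using assms by simp
  ultimately show ?thesis by (simp add: divide_simps)
qed

lemma levy_measure_finite_away:
  assumes "levy_measure \<mu>" and "0 < \<epsilon>"
  shows "emeasure \<mu> {x. \<epsilon> < \<bar>x\<bar>} < \<infinity>"
proof -
  have [measurable_cong]: "sets \<mu> = sets borel"
    using assms by (simp add: levy_measure_def)
  have "{x. \<epsilon> < \<bar>x\<bar>} \<in> sets borel" by measurable
  have "integrable \<mu> (indicat_real {x. \<epsilon> < \<bar>x\<bar>})"
  proof (rule levy_measure_integrable[where c = "1 / levy_weight \<epsilon>"])
    show "norm (indicat_real {x. \<epsilon> < \<bar>x\<bar>} x) \<le> 1 / levy_weight \<epsilon> * levy_weight x" for x
      using levy_weight_ge[OF \<open>0 < \<epsilon>\<close>, of x] by (auto simp: indicator_def)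
  qed (use assms in auto)
  then show ?thesis
    using \<open>{x. \<epsilon> < \<bar>x\<bar>} \<in> sets borel\<close> by (simp add: integrable_indicator_iff sets_eq_imp_space_eq[of \<mu> borel] less_top[symmetric] \<open>sets \<mu> = sets borel\<close>)
qed

text \<open>Fubini in \<open>nn_integral_cos_gap\<close> asks for this. The measure can be infinite
  only near the origin, so the null set {0} and the sets 1/(n+1) < |x| of finite measure exhaust the
  line.\<close>

lemma levy_measure_sigma_finite:
  assumes "levy_measure \<mu>"
  shows "sigma_finite_measure \<mu>"
proof
  have S: "sets \<mu> = sets borel" using assms by (simp add: levy_measure_def)
  let ?A = "insert {0} (range (\<lambda>n::nat. {x::real. 1 / real (Suc n) < \<bar>x\<bar>}))"
  have "x \<in> \<Union>?A" for x
  proof (cases "x = 0")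
    case False
    then obtain n where "1 / real (Suc n) < \<bar>x\<bar>"
      using nat_approx_posE[of "\<bar>x\<bar>"] by auto
    then show ?thesis by auto
  qed auto
  then have U: "\<Union>?A = space \<mu>"
    using S by (auto simp: sets_eq_imp_space_eq[OF S])
  show "\<exists>A. countable A \<and> A \<subseteq> sets \<mu> \<and> \<Union> A = space \<mu> \<and> (\<forall>a\<in>A. emeasure \<mu> a \<noteq> \<infinity>)"
  proof (intro exI conjI)
    show "?A \<subseteq> sets \<mu>" unfolding S by (auto intro: borel_closed)
    show "\<forall>a\<in>?A. emeasure \<mu> a \<noteq> \<infinity>"
    proof
      fix a assume "a \<in> ?A"
      then consider "a = {0}" | n where "a = {x. 1 / real (Suc n) < \<bar>x\<bar>}" by auto
      then show "emeasure \<mu> a \<noteq> \<infinity>"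
      proof cases
        case 1
        then show ?thesis using assms by (simp add: levy_measure_def)
      next
        case (2 n)
        then show ?thesis using levy_measure_finite_away[OF assms, of "1 / real (Suc n)"] by simp
      qed
    qed
  qed (use U in auto)
qed

section \<open>Monotone families of Levy measures\<close>

locale levy_flow =
  fixes \<nu> :: "real \<Rightarrow> real measure"
  assumes levy_family: "levy_family \<nu>"
begin

lemma levy [intro]: "0 \<le> t \<Longrightarrow> levy_measure (\<nu> t)"
  using levy_family by (auto simp: levy_family_def)

lemma sets_nu: "0 \<le> t \<Longrightarrow> sets (\<nu> t) = sets borel"
  using levy by (auto simp: levy_measure_def)

lemma integrable_nu:
  fixes f :: "real \<Rightarrow> 'b::{banach, second_countable_topology}"
  assumes "0 \<le> t" and "f \<in> borel_measurable borel" and "\<And>x. norm (f x) \<le> c * levy_weight x"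
  shows "integrable (\<nu> t) f"
  by (rule levy_measure_integrable[OF levy]) (use assms in auto)

lemma integral_nu_mono:
  fixes f :: "real \<Rightarrow> real"
  assumes st: "0 \<le> s" "s \<le> t" and f: "f \<in> borel_measurable borel"
    and "\<And>x. 0 \<le> f x" and "\<And>x. f x \<le> c * levy_weight x"
  shows "(\<integral>x. f x \<partial>\<nu> s) \<le> (\<integral>x. f x \<partial>\<nu> t)"
proof -
  have "sets (\<nu> s) = sets (\<nu> t)" using st sets_nu by auto
  moreover have "\<nu> s \<le> \<nu> t"
    using st levy_family sets_nu[of s] \<open>sets (\<nu> s) = sets (\<nu> t)\<close>
    by (subst le_measure) (auto simp: levy_family_def)
  ultimately have "(\<integral>\<^sup>+x. ennreal (f x) \<partial>\<nu> s) \<le> (\<integral>\<^sup>+x. ennreal (f x) \<partial>\<nu> t)"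
    by (rule nn_integral_mono_measure)
  moreover have "integrable (\<nu> r) f" if "0 \<le> r" for r
    using that assms by (intro integrable_nu[where c = c]) auto
  ultimately show ?thesis
    using st assms by (simp add: nn_integral_eq_integral Bochner_Integration.integral_nonneg)
qed

text \<open>Since g + f and g - f are nonnegative, their integrals grow with time. In effect this is
  the triangle inequality for the positive measure \<open>\<nu> t - \<nu> s\<close>.\<close>

lemma integral_nu_diff_le:
  fixes f g :: "real \<Rightarrow> real"
  assumes st: "0 \<le> s" "s \<le> t" and f: "f \<in> borel_measurable borel" and g: "g \<in> borel_measurable borel"
    and fg: "\<And>x. \<bar>f x\<bar> \<le> g x" and gc: "\<And>x. g x \<le> c * levy_weight x"
  shows "\<bar>(\<integral>x. f x \<partial>\<nu> t) - (\<integral>x. f x \<partial>\<nu> s)\<bar> \<le> (\<integral>x. g x \<partial>\<nu> t) - (\<integral>x. g x \<partial>\<nu> s)"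
proof -
  have g0: "0 \<le> g x" for x using fg[of x] by linarith
  have fc: "\<bar>f x\<bar> \<le> c * levy_weight x" for x using fg[of x] gc[of x] by linarith
  have int: "integrable (\<nu> r) f" "integrable (\<nu> r) g" if "0 \<le> r" for r
    using that f g fc gc g0 by (auto intro!: integrable_nu[where c = c])
  have le: "g x + f x \<le> (2 * c) * levy_weight x" "g x - f x \<le> (2 * c) * levy_weight x" for x
    using gc[of x] fc[of x] by linarith+
  have pos: "0 \<le> g x + f x" "0 \<le> g x - f x" for x
    using fg[of x] by linarith+
  have "(\<integral>x. g x + f x \<partial>\<nu> s) \<le> (\<integral>x. g x + f x \<partial>\<nu> t)"
    using st f g pos le by (intro integral_nu_mono[where c = "2 * c"]) auto
  moreover have "(\<integral>x. g x - f x \<partial>\<nu> s) \<le> (\<integral>x. g x - f x \<partial>\<nu> t)"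
    using st f g pos le by (intro integral_nu_mono[where c = "2 * c"]) auto
  ultimately show ?thesis using int st by simp
qed

lemma integral_weight_near_0:
  assumes "0 \<le> T" and "0 < e"
  obtains \<epsilon> where "0 < \<epsilon>" "(\<integral>x. levy_weight x * indicator {x. \<bar>x\<bar> \<le> \<epsilon>} x \<partial>\<nu> T) < e"
proof -
  let ?f = "\<lambda>n x. levy_weight x * indicator {x. \<bar>x\<bar> \<le> 1 / real (Suc n)} x"
  have [measurable_cong]: "sets (\<nu> T) = sets borel" using assms sets_nu by auto
  have "(\<lambda>n. \<integral>x. ?f n x \<partial>\<nu> T) \<longlonglongrightarrow> (\<integral>x. 0 \<partial>\<nu> T)"
  proof (rule integral_dominated_convergence)
    show "integrable (\<nu> T) levy_weight"
      using levy_measure_weight_integrable levy assms by blast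
    show "AE x in \<nu> T. (\<lambda>n. ?f n x) \<longlonglongrightarrow> 0"
    proof (intro AE_I2)
      fix x
      show "(\<lambda>n. ?f n x) \<longlonglongrightarrow> 0"
      proof (cases "x = 0")
        case False
        then obtain N where N: "1 / real (Suc N) < \<bar>x\<bar>"
          using nat_approx_posE[of "\<bar>x\<bar>"] by auto
        have "\<forall>\<^sub>F n in sequentially. ?f n x = 0"
          using eventually_ge_at_top[of N]
        proof eventually_elim
          case (elim n)
          have "1 / real (Suc n) \<le> 1 / real (Suc N)" using elim by (auto simp: field_simps)
          then show ?case using N by auto
        qed
        then show ?thesis by (rule tendsto_eventually)
      qed simp
    qed
  qed (auto simp: indicator_def)
  then have "\<forall>\<^sub>F n in sequentially. (\<integral>x. ?f n x \<partial>\<nu> T) < e"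
    using assms by (intro order_tendstoD) auto
  then obtain n where "(\<integral>x. ?f n x \<partial>\<nu> T) < e"
    by (auto simp: eventually_sequentially)
  then show thesis by (intro that[of "1 / real (Suc n)"]) auto
qed

text \<open>Monotonicity of the flow reduces continuity of all integrals to that of the weight, and
  the part of the weight near the origin is small uniformly on compact time intervals.\<close>

lemma continuous_integral_weight: "continuous_on {0..} (\<lambda>t. \<integral>x. levy_weight x \<partial>\<nu> t)"
  unfolding continuous_on_iff
proof (intro ballI allI impI)
  fix t e :: real assume t: "t \<in> {0..}" and e: "0 < e"
  \<comment> \<open>Chosen at time t + 1: by monotonicity the bound then holds at all times up to t
    + 1, and the final modulus is cut at 1 to stay below that time.\<close>
  obtain \<epsilon> where \<epsilon>: "0 < \<epsilon>"
    and small: "(\<integral>x. levy_weight x * indicator {x. \<bar>x\<bar> \<le> \<epsilon>} x \<partial>\<nu> (t + 1)) < e / 2"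
    using integral_weight_near_0[of "t + 1" "e / 2"] t e by auto
  let ?A = "{x. \<epsilon> < \<bar>x\<bar>}" and ?A' = "{x. \<bar>x\<bar> \<le> \<epsilon>}"
  let ?h = "\<lambda>t. \<integral>x. levy_weight x \<partial>\<nu> t"
  have A [measurable]: "?A \<in> sets borel" "?A' \<in> sets borel" by measurable
  have "continuous_on {0..} (\<lambda>t. measure (\<nu> t) ?A)"
    using levy_family \<epsilon> A by (auto simp: levy_family_def)
  then obtain \<delta> where \<delta>: "0 < \<delta>"
    and \<delta>': "\<And>s. s \<in> {0..} \<Longrightarrow> dist s t < \<delta> \<Longrightarrow> dist (measure (\<nu> s) ?A) (measure (\<nu> t) ?A) < e / 2"
    using t e unfolding continuous_on_iff by (metis half_gt_zero)
  have key: "\<bar>?h q - ?h p\<bar> \<le> \<bar>measure (\<nu> q) ?A - measure (\<nu> p) ?A\<bar> + e / 2"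
    if pq: "0 \<le> p" "p \<le> q" "q \<le> t + 1" for p q
  proof -
    have [simp]: "space (\<nu> r) = UNIV" if "0 \<le> r" for r
      using sets_eq_imp_space_eq[OF sets_nu[OF that]] by simp
    have i1: "integrable (\<nu> r) (\<lambda>x. levy_weight x * indicator B x)" if "0 \<le> r" "B \<in> sets borel" for r B
      using that by (intro integrable_nu[where c = 1]) (auto simp: indicator_def)
    have split: "?h r = (\<integral>x. levy_weight x * indicator ?A x \<partial>\<nu> r) + (\<integral>x. levy_weight x * indicator ?A' x \<partial>\<nu> r)"
      if "0 \<le> r" for r
      unfolding Bochner_Integration.integral_add[OF i1[OF that A(1)] i1[OF that A(2)], symmetric]
      by (intro Bochner_Integration.integral_cong) (auto simp: indicator_def)
    have far: "\<bar>(\<integral>x. levy_weight x * indicator ?A x \<partial>\<nu> q) - (\<integral>x. levy_weight x * indicator ?A x \<partial>\<nu> p)\<bar>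
       \<le> (\<integral>x. indicator ?A x \<partial>\<nu> q) - (\<integral>x. indicator ?A x \<partial>\<nu> p)"
      using pq levy_weight_ge[OF \<epsilon>]
      by (intro integral_nu_diff_le[where c = "1 / levy_weight \<epsilon>"]) (auto simp: indicator_def)
    have near: "\<bar>(\<integral>x. levy_weight x * indicator ?A' x \<partial>\<nu> q) - (\<integral>x. levy_weight x * indicator ?A' x \<partial>\<nu> p)\<bar>
       \<le> (\<integral>x. levy_weight x * indicator ?A' x \<partial>\<nu> q) - (\<integral>x. levy_weight x * indicator ?A' x \<partial>\<nu> p)"
      using pq by (intro integral_nu_diff_le[where c = 1]) (auto simp: indicator_def)
    have "(\<integral>x. levy_weight x * indicator ?A' x \<partial>\<nu> q) \<le> (\<integral>x. levy_weight x * indicator ?A' x \<partial>\<nu> (t + 1))"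
      using pq by (intro integral_nu_mono[where c = 1]) (auto simp: indicator_def)
    moreover have "0 \<le> (\<integral>x. levy_weight x * indicator ?A' x \<partial>\<nu> p)"
      by (intro Bochner_Integration.integral_nonneg) auto
    moreover have "(\<integral>x. indicator ?A x \<partial>\<nu> r) = measure (\<nu> r) ?A" if "0 \<le> r" for r
      using that by simp
    note this[of p] this[of q]
    moreover have "0 \<le> q" using pq by simp
    ultimately show ?thesis
      using far near small split[of p] split[of q] pq(1) by linarith
  qed
  show "\<exists>d>0. \<forall>s\<in>{0..}. dist s t < d \<longrightarrow> dist (?h s) (?h t) < e"
  proof (intro exI[of _ "min \<delta> 1"] conjI ballI impI)
    fix s assume s: "s \<in> {0..}" "dist s t < min \<delta> 1"
    have "dist (measure (\<nu> s) ?A) (measure (\<nu> t) ?A) < e / 2" using s by (intro \<delta>') auto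
    moreover have "\<bar>?h s - ?h t\<bar> \<le> \<bar>measure (\<nu> s) ?A - measure (\<nu> t) ?A\<bar> + e / 2"
    proof (cases "s \<le> t")
      case True
      then have "\<bar>?h t - ?h s\<bar> \<le> \<bar>measure (\<nu> t) ?A - measure (\<nu> s) ?A\<bar> + e / 2"
        using s t by (intro key) auto
      then show ?thesis by (simp only: abs_minus_commute)
    next
      case False
      then show ?thesis using s t by (intro key) (auto simp: dist_real_def)
    qed
    ultimately show "dist (?h s) (?h t) < e"
      unfolding dist_real_def by linarith
  qed (use \<delta> in auto)
qed

lemma continuous_integral_nu:
  fixes f :: "real \<Rightarrow> real"
  assumes f: "f \<in> borel_measurable borel" and fc: "\<And>x. \<bar>f x\<bar> \<le> c * levy_weight x"
  shows "continuous_on {0..} (\<lambda>t. \<integral>x. f x \<partial>\<nu> t)"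
proof -
  let ?h = "\<lambda>t. \<integral>x. c * levy_weight x \<partial>\<nu> t"
  have le: "\<bar>(\<integral>x. f x \<partial>\<nu> s) - (\<integral>x. f x \<partial>\<nu> t)\<bar> \<le> \<bar>?h s - ?h t\<bar>" if "0 \<le> s" "0 \<le> t" for s t
    using integral_nu_diff_le[of s t f "\<lambda>x. c * levy_weight x" c]
      integral_nu_diff_le[of t s f "\<lambda>x. c * levy_weight x" c] that f fc
    by (cases "s \<le> t") auto
  have "continuous_on {0..} ?h"
    by (simp add: continuous_integral_weight continuous_on_mult_left)
  then show ?thesis
    unfolding continuous_on_iff dist_real_def using le
    by (intro ballI allI impI) (meson atLeast_iff le_less_trans)
qed

lemma integral_nu_0: "(\<integral>x. f x \<partial>\<nu> 0) = (0::'b::{banach, second_countable_topology})"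
proof -
  have "\<nu> 0 = null_measure borel"
    using levy_family sets_nu[of 0] by (intro measure_eqI) (auto simp: levy_family_def)
  then show ?thesis
    by (metis (no_types) integral_null_measure)
qed

end

section \<open>The characteristic exponent\<close>

abbreviation scaled_weight :: "real \<Rightarrow> real \<Rightarrow> real" where
  "scaled_weight r x \<equiv> min 1 ((x / r)\<^sup>2)"

lemma scaled_weight_le: "0 < r \<Longrightarrow> scaled_weight r x \<le> (1 + 1 / r\<^sup>2) * levy_weight x"
proof (cases "x\<^sup>2 \<le> 1")
  case True
  assume "0 < r"
  have "scaled_weight r x \<le> x\<^sup>2 / r\<^sup>2" by (simp add: power_divide)
  also have "\<dots> \<le> (1 + 1 / r\<^sup>2) * x\<^sup>2" by (simp add: algebra_simps)
  finally show ?thesis using True by simp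
next
  case False
  assume "0 < r"
  then have "1 \<le> (1 + 1 / r\<^sup>2) * levy_weight x" using False by simp
  then show ?thesis by (rule order_trans[OF min.cobounded1])
qed

lemma scaled_inside: "0 < r \<Longrightarrow> \<bar>x\<bar> \<le> r \<Longrightarrow> (x / r)\<^sup>2 \<le> (1::real)"
  using abs_square_le_1[of "x / r"] by simp

lemma scaled_outside: "0 < r \<Longrightarrow> r < \<bar>x\<bar> \<Longrightarrow> (1::real) \<le> (x / r)\<^sup>2"
proof -
  assume "0 < r" "r < \<bar>x\<bar>"
  then have "1 \<le> \<bar>x / r\<bar>" by simp
  then have "1 \<le> \<bar>x / r\<bar>\<^sup>2" by (rule one_le_power)
  then show ?thesis by (simp only: power2_abs)
qed

text \<open>The Levy-Khintchine integrand with truncation at a free level r; level 1 is the one in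
  \<open>has_characteristics\<close>. Matching the truncation to the scale of interest gives bounds
  in terms of \<open>scaled_weight r\<close>.\<close>

definition compensated :: "real \<Rightarrow> real \<Rightarrow> real \<Rightarrow> complex" where
  "compensated r l x = iexp (l * x) - 1 - \<i> * of_real (l * x * indicator {x. \<bar>x\<bar> \<le> r} x)"

lemma compensated_measurable [measurable]: "compensated r l \<in> borel_measurable borel"
  unfolding compensated_def by measurable

text \<open>Taylor expansion to second order inside the truncation, the trivial bound 2 outside; the
  sum of both constants serves on the whole line.\<close>

lemma norm_compensated_le:
  assumes "0 < r"
  shows "norm (compensated r l x) \<le> ((l * r)\<^sup>2 / 2 + 2) * scaled_weight r x"
proof (cases "\<bar>x\<bar> \<le> r")
  case True
  have "norm (compensated r l x) \<le> \<bar>l * x\<bar>\<^sup>2 / 2"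
    using iexp_approx1[of "l * x" 1] True by (simp add: compensated_def power2_eq_square algebra_simps)
  also have "\<dots> = (l * r)\<^sup>2 / 2 * (x / r)\<^sup>2"
    using assms by (simp add: power2_eq_square)
  also have "\<dots> \<le> ((l * r)\<^sup>2 / 2 + 2) * (x / r)\<^sup>2"
    by (intro mult_right_mono) auto
  finally show ?thesis using scaled_inside[OF assms True] by simp
next
  case False
  then have "compensated r l x = iexp (l * x) - 1"
    by (simp add: compensated_def)
  moreover have "norm (iexp (l * x) - 1) \<le> norm (iexp (l * x)) + norm (1::complex)"
    by (rule norm_triangle_ineq4)
  moreover have "norm (iexp (l * x)) = 1" by (rule norm_exp_i_times)
  ultimately have "norm (compensated r l x) \<le> 2" by simp
  moreover have "2 \<le> (l * r)\<^sup>2 / 2 + 2" by simp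
  ultimately have "norm (compensated r l x) \<le> ((l * r)\<^sup>2 / 2 + 2) * 1"
    unfolding mult_1_right by (rule order_trans)
  then show ?thesis using scaled_outside[OF assms, of x] False by (simp only: min.absorb1 not_le)
qed

section \<open>Mass, drift and exponent of one component\<close>

locale levy_triplet = levy_flow +
  fixes B C :: "real \<Rightarrow> real"
  assumes B_cont: "continuous_on {0..} B" and B_0: "B 0 = 0"
    and C_mono: "mono_on {0..} C" and C_cont: "continuous_on {0..} C" and C_0: "C 0 = 0"
begin

lemma C_nonneg: "0 \<le> t \<Longrightarrow> 0 \<le> C t"
  using C_mono C_0 by (metis atLeast_iff mono_onD order_refl)

lemma integrable_scaled:
  fixes f :: "real \<Rightarrow> 'b::{banach, second_countable_topology}"
  assumes "0 \<le> t" and "0 < r" and "f \<in> borel_measurable borel" and "0 \<le> c"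
    and f: "\<And>x. norm (f x) \<le> c * scaled_weight r x"
  shows "integrable (\<nu> t) f"
proof (rule integrable_nu[where c = "c * (1 + 1 / r\<^sup>2)"])
  show "norm (f x) \<le> c * (1 + 1 / r\<^sup>2) * levy_weight x" for x
    using f[of x] mult_left_mono[OF scaled_weight_le[OF \<open>0 < r\<close>, of x] \<open>0 \<le> c\<close>]
    by (simp only: mult.assoc)
qed (use assms in auto)

lemma continuous_integral_scaled:
  fixes f :: "real \<Rightarrow> real"
  assumes "0 < r" and "f \<in> borel_measurable borel" and "0 \<le> c"
    and f: "\<And>x. \<bar>f x\<bar> \<le> c * scaled_weight r x"
  shows "continuous_on {0..} (\<lambda>t. \<integral>x. f x \<partial>\<nu> t)"
proof (rule continuous_integral_nu[where c = "c * (1 + 1 / r\<^sup>2)"])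
  show "\<bar>f x\<bar> \<le> c * (1 + 1 / r\<^sup>2) * levy_weight x" for x
    using f[of x] mult_left_mono[OF scaled_weight_le[OF \<open>0 < r\<close>, of x] \<open>0 \<le> c\<close>]
    by (simp only: mult.assoc)
qed (use assms in auto)

text \<open>This is G + K, see \<open>mass_eq\<close>. As one integral of a continuous weight it
  makes monotonicity and continuity in time, and the comparison of two levels, statements about that
  weight.\<close>

definition mass :: "real \<Rightarrow> real \<Rightarrow> real" where
  "mass t r = C t / r\<^sup>2 + (\<integral>x. scaled_weight r x \<partial>\<nu> t)"

lemma mass_eq:
  assumes "0 \<le> t" and r: "0 < r"
  shows "G_fun \<nu> t r + K_fun C \<nu> t r = mass t r"
proof -
  let ?A = "{x. r < \<bar>x\<bar>}" and ?A' = "{x. \<bar>x\<bar> \<le> r}"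
  have [simp]: "space (\<nu> t) = UNIV"
    using sets_eq_imp_space_eq[OF sets_nu[OF assms(1)]] by simp
  have "G_fun \<nu> t r = (\<integral>x. indicator ?A x \<partial>\<nu> t)" by (simp add: G_fun_def)
  moreover have "(LINT x:?A'|\<nu> t. x\<^sup>2) / r\<^sup>2 = (\<integral>x. (x / r)\<^sup>2 * indicator ?A' x \<partial>\<nu> t)"
    unfolding set_lebesgue_integral_def
    by (subst Bochner_Integration.integral_divide_zero[symmetric])
       (auto intro!: Bochner_Integration.integral_cong simp: power_divide indicator_def)
  moreover have "(\<integral>x. indicator ?A x \<partial>\<nu> t) + (\<integral>x. (x / r)\<^sup>2 * indicator ?A' x \<partial>\<nu> t) =
     (\<integral>x. indicator ?A x + (x / r)\<^sup>2 * indicator ?A' x \<partial>\<nu> t)"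
    using assms scaled_inside[OF r] scaled_outside[OF r]
    by (intro Bochner_Integration.integral_add[symmetric] integrable_scaled[where c = 1 and r = r])
       (auto simp: indicator_def)
  moreover have "indicator ?A x + (x / r)\<^sup>2 * indicator ?A' x = scaled_weight r x" for x
    using scaled_inside[OF r, of x] scaled_outside[OF r, of x] by (auto simp: indicator_def)
  ultimately show ?thesis
    by (simp add: K_fun_def mass_def add_divide_distrib)
qed

lemma mass_mono: "0 \<le> s \<Longrightarrow> s \<le> t \<Longrightarrow> 0 < r \<Longrightarrow> mass s r \<le> mass t r"
  unfolding mass_def
  by (intro add_mono divide_right_mono integral_nu_mono[OF _ _ _ _ scaled_weight_le] mono_onD[OF C_mono]) auto

lemma mass_cont: "0 < r \<Longrightarrow> continuous_on {0..} (\<lambda>t. mass t r)"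
  unfolding mass_def
  by (intro continuous_intros C_cont continuous_integral_scaled[where c = 1 and r = r]) auto

lemma mass_0: "mass 0 r = 0"
  by (simp add: mass_def C_0 integral_nu_0)

lemma mass_nonneg: "0 \<le> t \<Longrightarrow> 0 < r \<Longrightarrow> 0 \<le> mass t r"
  using mass_mono[of 0 t r] by (simp add: mass_0)

text \<open>The drift after moving the truncation point from 1 to \<open>r\<close>.\<close>

definition drift :: "real \<Rightarrow> real \<Rightarrow> real" where
  "drift t r = B t + (\<integral>x. x * (indicator {x. \<bar>x\<bar> \<le> r} x - indicator {x. \<bar>x\<bar> \<le> 1} x) \<partial>\<nu> t)"

text \<open>The left side vanishes off the annulus between 1 and r. There it is at most
  \<open>max 1 r\<close>, and the weight is bounded below by its value at
  \<open>min 1 r\<close>.\<close>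

lemma truncation_diff_le:
  assumes "0 < r"
  shows "\<bar>x * (indicator {x. \<bar>x\<bar> \<le> r} x - indicator {x. \<bar>x\<bar> \<le> 1} x)\<bar>
    \<le> max 1 r * (1 / levy_weight (min 1 r)) * levy_weight x"
proof (cases "min 1 r < \<bar>x\<bar> \<and> \<bar>x\<bar> \<le> max 1 r")
  case True
  have "\<bar>x * (indicator {x. \<bar>x\<bar> \<le> r} x - indicator {x. \<bar>x\<bar> \<le> 1} x)\<bar> \<le> max 1 r * 1"
    using True assms by (auto simp: indicator_def)
  also have "\<dots> \<le> max 1 r * (1 / levy_weight (min 1 r) * levy_weight x)"
    using levy_weight_ge[of "min 1 r" x] True assms by (intro mult_left_mono) auto
  finally show ?thesis by (simp only: mult.assoc)
next
  case False
  then have "x * (indicator {x. \<bar>x\<bar> \<le> r} x - indicator {x. \<bar>x\<bar> \<le> 1} x) = 0"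
    by (auto simp: indicator_def)
  moreover have "0 \<le> max 1 r * (1 / levy_weight (min 1 r)) * levy_weight x" by simp
  ultimately show ?thesis by (simp only: abs_zero)
qed

lemma truncation_diff_integrable:
  "0 < r \<Longrightarrow> 0 \<le> t \<Longrightarrow>
    integrable (\<nu> t) (\<lambda>x. x * (indicator {x. \<bar>x\<bar> \<le> r} x - indicator {x. \<bar>x\<bar> \<le> 1} x))"
  by (rule integrable_nu[where c = "max 1 r * (1 / levy_weight (min 1 r))"])
     (simp, simp, simp only: real_norm_def truncation_diff_le)

text \<open>For r > 1 only the first correction integral of \<open>M_fun\<close> is present, for r <
  1 only the second. In both cases they amount to moving the truncation from 1 to r.\<close>

lemma M_fun_eq:
  assumes "0 \<le> t" and r: "0 < r"
  shows "M_fun B \<nu> t r = \<bar>drift t r\<bar> / r"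
proof -
  let ?A = "{x. 1 < \<bar>x\<bar> \<and> \<bar>x\<bar> \<le> max r 1}" and ?A' = "{x. min r 1 < \<bar>x\<bar> \<and> \<bar>x\<bar> \<le> 1}"
  let ?f = "\<lambda>x. x * (indicator {x. \<bar>x\<bar> \<le> r} x - indicator {x. \<bar>x\<bar> \<le> 1} x)"
  have eq: "?f x = indicator ?A x *\<^sub>R x - indicator ?A' x *\<^sub>R x" for x
    by (auto simp: indicator_def)
  have le: "norm (indicator ?A x *\<^sub>R x) \<le> \<bar>?f x\<bar>" "norm (indicator ?A' x *\<^sub>R x) \<le> \<bar>?f x\<bar>" for x
    by (auto simp: indicator_def)
  have int: "integrable (\<nu> t) (\<lambda>x. indicator ?A x *\<^sub>R x)" "integrable (\<nu> t) (\<lambda>x. indicator ?A' x *\<^sub>R x)"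
    using le by (auto intro!: Bochner_Integration.integrable_bound[OF truncation_diff_integrable[OF r assms(1)]]
        simp: measurable_cong_sets[OF sets_nu[OF assms(1)] refl])
  from int have "(\<integral>x. ?f x \<partial>\<nu> t) = (LINT x:?A|\<nu> t. x) - (LINT x:?A'|\<nu> t. x)"
    unfolding eq set_lebesgue_integral_def by (rule Bochner_Integration.integral_diff)
  then show ?thesis by (simp only: M_fun_def drift_def add_diff_eq)
qed

lemma drift_cont: "0 < r \<Longrightarrow> continuous_on {0..} (\<lambda>t. drift t r)"
  unfolding drift_def
  by (intro continuous_on_add B_cont continuous_integral_nu[OF _ truncation_diff_le]) auto

lemma drift_0: "drift 0 r = 0"
  by (simp add: drift_def B_0 integral_nu_0)

definition psi :: "real \<Rightarrow> real \<Rightarrow> complex" where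
  "psi t l = \<i> * of_real (l * B t) - of_real (l\<^sup>2 * C t / 2) + (CLINT x|\<nu> t. compensated 1 l x)"

text \<open>The two integrands differ by a term linear in x, supported between the two truncation
  levels; its integral is exactly what \<open>drift\<close> adds to B.\<close>

lemma psi_drift:
  assumes "0 \<le> t" and r: "0 < r"
  shows "psi t l = \<i> * of_real (l * drift t r) - of_real (l\<^sup>2 * C t / 2) + (CLINT x|\<nu> t. compensated r l x)"
proof -
  let ?f = "\<lambda>x. x * (indicator {x. \<bar>x\<bar> \<le> r} x - indicator {x. \<bar>x\<bar> \<le> 1} x)"
  have "compensated 1 l x = compensated r l x + \<i> * of_real l * complex_of_real (?f x)" for x
    by (simp add: compensated_def algebra_simps)
  moreover have "integrable (\<nu> t) (compensated r l)"
    using norm_compensated_le[OF r, of l] assms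
    by (intro integrable_scaled[where c = "(l * r)\<^sup>2 / 2 + 2"]) auto
  moreover have "integrable (\<nu> t) (\<lambda>x. complex_of_real (?f x))"
    using truncation_diff_integrable assms by (intro integrable_of_real) auto
  ultimately have "(CLINT x|\<nu> t. compensated 1 l x) =
      (CLINT x|\<nu> t. compensated r l x) + \<i> * of_real l * (CLINT x|\<nu> t. complex_of_real (?f x))"
    by (simp del: of_real_mult)
  also have "(CLINT x|\<nu> t. complex_of_real (?f x)) = of_real (\<integral>x. ?f x \<partial>\<nu> t)"
    by (rule integral_complex_of_real)
  finally show ?thesis by (simp add: psi_def drift_def algebra_simps)
qed

text \<open>Used in both directions: to bound \<open>psi\<close> from above by y, and to recover the
  drift from the imaginary part of \<open>psi\<close> up to a multiple of the mass.\<close>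

lemma norm_psi_drift_le:
  assumes "0 \<le> t" and r: "0 < r"
  shows "norm (psi t l - \<i> * of_real (l * drift t r)) \<le> ((l * r)\<^sup>2 / 2 + 2) * mass t r"
proof -
  let ?c = "(l * r)\<^sup>2 / 2 + 2"
  have "norm (CLINT x|\<nu> t. compensated r l x) \<le> (\<integral>x. norm (compensated r l x) \<partial>\<nu> t)"
    by (rule integral_norm_bound)
  also have "\<dots> \<le> (\<integral>x. ?c * scaled_weight r x \<partial>\<nu> t)"
    using norm_compensated_le[OF r, of l] assms
    by (intro integral_mono integrable_scaled[where c = ?c and r = r]) auto
  also have "\<dots> = ?c * (\<integral>x. scaled_weight r x \<partial>\<nu> t)" by simp
  finally have 1: "norm (CLINT x|\<nu> t. compensated r l x) \<le> ?c * (\<integral>x. scaled_weight r x \<partial>\<nu> t)" .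
  have "norm (complex_of_real (l\<^sup>2 * C t / 2)) = (l * r)\<^sup>2 / 2 * (C t / r\<^sup>2)"
    using C_nonneg[OF assms(1)] r by (simp add: norm_of_real power2_eq_square norm_mult)
  also have "\<dots> \<le> ?c * (C t / r\<^sup>2)"
    using C_nonneg[OF assms(1)] by (intro mult_right_mono) auto
  finally have 2: "norm (complex_of_real (l\<^sup>2 * C t / 2)) \<le> ?c * (C t / r\<^sup>2)" .
  have "psi t l - \<i> * of_real (l * drift t r)
      = (CLINT x|\<nu> t. compensated r l x) - complex_of_real (l\<^sup>2 * C t / 2)"
    unfolding psi_drift[OF assms] by simp
  then have "norm (psi t l - \<i> * of_real (l * drift t r))
      \<le> norm (CLINT x|\<nu> t. compensated r l x) + norm (complex_of_real (l\<^sup>2 * C t / 2))"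
    by (simp only: norm_triangle_ineq4)
  also have "\<dots> \<le> ?c * mass t r"
    using 1 2 by (simp only: mass_def distrib_left)
  finally show ?thesis .
qed

lemma psi_parts:
  assumes "0 \<le> t"
  shows "Re (psi t l) = - (l\<^sup>2 * C t / 2) - (\<integral>x. 1 - cos (l * x) \<partial>\<nu> t)"
    and "Im (psi t l) = l * B t + (\<integral>x. Im (compensated 1 l x) \<partial>\<nu> t)"
proof -
  have "integrable (\<nu> t) (compensated 1 l)"
    using norm_compensated_le[of 1 l] assms
    by (intro integrable_scaled[where c = "(l * 1)\<^sup>2 / 2 + 2" and r = 1]) auto
  note int = integral_Re[OF this] integral_Im[OF this]
  have "Re (compensated 1 l x) = - (1 - cos (l * x))" for x
    by (simp add: compensated_def Re_exp)
  then have "(\<integral>x. Re (compensated 1 l x) \<partial>\<nu> t) = - (\<integral>x. 1 - cos (l * x) \<partial>\<nu> t)"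
    by (simp only: Bochner_Integration.integral_minus)
  then show "Re (psi t l) = - (l\<^sup>2 * C t / 2) - (\<integral>x. 1 - cos (l * x) \<partial>\<nu> t)"
    unfolding psi_def using int by simp
  show "Im (psi t l) = l * B t + (\<integral>x. Im (compensated 1 l x) \<partial>\<nu> t)"
    unfolding psi_def using int by simp
qed

lemma one_minus_cos_le: "\<bar>1 - cos (l * x)\<bar> \<le> (l\<^sup>2 / 2 + 2) * levy_weight x"
proof -
  have "\<bar>Re (compensated 1 l x)\<bar> \<le> norm (compensated 1 l x)" by (rule abs_Re_le_cmod)
  also have "\<dots> \<le> (l\<^sup>2 / 2 + 2) * levy_weight x"
    using norm_compensated_le[of 1 l x] by simp
  finally show ?thesis by (simp add: compensated_def Re_exp)
qed

lemma Re_psi_nonpos: "0 \<le> t \<Longrightarrow> Re (psi t l) \<le> 0"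
proof -
  assume "0 \<le> t"
  moreover have "0 \<le> (\<integral>x. 1 - cos (l * x) \<partial>\<nu> t)" by (intro Bochner_Integration.integral_nonneg) simp
  moreover have "0 \<le> l\<^sup>2 * C t / 2" using C_nonneg \<open>0 \<le> t\<close> by simp
  ultimately show ?thesis unfolding psi_parts[OF \<open>0 \<le> t\<close>] by linarith
qed

lemma Im_psi_cont: "continuous_on {0..} (\<lambda>t. Im (psi t l))"
proof -
  have "\<bar>Im (compensated 1 l x)\<bar> \<le> (l\<^sup>2 / 2 + 2) * levy_weight x" for x
    using norm_compensated_le[of 1 l x] abs_Im_le_cmod[of "compensated 1 l x"] by simp
  then have "continuous_on {0..} (\<lambda>t. \<integral>x. Im (compensated 1 l x) \<partial>\<nu> t)"
    by (rule continuous_integral_nu[rotated]) measurable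
  then have "continuous_on {0..} (\<lambda>t. l * B t + (\<integral>x. Im (compensated 1 l x) \<partial>\<nu> t))"
    by (intro continuous_intros B_cont)
  then show ?thesis
    by (rule continuous_on_eq) (simp add: psi_parts)
qed

lemma psi_0: "psi 0 l = 0"
  by (simp add: psi_def B_0 C_0 integral_nu_0)

end

section \<open>Averaging over frequencies\<close>

text \<open>The integral of \<open>1 - cos (l x)\<close> over \<open>l \<in> [0,a]\<close>. Unlike finitely many values of
  \<open>l\<close>, this average is bounded below on all of \<open>\<bar>x\<bar> \<ge> 1/a\<close>.\<close>

definition cos_gap :: "real \<Rightarrow> real \<Rightarrow> real" where
  "cos_gap a x = (if x = 0 then 0 else a - sin (a * x) / x)"

lemma cos_gap_measurable [measurable]: "cos_gap a \<in> borel_measurable borel"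
  unfolding cos_gap_def by measurable

lemma nn_integral_one_minus_cos:
  assumes "0 \<le> a"
  shows "(\<integral>\<^sup>+l. ennreal (1 - cos (l * x)) * indicator {0..a} l \<partial>lborel) = ennreal (cos_gap a x)"
proof (cases "x = 0")
  case False
  have "(\<integral>\<^sup>+l. ennreal (1 - cos (l * x)) * indicator {0..a} l \<partial>lborel)
      = ennreal ((a - sin (a * x) / x) - (0 - sin (0 * x) / x))"
    using assms False
    by (intro nn_integral_FTC_Icc[where F = "\<lambda>l. l - sin (l * x) / x"])
       (auto intro!: derivative_eq_intros)
  then show ?thesis using False by (simp add: cos_gap_def)
qed (simp add: cos_gap_def)

text \<open>Leaves a cubic deficit on the whole of [0,2]: the Taylor remainder w^5/120 is at most
  w^3/24 there because w^2 is at most 4, and 1/6 - 1/24 = 1/8.\<close>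

lemma sin_le_cubic:
  fixes w :: real
  assumes "0 \<le> w" "w \<le> 2"
  shows "sin w \<le> w - w ^ 3 / 8"
proof -
  have "(\<Sum>m<5. sin_coeff m * w ^ m) = w - w ^ 3 / 6"
    by (simp add: sin_coeff_def lessThan_nat_numeral fact_numeral)
  then have "\<bar>sin w - (w - w ^ 3 / 6)\<bar> \<le> w ^ 5 / 120"
    using Maclaurin_sin_bound[of w 5] assms by (simp add: fact_numeral)
  moreover have "w ^ 5 / 120 \<le> w ^ 3 / 24"
  proof -
    have "w * w \<le> 2 * 2" using assms by (intro mult_mono) auto
    then have "w ^ 3 * (w * w) \<le> w ^ 3 * 4" using assms by (intro mult_left_mono) auto
    moreover have "w ^ 5 = w ^ 3 * (w * w)" by (simp add: eval_nat_numeral)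
    moreover have "0 \<le> w ^ 3" using assms by simp
    ultimately show ?thesis by linarith
  qed
  ultimately show ?thesis by linarith
qed

lemma cos_gap_minus [simp]: "cos_gap a (- x) = cos_gap a x"
  by (simp add: cos_gap_def)

text \<open>With w = x/\<rho> the product of \<rho> and the gap is 1 - sin w / w. For 0 < w \<le> 2
  this is at least w^2/8 by \<open>sin_le_cubic\<close>, for w > 2 at least 1/2; evenness covers
  negative x.\<close>

lemma cos_gap_ge:
  assumes "0 < \<rho>"
  shows "scaled_weight \<rho> x \<le> 8 * \<rho> * cos_gap (1 / \<rho>) x"
proof -
  have pos: "scaled_weight \<rho> x \<le> 8 * \<rho> * cos_gap (1 / \<rho>) x" if x: "0 < x" for x
  proof (cases "x \<le> 2 * \<rho>")
    case True
    have "sin (x / \<rho>) \<le> x / \<rho> - (x / \<rho>) ^ 3 / 8"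
      using assms True x by (intro sin_le_cubic) (auto simp: field_simps)
    then have "\<rho> / x * sin (x / \<rho>) \<le> \<rho> / x * (x / \<rho> - (x / \<rho>) ^ 3 / 8)"
      using assms x by (intro mult_left_mono) auto
    also have "\<dots> = 1 - (x / \<rho>)\<^sup>2 / 8"
      using assms x by (simp add: field_simps power2_eq_square power3_eq_cube)
    finally have "(x / \<rho>)\<^sup>2 \<le> 8 * (1 - \<rho> / x * sin (x / \<rho>))" by simp
    also have "\<dots> = 8 * \<rho> * cos_gap (1 / \<rho>) x"
      using assms x by (simp add: cos_gap_def algebra_simps)
    finally show ?thesis by (rule order_trans[OF min.cobounded2])
  next
    case False
    have "sin (x / \<rho>) * \<rho> \<le> 1 * \<rho>" using assms by (intro mult_right_mono) auto
    then have "\<rho> * (2 * sin (x / \<rho>)) \<le> x" using False by (simp add: algebra_simps)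
    then have "\<rho> / x * sin (x / \<rho>) \<le> 1 / 2" using x by (simp add: field_simps)
    then have "1 \<le> 8 * (1 - \<rho> / x * sin (x / \<rho>))" by simp
    also have "\<dots> = 8 * \<rho> * cos_gap (1 / \<rho>) x"
      using assms x by (simp add: cos_gap_def algebra_simps)
    finally show ?thesis by (rule order_trans[OF min.cobounded1])
  qed
  consider "x = 0" | "0 < x" | "0 < - x" by linarith
  then show ?thesis
  proof cases
    case 1
    then show ?thesis by (simp add: cos_gap_def)
  next
    case 3
    then show ?thesis using pos[of "- x"] by simp
  qed (rule pos)
qed

lemma cos_gap_nonneg:
  assumes "0 < a"
  shows "0 \<le> cos_gap a x"
proof -
  have "0 \<le> scaled_weight (1 / a) x" by simp
  also have "\<dots> \<le> 8 / a * cos_gap a x" using cos_gap_ge[of "1 / a" x] assms by simp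
  finally show ?thesis using assms by (simp add: zero_le_divide_iff)
qed

text \<open>A crude domination, obtained by integrating the pointwise bound for 1 - cos over [0,a].
  It gives integrability of the gap against Levy measures.\<close>

lemma cos_gap_le:
  assumes "0 < a"
  shows "cos_gap a x \<le> ((a\<^sup>2 / 2 + 2) * a) * levy_weight x"
proof -
  let ?c = "(a\<^sup>2 / 2 + 2) * levy_weight x"
  have "ennreal (cos_gap a x) = (\<integral>\<^sup>+l. ennreal (1 - cos (l * x)) * indicator {0..a} l \<partial>lborel)"
    using assms by (simp add: nn_integral_one_minus_cos)
  also have "\<dots> \<le> (\<integral>\<^sup>+l. ennreal ?c * indicator {0..a} l \<partial>lborel)"
  proof (intro nn_integral_mono)
    fix l :: real
    have "1 - cos (l * x) \<le> ?c" if "l \<in> {0..a}"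
    proof -
      have "\<bar>Re (compensated 1 l x)\<bar> \<le> norm (compensated 1 l x)" by (rule abs_Re_le_cmod)
      also have "\<dots> \<le> (l\<^sup>2 / 2 + 2) * levy_weight x"
        using norm_compensated_le[of 1 l x] by simp
      also have "\<dots> \<le> ?c"
        using that by (intro mult_right_mono add_right_mono divide_right_mono power_mono) auto
      finally show ?thesis by (simp add: compensated_def Re_exp)
    qed
    then show "ennreal (1 - cos (l * x)) * indicator {0..a} l \<le> ennreal ?c * indicator {0..a} l"
      by (auto simp: indicator_def intro!: ennreal_leI)
  qed
  also have "\<dots> = ennreal (?c * a)"
    using assms by (simp add: nn_integral_cmult_indicator ennreal_mult)
  finally have "cos_gap a x \<le> ?c * a" using assms by simp
  then show ?thesis by (simp only: mult_ac)
qed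

text \<open>Applied twice: to a Levy measure, where it controls the growth of the mass, and to the
  law of a random variable, where it controls the tail.\<close>

lemma nn_integral_cos_gap:
  assumes "sigma_finite_measure \<mu>" and [measurable_cong]: "sets \<mu> = sets borel" and "0 \<le> a"
  shows "(\<integral>\<^sup>+x. ennreal (cos_gap a x) \<partial>\<mu>)
    = (\<integral>\<^sup>+l. (\<integral>\<^sup>+x. ennreal (1 - cos (l * x)) \<partial>\<mu>) * indicator {0..a} l \<partial>lborel)"
proof -
  interpret sigma_finite_measure \<mu> by fact
  interpret pair_sigma_finite lborel \<mu> ..
  have "(\<integral>\<^sup>+x. ennreal (cos_gap a x) \<partial>\<mu>)
      = (\<integral>\<^sup>+x. (\<integral>\<^sup>+l. ennreal (1 - cos (l * x)) * indicator {0..a} l \<partial>lborel) \<partial>\<mu>)"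
    using assms by (simp add: nn_integral_one_minus_cos)
  also have "\<dots> = (\<integral>\<^sup>+l. (\<integral>\<^sup>+x. ennreal (1 - cos (l * x)) * indicator {0..a} l \<partial>\<mu>) \<partial>lborel)"
    by (rule Fubini') measurable
  also have "\<dots> = (\<integral>\<^sup>+l. (\<integral>\<^sup>+x. ennreal (1 - cos (l * x)) \<partial>\<mu>) * indicator {0..a} l \<partial>lborel)"
    by (intro nn_integral_cong nn_integral_multc) measurable
  finally show ?thesis .
qed

text \<open>Averaging the hypothesis over l in [0,1/\<rho>] bounds the growth of the integrated gap
  by L/\<rho>. The pointwise inequality \<open>cos_gap_ge\<close> passes to increments by
  \<open>integral_nu_diff_le\<close> and costs a factor 8\<rho>.\<close>

lemma (in levy_flow) scaled_weight_increment_le: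
  assumes st: "0 \<le> s" "s \<le> t" and "0 < \<rho>" and "0 \<le> L"
    and L: "\<And>l. 0 \<le> l \<Longrightarrow> l \<le> 1 / \<rho> \<Longrightarrow>
      (\<integral>x. 1 - cos (l * x) \<partial>\<nu> t) \<le> (\<integral>x. 1 - cos (l * x) \<partial>\<nu> s) + L"
  shows "(\<integral>x. scaled_weight \<rho> x \<partial>\<nu> t) - (\<integral>x. scaled_weight \<rho> x \<partial>\<nu> s) \<le> 8 * L"
proof -
  let ?a = "1 / \<rho>"
  have a: "0 < ?a" using assms by simp
  have t: "0 \<le> t" using st by simp
  have int_cos: "integrable (\<nu> r) (\<lambda>x. 1 - cos (l * x))" if "0 \<le> r" for r l
  proof (rule integrable_nu[where c = "l\<^sup>2 / 2 + 2", OF that])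
    fix x
    show "norm (1 - cos (l * x)) \<le> (l\<^sup>2 / 2 + 2) * levy_weight x"
      using norm_compensated_le[of 1 l x] abs_Re_le_cmod[of "compensated 1 l x"]
      by (simp add: compensated_def Re_exp)
  qed measurable
  have nn_cos: "(\<integral>\<^sup>+x. ennreal (1 - cos (l * x)) \<partial>\<nu> r) = ennreal (\<integral>x. 1 - cos (l * x) \<partial>\<nu> r)"
    if "0 \<le> r" for r l
    using int_cos[OF that] by (intro nn_integral_eq_integral) auto
  have int_gap: "integrable (\<nu> r) (cos_gap ?a)" if "0 \<le> r" for r
    using cos_gap_nonneg[OF a] cos_gap_le[OF a]
    by (intro integrable_nu[OF that, where c = "(?a\<^sup>2 / 2 + 2) * ?a"]) auto
  have nn_gap: "(\<integral>\<^sup>+x. ennreal (cos_gap ?a x) \<partial>\<nu> r) = ennreal (\<integral>x. cos_gap ?a x \<partial>\<nu> r)"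
    if "0 \<le> r" for r
    using int_gap[OF that] cos_gap_nonneg[OF a] by (intro nn_integral_eq_integral) auto
  have pos: "0 \<le> (\<integral>x. 1 - cos (l * x) \<partial>\<nu> r)" "0 \<le> (\<integral>x. cos_gap ?a x \<partial>\<nu> r)" for l r
    using cos_gap_nonneg[OF a] by (auto intro!: Bochner_Integration.integral_nonneg)
  have [measurable_cong]: "sets (\<nu> s) = sets borel" using st sets_nu by auto
  interpret s: sigma_finite_measure "\<nu> s"
    using levy_measure_sigma_finite levy st by auto
  have "ennreal (\<integral>x. cos_gap ?a x \<partial>\<nu> t)
      = (\<integral>\<^sup>+l. ennreal (\<integral>x. 1 - cos (l * x) \<partial>\<nu> t) * indicator {0..?a} l \<partial>lborel)"
    using nn_integral_cos_gap[OF levy_measure_sigma_finite[OF levy[OF t]] sets_nu[OF t], of ?a] a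
    unfolding nn_gap[OF t] nn_cos[OF t] by simp
  also have "\<dots> \<le> (\<integral>\<^sup>+l. ((\<integral>\<^sup>+x. ennreal (1 - cos (l * x)) \<partial>\<nu> s) * indicator {0..?a} l +
      ennreal L * indicator {0..?a} l) \<partial>lborel)"
    using L \<open>0 \<le> L\<close> pos
    by (intro nn_integral_mono)
       (auto simp: indicator_def nn_cos[OF st(1)] ennreal_plus[symmetric] simp del: ennreal_plus intro!: ennreal_leI)
  also have "\<dots> = (\<integral>\<^sup>+l. (\<integral>\<^sup>+x. ennreal (1 - cos (l * x)) \<partial>\<nu> s) * indicator {0..?a} l \<partial>lborel) +
      (\<integral>\<^sup>+l. ennreal L * indicator {0..?a} l \<partial>lborel)"
    by (intro nn_integral_add) measurable
  also have "\<dots> = ennreal (\<integral>x. cos_gap ?a x \<partial>\<nu> s) + ennreal (L * ?a)"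
  proof -
    have "(\<integral>\<^sup>+l. ennreal L * indicator {0..?a} l \<partial>lborel) = ennreal (L * ?a)"
      using \<open>0 \<le> L\<close> a by (simp only: nn_integral_cmult_indicator sets_lborel atLeastAtMost_borel
        emeasure_lborel_Icc less_imp_le diff_zero ennreal_mult)
    then show ?thesis
      using nn_integral_cos_gap[OF levy_measure_sigma_finite[OF levy[OF st(1)]] sets_nu[OF st(1)], of ?a] a
      unfolding nn_gap[OF st(1)] by (simp only: less_imp_le)
  qed
  also have "\<dots> = ennreal ((\<integral>x. cos_gap ?a x \<partial>\<nu> s) + L * ?a)"
    using pos \<open>0 \<le> L\<close> a by (intro ennreal_plus[symmetric]) auto
  finally have gap: "(\<integral>x. cos_gap ?a x \<partial>\<nu> t) - (\<integral>x. cos_gap ?a x \<partial>\<nu> s) \<le> L / \<rho>"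
    using pos \<open>0 \<le> L\<close> a by (subst (asm) ennreal_le_iff) auto
  have "\<bar>(\<integral>x. scaled_weight \<rho> x \<partial>\<nu> t) - (\<integral>x. scaled_weight \<rho> x \<partial>\<nu> s)\<bar>
      \<le> (\<integral>x. 8 * \<rho> * cos_gap ?a x \<partial>\<nu> t) - (\<integral>x. 8 * \<rho> * cos_gap ?a x \<partial>\<nu> s)"
  proof (rule integral_nu_diff_le[OF st, where c = "8 * \<rho> * ((?a\<^sup>2 / 2 + 2) * ?a)"])
    show "8 * \<rho> * cos_gap ?a x \<le> 8 * \<rho> * ((?a\<^sup>2 / 2 + 2) * ?a) * levy_weight x" for x
      unfolding mult.assoc[of "8 * \<rho>"] using \<open>0 < \<rho>\<close> cos_gap_le[OF a, of x] by (intro mult_left_mono) auto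
  qed (use cos_gap_ge[OF \<open>0 < \<rho>\<close>] in auto)
  also have "\<dots> = 8 * \<rho> * ((\<integral>x. cos_gap ?a x \<partial>\<nu> t) - (\<integral>x. cos_gap ?a x \<partial>\<nu> s))"
    by (simp add: right_diff_distrib)
  also have "\<dots> \<le> 8 * \<rho> * (L / \<rho>)"
    using gap \<open>0 < \<rho>\<close> by (intro mult_left_mono) auto
  finally show ?thesis using \<open>0 < \<rho>\<close> by simp
qed

text \<open>The Gaussian part and the jump part of -Re psi both grow with time, so each of them
  alone grows by at most L. The jump part costs 8 * 16 = 128, where 16 = 4^2 comes from comparing
  level r with level 4r; the Gaussian part, read at l = 1/(4r), costs 32.\<close>

lemma (in levy_triplet) mass_increment_le:
  assumes st: "0 \<le> s" "s \<le> t" and "0 < r" and "0 \<le> L"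
    and L: "\<And>l. 0 \<le> l \<Longrightarrow> l \<le> 1 / (4 * r) \<Longrightarrow> Re (psi s l) - Re (psi t l) \<le> L"
  shows "mass t r - mass s r \<le> 160 * L"
proof -
  have t: "0 \<le> t" using st by simp
  have C: "C s \<le> C t" using C_mono st by (auto intro: mono_onD)
  have cos: "(\<integral>x. 1 - cos (l * x) \<partial>\<nu> s) \<le> (\<integral>x. 1 - cos (l * x) \<partial>\<nu> t)" for l
    using one_minus_cos_le[of l] st by (intro integral_nu_mono[where c = "l\<^sup>2 / 2 + 2"]) auto
  have split: "l\<^sup>2 * (C t - C s) / 2 + ((\<integral>x. 1 - cos (l * x) \<partial>\<nu> t) - (\<integral>x. 1 - cos (l * x) \<partial>\<nu> s)) \<le> L"
    if "0 \<le> l" "l \<le> 1 / (4 * r)" for l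
    using L[OF that] st t by (simp add: psi_parts algebra_simps diff_divide_distrib)
  have "(\<integral>x. scaled_weight (4 * r) x \<partial>\<nu> t) - (\<integral>x. scaled_weight (4 * r) x \<partial>\<nu> s) \<le> 8 * L"
  proof (rule scaled_weight_increment_le[OF st])
    fix l assume l: "0 \<le> l" "l \<le> 1 / (4 * r)"
    have "0 \<le> l\<^sup>2 * (C t - C s) / 2" using C by simp
    then show "(\<integral>x. 1 - cos (l * x) \<partial>\<nu> t) \<le> (\<integral>x. 1 - cos (l * x) \<partial>\<nu> s) + L"
      using split[OF l] by linarith
  qed (use assms in auto)
  moreover have "\<bar>(\<integral>x. scaled_weight r x \<partial>\<nu> t) - (\<integral>x. scaled_weight r x \<partial>\<nu> s)\<bar>
      \<le> (\<integral>x. 16 * scaled_weight (4 * r) x \<partial>\<nu> t) - (\<integral>x. 16 * scaled_weight (4 * r) x \<partial>\<nu> s)"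
  proof (rule integral_nu_diff_le[OF st, where c = "16 * (1 + 1 / (4 * r)\<^sup>2)"])
    show "\<bar>scaled_weight r x\<bar> \<le> 16 * scaled_weight (4 * r) x" for x
    proof -
      have "(x / (4 * r))\<^sup>2 = (x / r)\<^sup>2 / 16" by (simp add: power_divide power_mult_distrib)
      then show ?thesis by (simp add: min_def)
    qed
    show "16 * scaled_weight (4 * r) x \<le> 16 * (1 + 1 / (4 * r)\<^sup>2) * levy_weight x" for x
      unfolding mult.assoc[of 16] using \<open>0 < r\<close> scaled_weight_le[of "4 * r" x] by (intro mult_left_mono) auto
  qed measurable
  moreover have "C t / r\<^sup>2 - C s / r\<^sup>2 \<le> 32 * L"
  proof -
    have "(1 / (4 * r))\<^sup>2 * (C t - C s) / 2 \<le> L"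
      using split[of "1 / (4 * r)"] cos[of "1 / (4 * r)"] \<open>0 < r\<close> by simp
    moreover have "(1 / (4 * r))\<^sup>2 * (C t - C s) / 2 = (C t / r\<^sup>2 - C s / r\<^sup>2) / 32"
      by (simp add: power_divide power_mult_distrib diff_divide_distrib)
    ultimately have "(C t / r\<^sup>2 - C s / r\<^sup>2) / 32 \<le> L" by (simp only:)
    then show ?thesis by simp
  qed
  ultimately show ?thesis
    unfolding mass_def by simp
qed

text \<open>Markov's inequality for \<open>8 * \<rho> * cos_gap (1 / \<rho>) (Z \<omega>)\<close>,
  which is nonnegative and at least 1 when |Z| > \<rho>. Its expectation is an average of 1 - Re of
  the characteristic function over [0,1/\<rho>].\<close>

lemma (in prob_space) prob_abs_gt_le_char:
  assumes Z [measurable]: "random_variable borel Z" and "0 < \<rho>"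
    and L: "\<And>l. 0 \<le> l \<Longrightarrow> l \<le> 1 / \<rho> \<Longrightarrow> norm (1 - (CLINT \<omega>|M. iexp (l * Z \<omega>))) \<le> L"
  shows "prob {\<omega> \<in> space M. \<rho> < \<bar>Z \<omega>\<bar>} \<le> 8 * L"
proof -
  let ?a = "1 / \<rho>" and ?\<mu> = "distr M borel Z"
  interpret D: prob_space ?\<mu> by (rule prob_space_distr) measurable
  have "0 \<le> L" using order_trans[OF norm_ge_zero L[of 0]] assms by simp
  have cos: "(\<integral>\<^sup>+x. ennreal (1 - cos (l * x)) \<partial>?\<mu>) \<le> ennreal L" if l: "0 \<le> l" "l \<le> ?a" for l
  proof -
    have int: "integrable M (\<lambda>\<omega>. iexp (l * Z \<omega>))"
      by (intro integrable_const_bound[where B = 1]) auto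
    have int': "integrable M (\<lambda>\<omega>. cos (l * Z \<omega>))"
      by (intro integrable_const_bound[where B = 1]) auto
    have "(\<integral>\<omega>. cos (l * Z \<omega>) \<partial>M) = Re (CLINT \<omega>|M. iexp (l * Z \<omega>))"
      using integral_Re[OF int] by (simp add: Re_exp)
    then have "1 - (\<integral>\<omega>. cos (l * Z \<omega>) \<partial>M) \<le> L"
      using L[OF l] abs_Re_le_cmod[of "1 - (CLINT \<omega>|M. iexp (l * Z \<omega>))"] by simp
    moreover have "(\<integral>\<^sup>+x. ennreal (1 - cos (l * x)) \<partial>?\<mu>) = ennreal (\<integral>\<omega>. 1 - cos (l * Z \<omega>) \<partial>M)"
      using int' by (subst nn_integral_distr, measurable, intro nn_integral_eq_integral) auto
    ultimately show ?thesis using int' by (simp add: prob_space ennreal_leI)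
  qed
  have "ennreal (prob {\<omega> \<in> space M. \<rho> < \<bar>Z \<omega>\<bar>}) = (\<integral>\<^sup>+\<omega>. indicator {\<omega> \<in> space M. \<rho> < \<bar>Z \<omega>\<bar>} \<omega> \<partial>M)"
    by (simp add: emeasure_eq_measure)
  also have "\<dots> \<le> (\<integral>\<^sup>+\<omega>. ennreal (8 * \<rho> * cos_gap ?a (Z \<omega>)) \<partial>M)"
  proof (intro nn_integral_mono)
    fix \<omega>
    have "1 \<le> 8 * \<rho> * cos_gap ?a (Z \<omega>)" if "\<rho> < \<bar>Z \<omega>\<bar>"
      using cos_gap_ge[OF \<open>0 < \<rho>\<close>, of "Z \<omega>"] scaled_outside[OF \<open>0 < \<rho>\<close> that] by simp
    then show "indicator {\<omega> \<in> space M. \<rho> < \<bar>Z \<omega>\<bar>} \<omega> \<le> ennreal (8 * \<rho> * cos_gap ?a (Z \<omega>))"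
      by (auto simp: indicator_def ennreal_1[symmetric] simp del: ennreal_1 intro: ennreal_leI)
  qed
  also have "\<dots> = ennreal (8 * \<rho>) * (\<integral>\<^sup>+x. ennreal (cos_gap ?a x) \<partial>?\<mu>)"
    using \<open>0 < \<rho>\<close> cos_gap_nonneg[of ?a] by (simp add: nn_integral_distr ennreal_mult nn_integral_cmult)
  also have "(\<integral>\<^sup>+x. ennreal (cos_gap ?a x) \<partial>?\<mu>)
      = (\<integral>\<^sup>+l. (\<integral>\<^sup>+x. ennreal (1 - cos (l * x)) \<partial>?\<mu>) * indicator {0..?a} l \<partial>lborel)"
    using \<open>0 < \<rho>\<close> by (intro nn_integral_cos_gap D.sigma_finite_measure) auto
  also have "\<dots> \<le> (\<integral>\<^sup>+l. ennreal L * indicator {0..?a} l \<partial>lborel)"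
    using cos by (intro nn_integral_mono) (auto simp: indicator_def)
  also have "\<dots> = ennreal (L / \<rho>)"
    using \<open>0 < \<rho>\<close> \<open>0 \<le> L\<close> by (simp add: nn_integral_cmult_indicator ennreal_mult''[symmetric])
  also have "ennreal (8 * \<rho>) * ennreal (L / \<rho>) = ennreal (8 * L)"
    using \<open>0 < \<rho>\<close> \<open>0 \<le> L\<close> by (simp add: ennreal_mult[symmetric])
  finally show ?thesis using \<open>0 \<le> L\<close> by (simp add: mult_left_mono)
qed

section \<open>Maximal inequality, level times and running suprema\<close>

text \<open>Decompose by the first index k at which the partial sum leaves [-3a,3a]. Either the
  final sum exceeds a in modulus, which costs p, or the later increment exceeds 2a; the latter is
  independent of the past and has probability at most 2p. Neither symmetry nor moments
  enter.\<close>

lemma (in prob_space) etemadi_maximal_inequality: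
  fixes Z :: "nat \<Rightarrow> 'a \<Rightarrow> real"
  assumes ind: "indep_vars (\<lambda>_. borel) Z {..<n}"
    and p: "\<And>k. k \<le> n \<Longrightarrow> prob {\<omega> \<in> space M. a < \<bar>\<Sum>i<k. Z i \<omega>\<bar>} \<le> p"
  shows "prob {\<omega> \<in> space M. \<exists>k\<le>n. 3 * a < \<bar>\<Sum>i<k. Z i \<omega>\<bar>} \<le> 3 * p"
proof -
  define S where "S k \<omega> = (\<Sum>i<k. Z i \<omega>)" for k \<omega>
  define A where "A k = {\<omega> \<in> space M. 3 * a < \<bar>S k \<omega>\<bar> \<and> (\<forall>j<k. \<bar>S j \<omega>\<bar> \<le> 3 * a)}" for k
  have Z [measurable]: "i < n \<Longrightarrow> random_variable borel (Z i)" for i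
    using ind unfolding indep_vars_def by auto
  have S [measurable]: "k \<le> n \<Longrightarrow> random_variable borel (S k)" for k
    unfolding S_def by (intro borel_measurable_sum Z) auto
  have A: "k \<le> n \<Longrightarrow> A k \<in> events" for k
    unfolding A_def by measurable
  have p0: "0 \<le> p" using order_trans[OF measure_nonneg p[of 0]] by simp
  have disj: "disjoint_family_on A {..n}"
    unfolding disjoint_family_on_def A_def
  proof (intro ballI impI equalityI subsetI)
    fix j k \<omega> assume "j \<noteq> k" and
      *: "\<omega> \<in> {\<omega> \<in> space M. 3 * a < \<bar>S j \<omega>\<bar> \<and> (\<forall>i<j. \<bar>S i \<omega>\<bar> \<le> 3 * a)} \<inter>
        {\<omega> \<in> space M. 3 * a < \<bar>S k \<omega>\<bar> \<and> (\<forall>j<k. \<bar>S j \<omega>\<bar> \<le> 3 * a)}"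
    then consider "j < k" | "k < j" by linarith
    then show "\<omega> \<in> {}" using * by cases (auto simp: not_less[symmetric])
  qed auto
  have step: "prob (A k \<inter> {\<omega> \<in> space M. \<bar>S n \<omega>\<bar> \<le> a}) \<le> prob (A k) * (2 * p)" if k: "k \<le> n" for k
  proof -
    \<comment> \<open>Both events are written as preimages under disjoint blocks of coordinates, the
      indices below k and those from k on, so that independence of the blocks applies.\<close>
    let ?P = "\<lambda>I. PiM I (\<lambda>_. borel) :: (nat \<Rightarrow> real) measure"
    let ?R = "\<lambda>I \<omega>. restrict (\<lambda>i. Z i \<omega>) I"
    let ?A = "{f \<in> space (?P {..<k}). 3 * a < \<bar>\<Sum>i<k. f i\<bar> \<and> (\<forall>j<k. \<bar>\<Sum>i<j. f i\<bar> \<le> 3 * a)}"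
    let ?B = "{f \<in> space (?P {k..<n}). 2 * a < \<bar>\<Sum>i\<in>{k..<n}. f i\<bar>}"
    have [measurable]: "j \<le> k \<Longrightarrow> (\<lambda>f. \<Sum>i<j. f i) \<in> borel_measurable (?P {..<k})" for j
      by (intro borel_measurable_sum measurable_component_singleton) auto
    have [measurable]: "(\<lambda>f. \<Sum>i\<in>{k..<n}. f i) \<in> borel_measurable (?P {k..<n})"
      by (intro borel_measurable_sum measurable_component_singleton) auto
    have AB: "?A \<in> sets (?P {..<k})" "?B \<in> sets (?P {k..<n})"
      by measurable
    have "indep_var (?P {..<k}) (?R {..<k}) (?P {k..<n}) (?R {k..<n})"
      using k by (intro indep_var_restrict[OF ind]) auto
    from indep_varD[OF this AB]
    have ind': "prob ((\<lambda>\<omega>. (?R {..<k} \<omega>, ?R {k..<n} \<omega>)) -` (?A \<times> ?B) \<inter> space M) =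
      prob (?R {..<k} -` ?A \<inter> space M) * prob (?R {k..<n} -` ?B \<inter> space M)" .
    have diff: "S n \<omega> - S k \<omega> = (\<Sum>i\<in>{k..<n}. Z i \<omega>)" for \<omega>
    proof -
      have "{..<n} = {..<k} \<union> {k..<n}" using k by auto
      then have "S n \<omega> = (\<Sum>i\<in>{..<k} \<union> {k..<n}. Z i \<omega>)" by (simp only: S_def)
      also have "\<dots> = S k \<omega> + (\<Sum>i\<in>{k..<n}. Z i \<omega>)"
        unfolding S_def by (intro sum.union_disjoint) auto
      finally show ?thesis by simp
    qed
    have eqA: "?R {..<k} -` ?A \<inter> space M = A k"
      by (auto simp: A_def S_def space_PiM)
    have eqB: "?R {k..<n} -` ?B \<inter> space M = {\<omega> \<in> space M. 2 * a < \<bar>S n \<omega> - S k \<omega>\<bar>}"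
      by (auto simp: diff space_PiM)
    have "(\<lambda>\<omega>. (?R {..<k} \<omega>, ?R {k..<n} \<omega>)) -` (?A \<times> ?B) \<inter> space M
        = (?R {..<k} -` ?A \<inter> space M) \<inter> (?R {k..<n} -` ?B \<inter> space M)"
      by auto
    with ind' have eq: "prob (A k \<inter> {\<omega> \<in> space M. 2 * a < \<bar>S n \<omega> - S k \<omega>\<bar>}) =
        prob (A k) * prob {\<omega> \<in> space M. 2 * a < \<bar>S n \<omega> - S k \<omega>\<bar>}"
      by (simp only: eqA eqB)
    have "prob (A k \<inter> {\<omega> \<in> space M. \<bar>S n \<omega>\<bar> \<le> a}) \<le> prob (A k \<inter> {\<omega> \<in> space M. 2 * a < \<bar>S n \<omega> - S k \<omega>\<bar>})"
      using A[OF k] k by (intro finite_measure_mono) (auto simp: A_def)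
    also note eq
    also have "prob {\<omega> \<in> space M. 2 * a < \<bar>S n \<omega> - S k \<omega>\<bar>} \<le>
        prob ({\<omega> \<in> space M. a < \<bar>S n \<omega>\<bar>} \<union> {\<omega> \<in> space M. a < \<bar>S k \<omega>\<bar>})"
      using k by (intro finite_measure_mono) auto
    also have "\<dots> \<le> prob {\<omega> \<in> space M. a < \<bar>S n \<omega>\<bar>} + prob {\<omega> \<in> space M. a < \<bar>S k \<omega>\<bar>}"
      using k by (intro measure_Un_le) auto
    also have "\<dots> \<le> 2 * p" using p[of n] p[of k] k by (simp add: S_def)
    finally show ?thesis by (simp add: mult_left_mono)
  qed
  have "{\<omega> \<in> space M. \<exists>k\<le>n. 3 * a < \<bar>S k \<omega>\<bar>} \<subseteq>
      {\<omega> \<in> space M. a < \<bar>S n \<omega>\<bar>} \<union> (\<Union>k\<in>{..n}. A k \<inter> {\<omega> \<in> space M. \<bar>S n \<omega>\<bar> \<le> a})"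
  proof
    fix \<omega> assume "\<omega> \<in> {\<omega> \<in> space M. \<exists>k\<le>n. 3 * a < \<bar>S k \<omega>\<bar>}"
    then obtain k where \<omega>: "\<omega> \<in> space M" and "k \<le> n" and k: "3 * a < \<bar>S k \<omega>\<bar>" by auto
    let ?m = "LEAST k. 3 * a < \<bar>S k \<omega>\<bar>"
    have "3 * a < \<bar>S ?m \<omega>\<bar>" using k by (rule LeastI)
    moreover have "?m \<le> n" using Least_le[of "\<lambda>k. 3 * a < \<bar>S k \<omega>\<bar>", OF k] \<open>k \<le> n\<close> by simp
    moreover have "\<forall>j<?m. \<bar>S j \<omega>\<bar> \<le> 3 * a"
      using not_less_Least[of _ "\<lambda>k. 3 * a < \<bar>S k \<omega>\<bar>"] by (auto simp: not_less)
    ultimately have "\<omega> \<in> A ?m" "?m \<in> {..n}" using \<omega> by (auto simp: A_def)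
    then show "\<omega> \<in> {\<omega> \<in> space M. a < \<bar>S n \<omega>\<bar>} \<union> (\<Union>k\<in>{..n}. A k \<inter> {\<omega> \<in> space M. \<bar>S n \<omega>\<bar> \<le> a})"
      using \<omega> by (cases "a < \<bar>S n \<omega>\<bar>") auto
  qed
  then have "prob {\<omega> \<in> space M. \<exists>k\<le>n. 3 * a < \<bar>S k \<omega>\<bar>} \<le>
      prob ({\<omega> \<in> space M. a < \<bar>S n \<omega>\<bar>} \<union> (\<Union>k\<in>{..n}. A k \<inter> {\<omega> \<in> space M. \<bar>S n \<omega>\<bar> \<le> a}))"
    using A by (intro finite_measure_mono) auto
  also have "\<dots> \<le> prob {\<omega> \<in> space M. a < \<bar>S n \<omega>\<bar>} + prob (\<Union>k\<in>{..n}. A k \<inter> {\<omega> \<in> space M. \<bar>S n \<omega>\<bar> \<le> a})"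
    using A by (intro measure_Un_le) auto
  also have "\<dots> \<le> p + (\<Sum>k\<in>{..n}. prob (A k \<inter> {\<omega> \<in> space M. \<bar>S n \<omega>\<bar> \<le> a}))"
    using p[of n] A by (intro add_mono finite_measure_subadditive_finite) (auto simp: S_def)
  also have "\<dots> \<le> p + (\<Sum>k\<in>{..n}. prob (A k) * (2 * p))"
    using step by (intro add_left_mono sum_mono) auto
  also have "\<dots> = p + prob (\<Union>k\<in>{..n}. A k) * (2 * p)"
    using A disj by (subst finite_measure_finite_Union) (auto simp: sum_distrib_right)
  also have "\<dots> \<le> p + 1 * (2 * p)"
    using p0 by (intro add_left_mono mult_right_mono) auto
  finally show ?thesis by (simp add: S_def)
qed

lemma (in prob_space) prob_all_abs_le_power:
  fixes Z :: "nat \<Rightarrow> 'a \<Rightarrow> real"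
  assumes ind: "indep_vars (\<lambda>_. borel) Z {..<n}"
    and q: "\<And>i. i < n \<Longrightarrow> prob {\<omega> \<in> space M. \<bar>Z i \<omega>\<bar> \<le> c} \<le> q"
  shows "prob {\<omega> \<in> space M. \<forall>i<n. \<bar>Z i \<omega>\<bar> \<le> c} \<le> q ^ n"
proof (cases "n = 0")
  case False
  let ?A = "\<lambda>i. {x::real. \<bar>x\<bar> \<le> c}"
  have vimage: "Z i -` {x. \<bar>x\<bar> \<le> c} \<inter> space M = {\<omega> \<in> space M. \<bar>Z i \<omega>\<bar> \<le> c}" for i by auto
  have "{\<omega> \<in> space M. \<forall>i<n. \<bar>Z i \<omega>\<bar> \<le> c} = (\<Inter>i\<in>{..<n}. Z i -` ?A i \<inter> space M)"
    using False by auto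
  then have "prob {\<omega> \<in> space M. \<forall>i<n. \<bar>Z i \<omega>\<bar> \<le> c} = (\<Prod>i<n. prob (Z i -` ?A i \<inter> space M))"
    using False indep_varsD_finite[OF ind, of ?A] by auto
  also have "\<dots> = (\<Prod>i<n. prob {\<omega> \<in> space M. \<bar>Z i \<omega>\<bar> \<le> c})" by (simp only: vimage)
  also have "\<dots> \<le> (\<Prod>i<n. q)" using q by (intro prod_mono) auto
  finally show ?thesis by simp
qed simp

text \<open>The intermediate value theorem is applied from the previous time onwards, so the times
  increase although F may oscillate. The sequence is constant after index n because
  \<open>indep_increments\<close> speaks of sequences monotone on all of nat.\<close>

lemma continuous_level_times:
  fixes F :: "real \<Rightarrow> real"
  assumes F: "continuous_on {0..s} F" "F 0 = 0" and "0 \<le> s" and "0 < \<kappa>" and "real n * \<kappa> \<le> F s"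
  shows "\<exists>\<tau>::nat \<Rightarrow> real. mono \<tau> \<and> \<tau> 0 = 0 \<and> (\<forall>k. 0 \<le> \<tau> k \<and> \<tau> k \<le> s) \<and> (\<forall>k\<le>n. F (\<tau> k) = real k * \<kappa>)"
  using assms(5)
proof (induction n)
  case 0
  then show ?case using assms by (intro exI[of _ "\<lambda>_. 0"]) (auto intro: monoI)
next
  case (Suc n)
  then have "real n * \<kappa> \<le> F s" using \<open>0 < \<kappa>\<close> by (simp add: algebra_simps)
  with Suc.IH obtain \<tau> where \<tau>: "mono \<tau>" "\<tau> 0 = 0" "\<And>k. 0 \<le> \<tau> k" "\<And>k. \<tau> k \<le> s"
    "\<And>k. k \<le> n \<Longrightarrow> F (\<tau> k) = real k * \<kappa>" by auto
  obtain x where x: "\<tau> n \<le> x" "x \<le> s" "F x = real (Suc n) * \<kappa>"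
    using IVT'[of F "\<tau> n" "real (Suc n) * \<kappa>" s] \<tau>(5)[of n] \<tau>(3,4)[of n] Suc.prems \<open>0 < \<kappa>\<close>
      continuous_on_subset[OF F(1), of "{\<tau> n..s}"] by auto
  let ?\<tau> = "\<lambda>k. if k \<le> n then \<tau> k else x"
  have "mono ?\<tau>"
  proof (rule monoI)
    fix i j :: nat assume "i \<le> j"
    moreover have "i \<le> n \<Longrightarrow> \<tau> i \<le> x" using monoD[OF \<tau>(1), of i n] x by simp
    ultimately show "?\<tau> i \<le> ?\<tau> j" using monoD[OF \<tau>(1)] by auto
  qed
  moreover have "0 \<le> x" using x(1) \<tau>(3)[of n] by simp
  ultimately show ?case
    using \<tau> x by (intro exI[of _ ?\<tau>]) (auto simp: le_Suc_eq)
qed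

text \<open>Weakens geometric decay to decay like 1/n, which is all that a bound by 1/y needs.
  Bernoulli's inequality gives (4/3)^n \<ge> 1 + n/3.\<close>

lemma geometric_le_harmonic: "(3 / 4) ^ n * (real n + 1) \<le> 3"
proof -
  have "(real n + 1) / 3 \<le> 1 + real n * (1 / 3)" by simp
  also have "\<dots> \<le> (1 + 1 / 3) ^ n" by (rule Bernoulli_inequality) simp
  finally have "(3 / 4) ^ n * ((real n + 1) / 3) \<le> (3 / 4) ^ n * (4 / 3) ^ n"
    by (intro mult_left_mono) auto
  also have "\<dots> = 1" by (simp add: power_mult_distrib[symmetric])
  finally show ?thesis by simp
qed

text \<open>Gives continuity of \<open>M_star\<close> in time. If [p,q] lies in the interval around
  t where f varies little, the values on (p,q] exceed f p, hence the supremum up to p, by at most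
  e/2.\<close>

lemma continuous_running_sup:
  fixes f :: "real \<Rightarrow> real"
  assumes f: "continuous_on {0..} f"
  shows "continuous_on {0..} (\<lambda>t. SUP s\<in>{0..t}. f s)"
proof -
  have bdd: "bdd_above (f ` {0..t})" for t
  proof -
    have "compact (f ` {0..t})"
      by (intro compact_continuous_image continuous_on_subset[OF f]) auto
    then show ?thesis by (intro bounded_imp_bdd_above compact_imp_bounded)
  qed
  show ?thesis
    unfolding continuous_on_iff
  proof (intro ballI allI impI)
    fix t e :: real assume t: "t \<in> {0..}" and e: "0 < e"
    obtain d where d: "0 < d" "\<And>s. s \<in> {0..} \<Longrightarrow> dist s t < d \<Longrightarrow> dist (f s) (f t) < e / 4"
      using f t e unfolding continuous_on_iff by (metis zero_less_divide_iff zero_less_numeral)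
    have close: "\<bar>(SUP s\<in>{0..q}. f s) - (SUP s\<in>{0..p}. f s)\<bar> \<le> e / 2"
      if pq: "0 \<le> p" "p \<le> q" "\<And>s. p \<le> s \<Longrightarrow> s \<le> q \<Longrightarrow> dist s t < d" for p q
    proof -
      have "(SUP s\<in>{0..p}. f s) \<le> (SUP s\<in>{0..q}. f s)"
        using pq by (intro cSUP_subset_mono bdd) auto
      moreover have "(SUP s\<in>{0..q}. f s) \<le> (SUP s\<in>{0..p}. f s) + e / 2"
      proof (rule cSUP_least)
        fix s assume s: "s \<in> {0..q}"
        show "f s \<le> (SUP s\<in>{0..p}. f s) + e / 2"
        proof (cases "s \<le> p")
          case True
          then have "f s \<le> (SUP s\<in>{0..p}. f s)" using s by (intro cSUP_upper bdd) auto
          then show ?thesis using e by simp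
        next
          case False
          have "\<bar>f s - f t\<bar> < e / 4" "\<bar>f p - f t\<bar> < e / 4"
            using d(2)[of s] d(2)[of p] pq s False by (auto simp: dist_real_def)
          moreover have "f p \<le> (SUP s\<in>{0..p}. f s)" using pq by (intro cSUP_upper bdd) auto
          ultimately show ?thesis by linarith
        qed
      qed (use pq in auto)
      ultimately show ?thesis by linarith
    qed
    show "\<exists>d>0. \<forall>s\<in>{0..}. dist s t < d \<longrightarrow> dist (SUP s\<in>{0..s}. f s) (SUP s\<in>{0..t}. f s) < e"
    proof (intro exI[of _ d] conjI ballI impI d)
      fix s assume s: "s \<in> {0..}" "dist s t < d"
      have "\<bar>(SUP s\<in>{0..s}. f s) - (SUP s\<in>{0..t}. f s)\<bar> \<le> e / 2"
      proof (cases "s \<le> t")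
        case True
        then have "\<bar>(SUP s\<in>{0..t}. f s) - (SUP s\<in>{0..s}. f s)\<bar> \<le> e / 2"
          using s by (intro close) (auto simp: dist_real_def)
        then show ?thesis by (simp only: abs_minus_commute)
      next
        case False
        then show ?thesis using s t by (intro close) (auto simp: dist_real_def)
      qed
      then show "dist (SUP s\<in>{0..s}. f s) (SUP s\<in>{0..t}. f s) < e"
        using e unfolding dist_real_def by linarith
    qed
  qed
qed

section \<open>Regularity of y in time and its bound on the exponent\<close>

context levy_triplet
begin

lemma M_fun_cont: "0 < r \<Longrightarrow> continuous_on {0..} (\<lambda>t. M_fun B \<nu> t r)"
proof -
  assume r: "0 < r"
  have "continuous_on {0..} (\<lambda>t. \<bar>drift t r\<bar> / r)"
    using r by (intro continuous_intros drift_cont) auto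
  then show ?thesis by (rule continuous_on_eq) (simp add: M_fun_eq r)
qed

lemma M_fun_bdd: "0 < r \<Longrightarrow> bdd_above ((\<lambda>s. M_fun B \<nu> s r) ` {0..t})"
  by (intro bounded_imp_bdd_above compact_imp_bounded compact_continuous_image
      continuous_on_subset[OF M_fun_cont]) auto

lemma M_fun_le_M_star: "0 < r \<Longrightarrow> 0 \<le> s \<Longrightarrow> s \<le> t \<Longrightarrow> M_fun B \<nu> s r \<le> M_star B \<nu> t r"
  unfolding M_star_def by (intro cSUP_upper M_fun_bdd) auto

lemma M_star_mono: "0 < r \<Longrightarrow> 0 \<le> s \<Longrightarrow> s \<le> t \<Longrightarrow> M_star B \<nu> s r \<le> M_star B \<nu> t r"
  unfolding M_star_def by (intro cSUP_subset_mono M_fun_bdd) auto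

lemma M_star_0: "0 < r \<Longrightarrow> M_star B \<nu> 0 r = 0"
  by (simp add: M_star_def M_fun_eq drift_0)

lemma M_star_nonneg: "0 < r \<Longrightarrow> 0 \<le> t \<Longrightarrow> 0 \<le> M_star B \<nu> t r"
  using M_star_mono[of r 0 t] by (simp add: M_star_0)

lemma y_real_eq: "0 < r \<Longrightarrow> 0 \<le> t \<Longrightarrow> y_real B C \<nu> t r = mass t r + M_star B \<nu> t r"
  by (simp add: y_real_def mass_eq)

lemma y_real_mono: "0 < r \<Longrightarrow> 0 \<le> s \<Longrightarrow> s \<le> t \<Longrightarrow> y_real B C \<nu> s r \<le> y_real B C \<nu> t r"
  by (simp add: y_real_eq add_mono mass_mono M_star_mono)

lemma y_real_0: "0 < r \<Longrightarrow> y_real B C \<nu> 0 r = 0"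
  by (simp add: y_real_eq mass_0 M_star_0)

lemma y_real_nonneg: "0 < r \<Longrightarrow> 0 \<le> t \<Longrightarrow> 0 \<le> y_real B C \<nu> t r"
  by (simp add: y_real_eq mass_nonneg M_star_nonneg)

lemma y_real_cont: "0 < r \<Longrightarrow> continuous_on {0..} (\<lambda>t. y_real B C \<nu> t r)"
proof -
  assume r: "0 < r"
  have "continuous_on {0..} (\<lambda>t. mass t r + M_star B \<nu> t r)"
    using r unfolding M_star_def by (intro continuous_on_add mass_cont continuous_running_sup M_fun_cont)
  then show ?thesis by (rule continuous_on_eq) (simp add: y_real_eq r)
qed

lemma norm_psi_le_y:
  assumes "0 \<le> t" and r: "0 < r"
  shows "norm (psi t l) \<le> (\<bar>l * r\<bar> + (l * r)\<^sup>2 / 2 + 2) * y_real B C \<nu> t r"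
proof -
  let ?c = "(l * r)\<^sup>2 / 2 + 2"
  have "norm (psi t l) \<le> norm (psi t l - \<i> * of_real (l * drift t r)) + norm (\<i> * complex_of_real (l * drift t r))"
    by (subst add.commute) (rule norm_triangle_sub)
  also have "norm (\<i> * complex_of_real (l * drift t r)) = \<bar>l * r\<bar> * M_fun B \<nu> t r"
    using r by (auto simp: M_fun_eq assms(1) norm_mult abs_mult abs_of_pos)
  also have "\<dots> \<le> \<bar>l * r\<bar> * M_star B \<nu> t r"
    using assms by (intro mult_left_mono M_fun_le_M_star) auto
  also have "norm (psi t l - \<i> * of_real (l * drift t r)) \<le> ?c * mass t r"
    by (rule norm_psi_drift_le[OF assms])
  also have "?c * mass t r + \<bar>l * r\<bar> * M_star B \<nu> t r
      \<le> (\<bar>l * r\<bar> + ?c) * mass t r + (\<bar>l * r\<bar> + ?c) * M_star B \<nu> t r"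
    using assms by (intro add_mono[OF mult_right_mono mult_right_mono] mass_nonneg M_star_nonneg) auto
  finally show ?thesis using assms by (simp only: y_real_eq distrib_left add.assoc)
qed

end

text \<open>Mean value inequality on the left half-plane, which is convex and on which the
  derivative of exp has modulus at most 1.\<close>

lemma norm_exp_minus_one_le:
  fixes z :: complex
  assumes "Re z \<le> 0"
  shows "norm (1 - exp z) \<le> norm z"
proof -
  have "norm (exp 0 - exp z) \<le> 1 * norm (0 - z)"
  proof (rule field_differentiable_bound[where S = "{z. Re z \<le> 0}" and f' = exp])
    show "(exp has_field_derivative exp w) (at w within {z. Re z \<le> 0})" for w :: complex
      by (auto intro!: derivative_eq_intros)
  qed (use assms convex_halfspace_Re_le in auto)
  then show ?thesis by simp
qed

section \<open>Estimates for real additive processes\<close>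

locale additive_levy = prob_space M + levy_triplet \<nu> B C
  for M :: "'w measure" and \<nu> :: "real \<Rightarrow> real measure" and B C :: "real \<Rightarrow> real" +
  fixes X :: "real \<Rightarrow> 'w \<Rightarrow> real"
  assumes additive: "additive_process M X"
    and char_X: "\<And>t l. 0 \<le> t \<Longrightarrow> (CLINT \<omega>|M. iexp (l * X t \<omega>)) = exp (psi t l)"

lemma additive_levyI:
  assumes "prob_space M" and "additive_process M X" and "has_characteristics M X B C \<nu>"
  shows "additive_levy M \<nu> B C X"
proof -
  interpret prob_space M by fact
  interpret levy_triplet \<nu> B C
    using assms(3) by unfold_locales (auto simp: has_characteristics_def)
  show ?thesis
  proof
    show "(CLINT \<omega>|M. iexp (l * X t \<omega>)) = exp (psi t l)" if "0 \<le> t" for t l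
      using assms(3) that unfolding has_characteristics_def psi_def compensated_def by blast
  qed fact
qed

context additive_levy
begin

lemma X_measurable [measurable]: "0 \<le> t \<Longrightarrow> X t \<in> borel_measurable M"
  using additive by (simp add: additive_process_def)

lemma X_0: "\<omega> \<in> space M \<Longrightarrow> X 0 \<omega> = 0"
  using additive by (simp add: additive_process_def)

lemma indep_vars_increments:
  fixes \<tau> :: "nat \<Rightarrow> real"
  assumes "0 \<le> \<tau> 0" and "mono \<tau>"
  shows "indep_vars (\<lambda>_. borel) (\<lambda>i \<omega>. X (\<tau> (Suc i)) \<omega> - X (\<tau> i) \<omega>) {..<n}"
  using additive assms by (simp add: additive_process_def indep_increments_def)

text \<open>X_t is the sum of the independent variables X_s and X_t - X_s, and the factor
  \<open>exp (psi s l)\<close> can be divided out because exp has no zeros.\<close>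

lemma char_increment:
  assumes st: "0 \<le> s" "s \<le> t"
  shows "(CLINT \<omega>|M. iexp (l * (X t \<omega> - X s \<omega>))) = exp (psi t l - psi s l)"
proof -
  have t: "0 \<le> t" using st by simp
  note [measurable] = X_measurable[OF st(1)] X_measurable[OF t] X_measurable[OF order_refl]
  define \<tau> :: "nat \<Rightarrow> real" where "\<tau> i = (if i = 0 then 0 else if i = 1 then s else t)" for i
  have "mono \<tau>" using st by (auto simp: mono_def \<tau>_def)
  moreover have "0 \<le> \<tau> 0" by (simp add: \<tau>_def)
  ultimately have ind: "indep_vars (\<lambda>_. borel) (\<lambda>i \<omega>. X (\<tau> (Suc i)) \<omega> - X (\<tau> i) \<omega>) {..<2}"
    by (intro indep_vars_increments)
  have "char (distr M borel (\<lambda>\<omega>. \<Sum>i<2. X (\<tau> (Suc i)) \<omega> - X (\<tau> i) \<omega>)) l =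
      (\<Prod>i<2. char (distr M borel (\<lambda>\<omega>. X (\<tau> (Suc i)) \<omega> - X (\<tau> i) \<omega>)) l)"
    by (rule char_distr_sum[OF ind])
  then have "(CLINT \<omega>|M. iexp (l * (X t \<omega> - X 0 \<omega>))) =
      (CLINT \<omega>|M. iexp (l * (X s \<omega> - X 0 \<omega>))) * (CLINT \<omega>|M. iexp (l * (X t \<omega> - X s \<omega>)))"
    by (simp add: char_def integral_distr lessThan_nat_numeral lessThan_Suc \<tau>_def mult.commute)
  moreover have "(CLINT \<omega>|M. iexp (l * (X r \<omega> - X 0 \<omega>))) = exp (psi r l)" if "0 \<le> r" for r
    unfolding char_X[OF that, symmetric]
    by (intro Bochner_Integration.integral_cong) (simp_all add: X_0)
  ultimately show ?thesis using st t by (simp add: exp_diff field_simps)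
qed

text \<open>The tail level a and the level r of y are kept apart: in dimension d this is applied
  with a = r/(3d), whereas y has to be taken at r.\<close>

lemma prob_abs_gt_le:
  assumes st: "0 \<le> s" "s \<le> t" and "0 < a" "0 < r"
  shows "prob {\<omega> \<in> space M. a < \<bar>X s \<omega>\<bar>} \<le> 8 * ((r / a + (r / a)\<^sup>2 / 2 + 2) * y_real B C \<nu> t r)"
proof (rule prob_abs_gt_le_char)
  fix l assume l: "0 \<le> l" "l \<le> 1 / a"
  have lr: "\<bar>l * r\<bar> \<le> r / a" using l assms by (simp add: field_simps abs_mult)
  then have "(l * r)\<^sup>2 \<le> (r / a)\<^sup>2" by (rule power2_le_iff_abs_le[THEN iffD2, rotated]) (use assms in auto)
  have "norm (1 - (CLINT \<omega>|M. iexp (l * X s \<omega>))) \<le> norm (psi s l)"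
    unfolding char_X[OF st(1)] using st by (intro norm_exp_minus_one_le Re_psi_nonpos)
  also have "\<dots> \<le> (\<bar>l * r\<bar> + (l * r)\<^sup>2 / 2 + 2) * y_real B C \<nu> s r"
    using assms by (intro norm_psi_le_y)
  also have "\<dots> \<le> (r / a + (r / a)\<^sup>2 / 2 + 2) * y_real B C \<nu> t r"
    using lr \<open>(l * r)\<^sup>2 \<le> (r / a)\<^sup>2\<close> assms
    by (intro mult_mono y_real_mono y_real_nonneg add_mono divide_right_mono) (auto intro!: add_nonneg_nonneg)
  finally show "norm (1 - (CLINT \<omega>|M. iexp (l * X s \<omega>))) \<le> (r / a + (r / a)\<^sup>2 / 2 + 2) * y_real B C \<nu> t r" .
qed (use assms in auto)

text \<open>Etemadi's inequality divides the level by 3 and multiplies the probability by 3; hence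
  the ratio 3/a and the constant 24 = 3 * 8.\<close>

lemma prob_max_gt_le:
  fixes \<tau> :: "nat \<Rightarrow> real"
  assumes "0 < a" and "0 < r" and \<tau>: "mono \<tau>" "\<tau> 0 = 0" and "\<tau> n \<le> t"
  shows "prob {\<omega> \<in> space M. \<exists>k\<le>n. a * r < \<bar>X (\<tau> k) \<omega>\<bar>} \<le>
    24 * ((3 / a + (3 / a)\<^sup>2 / 2 + 2) * y_real B C \<nu> t r)"
proof -
  have \<tau>0: "0 \<le> \<tau> k" for k using monoD[OF \<tau>(1), of 0 k] \<tau>(2) by simp
  have \<tau>t: "k \<le> n \<Longrightarrow> \<tau> k \<le> t" for k using monoD[OF \<tau>(1), of k n] \<open>\<tau> n \<le> t\<close> by simp
  have sum: "(\<Sum>i<k. X (\<tau> (Suc i)) \<omega> - X (\<tau> i) \<omega>) = X (\<tau> k) \<omega>" if "\<omega> \<in> space M" for k \<omega>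
    using X_0[OF that] \<tau>(2) sum_lessThan_telescope[of "\<lambda>i. X (\<tau> i) \<omega>" k] by simp
  have "prob {\<omega> \<in> space M. \<exists>k\<le>n. 3 * (a * r / 3) < \<bar>\<Sum>i<k. X (\<tau> (Suc i)) \<omega> - X (\<tau> i) \<omega>\<bar>}
      \<le> 3 * (8 * ((3 / a + (3 / a)\<^sup>2 / 2 + 2) * y_real B C \<nu> t r))"
  proof (rule etemadi_maximal_inequality[OF indep_vars_increments])
    fix k assume "k \<le> n"
    have "{\<omega> \<in> space M. a * r / 3 < \<bar>\<Sum>i<k. X (\<tau> (Suc i)) \<omega> - X (\<tau> i) \<omega>\<bar>}
        = {\<omega> \<in> space M. a * r / 3 < \<bar>X (\<tau> k) \<omega>\<bar>}"
      using sum by auto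
    then show "prob {\<omega> \<in> space M. a * r / 3 < \<bar>\<Sum>i<k. X (\<tau> (Suc i)) \<omega> - X (\<tau> i) \<omega>\<bar>}
        \<le> 8 * ((3 / a + (3 / a)\<^sup>2 / 2 + 2) * y_real B C \<nu> t r)"
      using prob_abs_gt_le[OF \<tau>0 \<tau>t, of k "a * r / 3" r] assms \<open>k \<le> n\<close> by simp
  qed (use \<tau> in auto)
  moreover have "{\<omega> \<in> space M. \<exists>k\<le>n. 3 * (a * r / 3) < \<bar>\<Sum>i<k. X (\<tau> (Suc i)) \<omega> - X (\<tau> i) \<omega>\<bar>}
      = {\<omega> \<in> space M. \<exists>k\<le>n. a * r < \<bar>X (\<tau> k) \<omega>\<bar>}"
    using sum by auto
  ultimately show ?thesis by simp
qed

text \<open>If |X_t - X_s| \<le> 2r, the phase is at most 1/2 in modulus and its cosine at least 1 -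
  2 (1/4)^2 = 7/8; elsewhere the cosine is at least -1. The expectation is therefore at least
  (15/8)p - 1 with p > 3/4, which exceeds 1/4.\<close>

lemma Re_char_increment_ge:
  assumes st: "0 \<le> s" "s \<le> t" and "0 < r" and l: "\<bar>l\<bar> \<le> 1 / (4 * r)"
    and conc: "3 / 4 < prob {\<omega> \<in> space M. \<bar>X t \<omega> - X s \<omega>\<bar> \<le> 2 * r}"
  shows "1 / 4 \<le> Re (exp (psi t l - psi s l))"
proof -
  let ?Z = "\<lambda>\<omega>. X t \<omega> - X s \<omega>" and ?A = "{\<omega> \<in> space M. \<bar>X t \<omega> - X s \<omega>\<bar> \<le> 2 * r}"
  have t: "0 \<le> t" using st by simp
  note [measurable] = X_measurable[OF st(1)] X_measurable[OF t]
  have int: "integrable M (\<lambda>\<omega>. iexp (l * ?Z \<omega>))"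
    by (intro integrable_const_bound[where B = 1]) auto
  have "15 / 8 * indicator ?A \<omega> - 1 \<le> cos (l * ?Z \<omega>)" if "\<omega> \<in> space M" for \<omega>
  proof (cases "\<omega> \<in> ?A")
    case True
    have "\<bar>l * ?Z \<omega>\<bar> \<le> 1 / (4 * r) * (2 * r)"
      unfolding abs_mult using l True by (intro mult_mono) auto
    then have "\<bar>l * ?Z \<omega> / 2\<bar> \<le> 1 / 4" using \<open>0 < r\<close> by simp
    then have "\<bar>sin (l * ?Z \<omega> / 2)\<bar> \<le> 1 / 4" using abs_sin_x_le_abs_x order_trans by blast
    then have "(sin (l * ?Z \<omega> / 2))\<^sup>2 \<le> (1 / 4)\<^sup>2"
      by (rule power2_le_iff_abs_le[THEN iffD2, rotated]) simp
    moreover have "cos (l * ?Z \<omega>) = 1 - 2 * (sin (l * ?Z \<omega> / 2))\<^sup>2"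
      using cos_double_sin[of "l * ?Z \<omega> / 2"] by simp
    ultimately have "7 / 8 \<le> cos (l * ?Z \<omega>)" by (simp add: power_divide)
    then show ?thesis using True by simp
  qed simp
  then have "(\<integral>\<omega>. 15 / 8 * indicator ?A \<omega> - 1 \<partial>M) \<le> (\<integral>\<omega>. cos (l * ?Z \<omega>) \<partial>M)"
    by (intro integral_mono integrable_const_bound[where B = 1]) (auto simp: indicator_def)
  also have "(\<integral>\<omega>. 15 / 8 * indicator ?A \<omega> - 1 \<partial>M) = 15 / 8 * prob ?A - 1"
  proof -
    have "?A \<in> events" by measurable
    then have "integrable M (indicat_real ?A)" "expectation (indicat_real ?A) = prob ?A"
      by (auto simp: less_top[symmetric])
    then show ?thesis
      by (subst Bochner_Integration.integral_diff) (auto simp: prob_space)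
  qed
  also have "(\<integral>\<omega>. cos (l * ?Z \<omega>) \<partial>M) = Re (CLINT \<omega>|M. iexp (l * ?Z \<omega>))"
    using integral_Re[OF int] by (simp add: Re_exp)
  finally show ?thesis
    using conc unfolding char_increment[OF st] by simp
qed

text \<open>Concentration would keep the modulus of the characteristic function at 1/4 or more on
  all frequencies in [0,1/(4r)]. Then Re psi drops by at most ln 4 there, and the mass grows by at
  most 160 ln 4 < 320.\<close>

lemma mass_increment_conc:
  assumes st: "0 \<le> s" "s \<le> t" and "0 < r" and "320 \<le> mass t r - mass s r"
  shows "prob {\<omega> \<in> space M. \<bar>X t \<omega> - X s \<omega>\<bar> \<le> 2 * r} \<le> 3 / 4"
proof (rule ccontr)
  assume "\<not> ?thesis"
  then have conc: "3 / 4 < prob {\<omega> \<in> space M. \<bar>X t \<omega> - X s \<omega>\<bar> \<le> 2 * r}" by simp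
  have "mass t r - mass s r \<le> 160 * ln 4"
  proof (rule mass_increment_le[OF st \<open>0 < r\<close>])
    fix l assume l: "0 \<le> l" "l \<le> 1 / (4 * r)"
    have "1 / 4 \<le> Re (exp (psi t l - psi s l))"
      using l assms conc by (intro Re_char_increment_ge) auto
    also have "\<dots> \<le> norm (exp (psi t l - psi s l))" by (rule complex_Re_le_cmod)
    also have "\<dots> = exp (Re (psi t l) - Re (psi s l))" by (simp add: norm_exp_eq_Re)
    finally have "ln (1 / 4) \<le> ln (exp (Re (psi t l) - Re (psi s l)))"
      by (subst ln_le_cancel_iff) auto
    then show "Re (psi s l) - Re (psi t l) \<le> ln 4" by (simp add: ln_div)
  qed simp
  moreover have "ln 4 < (2::real)"
  proof -
    have "ln (2 * 2) = ln 2 + ln (2::real)" by (rule ln_mult_pos) auto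
    then show ?thesis using ln_2_less_1 by simp
  qed
  ultimately show False using assms by simp
qed

text \<open>A phase increment of \<open>\<pi>\<close> makes the characteristic function at \<open>1/(4r)\<close> negative, whereas
  concentration of the increment in \<open>[-2r,2r]\<close> would make its real part positive.\<close>

lemma phase_increment_conc:
  assumes st: "0 \<le> s" "s \<le> t" and "0 < r"
    and "\<bar>Im (psi t (1 / (4 * r))) - Im (psi s (1 / (4 * r)))\<bar> = pi"
  shows "prob {\<omega> \<in> space M. \<bar>X t \<omega> - X s \<omega>\<bar> \<le> 2 * r} \<le> 3 / 4"
proof (rule ccontr)
  assume "\<not> ?thesis"
  then have "1 / 4 \<le> Re (exp (psi t (1 / (4 * r)) - psi s (1 / (4 * r))))"
    using assms by (intro Re_char_increment_ge) auto
  also have "\<dots> = - exp (Re (psi t (1 / (4 * r))) - Re (psi s (1 / (4 * r))))"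
    using assms(4) by (auto simp: Re_exp abs_if split: if_splits)
      (metis cos_minus cos_pi minus_diff_eq mult_minus1_right)
  finally show False using exp_gt_zero[of "Re (psi t (1 / (4 * r))) - Re (psi s (1 / (4 * r)))"] by linarith
qed

text \<open>A path that stays in \<open>[-r,r]\<close> has all its increments in \<open>[-2r,2r]\<close>. By continuity \<open>F\<close> makes
  about \<open>F s / \<kappa>\<close> consecutive increments of size \<open>\<kappa>\<close>, each survived with probability at most 3/4.\<close>

lemma stay_bound:
  assumes F: "continuous_on {0..} F" "F 0 = (0::real)" and "0 < \<kappa>"
    and conc: "\<And>p q. 0 \<le> p \<Longrightarrow> p \<le> q \<Longrightarrow> F q - F p = \<kappa> \<Longrightarrow>
      prob {\<omega> \<in> space M. \<bar>X q \<omega> - X p \<omega>\<bar> \<le> 2 * r} \<le> 3 / 4"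
    and s: "0 \<le> s" and E: "E \<in> events" "\<And>\<omega> q. \<omega> \<in> E \<Longrightarrow> 0 \<le> q \<Longrightarrow> q \<le> s \<Longrightarrow> \<bar>X q \<omega>\<bar> \<le> r"
  shows "prob E * F s \<le> 3 * \<kappa>"
proof (cases "F s \<le> 0")
  case True
  then have "prob E * F s \<le> 0" by (simp add: mult_nonneg_nonpos)
  then show ?thesis using \<open>0 < \<kappa>\<close> by simp
next
  case False
  \<comment> \<open>Rounding down leaves F s below (n + 1)\<kappa>; this is the n + 1 in
    \<open>geometric_le_harmonic\<close>.\<close>
  let ?n = "nat \<lfloor>F s / \<kappa>\<rfloor>"
  have "0 \<le> F s / \<kappa>" using False \<open>0 < \<kappa>\<close> by simp
  then have "real ?n \<le> F s / \<kappa>" "F s / \<kappa> \<le> real ?n + 1" by linarith+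
  then have n: "real ?n * \<kappa> \<le> F s" "F s \<le> (real ?n + 1) * \<kappa>"
    using \<open>0 < \<kappa>\<close> by (simp_all add: field_simps)
  obtain \<tau> :: "nat \<Rightarrow> real" where \<tau>: "mono \<tau>" "\<tau> 0 = 0" "\<And>k. 0 \<le> \<tau> k" "\<And>k. \<tau> k \<le> s"
    "\<And>k. k \<le> ?n \<Longrightarrow> F (\<tau> k) = real k * \<kappa>"
    using continuous_level_times[OF continuous_on_subset[OF F(1)] F(2) s \<open>0 < \<kappa>\<close> n(1)] by auto
  let ?Z = "\<lambda>i \<omega>. X (\<tau> (Suc i)) \<omega> - X (\<tau> i) \<omega>"
  have [measurable]: "X (\<tau> k) \<in> borel_measurable M" for k using \<tau>(3) by (rule X_measurable)
  have "prob E \<le> prob {\<omega> \<in> space M. \<forall>i<?n. \<bar>?Z i \<omega>\<bar> \<le> 2 * r}"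
  proof (intro finite_measure_mono subsetI CollectI conjI allI impI)
    fix \<omega> i assume "\<omega> \<in> E"
    then have "\<bar>X (\<tau> (Suc i)) \<omega>\<bar> \<le> r" "\<bar>X (\<tau> i) \<omega>\<bar> \<le> r" using E(2) \<tau> by auto
    then show "\<bar>?Z i \<omega>\<bar> \<le> 2 * r" by linarith
  qed (use sets.sets_into_space[OF E(1)] in auto)
  also have "\<dots> \<le> (3 / 4) ^ ?n"
  proof (intro prob_all_abs_le_power indep_vars_increments conc)
    show "F (\<tau> (Suc i)) - F (\<tau> i) = \<kappa>" if "i < ?n" for i
      using that \<tau>(5)[of "Suc i"] \<tau>(5)[of i] by (simp add: algebra_simps)
  qed (use \<tau> in \<open>auto intro: monoD\<close>)
  finally have "prob E * F s \<le> (3 / 4) ^ ?n * ((real ?n + 1) * \<kappa>)"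
    using n False by (intro mult_mono) auto
  also have "\<dots> \<le> 3 * \<kappa>"
    using geometric_le_harmonic[of ?n] \<open>0 < \<kappa>\<close> by (simp add: mult.assoc[symmetric] mult_right_mono del: of_nat_nat)
  finally show ?thesis .
qed

text \<open>E is an arbitrary event on which the path stays small, so that one event defined by the
  vector process can be used for every component. The constants: 3 * 320 = 960 for the mass, 4 * 3
  pi + 12 * 960 < 11600 for the drift, and 960 + 11600 < 12600.\<close>

lemma prob_stay_le:
  assumes "0 \<le> t" and r: "0 < r"
    and E: "E \<in> events" "\<And>\<omega> q. \<omega> \<in> E \<Longrightarrow> 0 \<le> q \<Longrightarrow> q \<le> t \<Longrightarrow> \<bar>X q \<omega>\<bar> \<le> r"
  shows "prob E * y_real B C \<nu> t r \<le> 12600"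
proof -
  let ?l = "1 / (4 * r)"
  have mass: "prob E * mass t r \<le> 960"
    using stay_bound[OF mass_cont[OF r] mass_0, of 320 r t E] mass_increment_conc r E assms(1) by simp
  have M_fun: "prob E * M_fun B \<nu> s r \<le> 11600" if s: "0 \<le> s" "s \<le> t" for s
  proof -
    let ?F = "\<lambda>q. Im (psi q ?l)"
    have ph: "prob {\<omega> \<in> space M. \<bar>X q \<omega> - X p \<omega>\<bar> \<le> 2 * r} \<le> 3 / 4"
      if "0 \<le> p" "p \<le> q" "\<bar>?F q - ?F p\<bar> = pi" for p q
      using that r by (intro phase_increment_conc) auto
    \<comment> \<open>The phase can move in either direction, so \<open>stay_bound\<close> is
      applied to \<open>?F\<close> and to its negative.\<close>
    have "prob E * ?F s \<le> 3 * pi"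
      using ph pi_gt_zero by (intro stay_bound[where r = r] Im_psi_cont E s) (use s in \<open>auto simp: psi_0\<close>)
    moreover have "prob E * (- ?F s) \<le> 3 * pi"
    proof (rule stay_bound[where r = r and F = "\<lambda>q. - ?F q"])
      show "prob {\<omega> \<in> space M. \<bar>X q \<omega> - X p \<omega>\<bar> \<le> 2 * r} \<le> 3 / 4"
        if "0 \<le> p" "p \<le> q" "- ?F q - - ?F p = pi" for p q
      proof -
        have "\<bar>?F q - ?F p\<bar> = pi" using that pi_gt_zero by linarith
        with that show ?thesis by (intro ph)
      qed
    qed (use s E in \<open>auto simp: psi_0 intro!: continuous_intros Im_psi_cont\<close>)
    ultimately have Im: "prob E * \<bar>?F s\<bar> \<le> 3 * pi" by (simp add: abs_if)
    \<comment> \<open>From the phase back to the drift: at frequency 1/(4r) they differ by at most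
      (1/32 + 2) times the mass, and the mass is already controlled.\<close>
    have "Im (psi s ?l - \<i> * of_real (?l * drift s r)) = ?F s - ?l * drift s r" by simp
    then have "\<bar>?F s - ?l * drift s r\<bar> \<le> norm (psi s ?l - \<i> * of_real (?l * drift s r))"
      using abs_Im_le_cmod[of "psi s ?l - \<i> * of_real (?l * drift s r)"] by simp
    also have "\<dots> \<le> ((?l * r)\<^sup>2 / 2 + 2) * mass s r"
      by (rule norm_psi_drift_le[OF s(1) r])
    also have "\<dots> \<le> 3 * mass t r"
      using r s by (intro mult_mono mass_mono mass_nonneg) (auto simp: power_divide)
    finally have "\<bar>?l * drift s r\<bar> \<le> \<bar>?F s\<bar> + 3 * mass t r" by linarith
    moreover have "\<bar>?l * drift s r\<bar> = M_fun B \<nu> s r / 4"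
      using r by (simp add: M_fun_eq s abs_mult)
    ultimately have "M_fun B \<nu> s r \<le> 4 * (\<bar>?F s\<bar> + 3 * mass t r)" by simp
    then have "prob E * M_fun B \<nu> s r \<le> prob E * (4 * (\<bar>?F s\<bar> + 3 * mass t r))"
      by (intro mult_left_mono) auto
    also have "\<dots> = 4 * (prob E * \<bar>?F s\<bar>) + 12 * (prob E * mass t r)" by (simp add: algebra_simps)
    also have "\<dots> \<le> 11600" using Im mass pi_less_4 by linarith
    finally show ?thesis .
  qed
  have "prob E * M_star B \<nu> t r \<le> 11600"
  \<comment> \<open>The bound is uniform in s; dividing by a positive \<open>prob E\<close> turns it
    into a bound for the supremum over s.\<close>
  proof (cases "prob E = 0")
    case False
    then have pos: "0 < prob E" by (simp add: zero_less_measure_iff)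
    have "M_star B \<nu> t r \<le> 11600 / prob E"
      unfolding M_star_def
    proof (rule cSUP_least)
      fix s assume "s \<in> {0..t}"
      then have "prob E * M_fun B \<nu> s r \<le> 11600" using M_fun[of s] by auto
      then show "M_fun B \<nu> s r \<le> 11600 / prob E"
        using pos by (simp only: pos_le_divide_eq mult.commute)
    qed (use assms in auto)
    then show ?thesis using pos by (simp add: field_simps)
  qed simp
  then show ?thesis using mass r assms(1) by (simp add: y_real_eq distrib_left)
qed

end

section \<open>Processes with additive components\<close>

text \<open>Bisection: boundedness passes to the union of adjacent intervals and holds near every
  point by the one-sided limits. It makes the real-valued supremum in \<open>sup_process\<close>
  meaningful.\<close>

lemma cadlag_bounded:
  fixes f :: "real \<Rightarrow> real"
  assumes right: "\<And>t. 0 \<le> t \<Longrightarrow> continuous (at_right t) f"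
    and left: "\<And>t. 0 < t \<Longrightarrow> \<exists>l. (f \<longlongrightarrow> l) (at_left t)"
    and "0 \<le> T"
  shows "\<exists>K. \<forall>q\<in>{0..T}. \<bar>f q\<bar> \<le> K"
proof -
  \<comment> \<open>The guard \<open>0 \<le> q\<close> is for intervals around 0, which reach into
    negative times where nothing is known about f.\<close>
  define P where "P a b \<longleftrightarrow> (\<exists>K. \<forall>q\<in>{a..b}. 0 \<le> q \<longrightarrow> \<bar>f q\<bar> \<le> K)" for a b
  have "P 0 T"
  proof (rule Bolzano[OF \<open>0 \<le> T\<close>])
    fix a b c
    assume "P a b" "P b c"
    then obtain K1 K2 where "\<forall>q\<in>{a..b}. 0 \<le> q \<longrightarrow> \<bar>f q\<bar> \<le> K1" "\<forall>q\<in>{b..c}. 0 \<le> q \<longrightarrow> \<bar>f q\<bar> \<le> K2"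
      unfolding P_def by blast
    then show "P a c"
      unfolding P_def by (intro exI[of _ "max K1 K2"]) (force simp: le_max_iff_disj)
  next
    fix x assume x: "0 \<le> x" "x \<le> T"
    have "\<forall>\<^sub>F q in at_right x. dist (f q) (f x) < 1"
      using right[of x] x by (auto simp: continuous_within intro: tendstoD)
    then obtain d1 where d1: "x < d1" "\<And>q. x < q \<Longrightarrow> q < d1 \<Longrightarrow> dist (f q) (f x) < 1"
      unfolding eventually_at_right_field by auto
    have "\<exists>l d2. d2 < x \<and> (\<forall>q. d2 < q \<longrightarrow> q < x \<longrightarrow> 0 \<le> q \<longrightarrow> dist (f q) l < 1)"
    proof (cases "x = 0")
      case True
      then show ?thesis by (intro exI[of _ 0] exI[of _ "- 1"]) auto
    next
      case False
      then obtain l where "(f \<longlongrightarrow> l) (at_left x)" using left[of x] x by auto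
      then have "\<forall>\<^sub>F q in at_left x. dist (f q) l < 1" by (rule tendstoD) simp
      then show ?thesis unfolding eventually_at_left_field by auto
    qed
    then obtain l d2 where d2: "d2 < x" "\<And>q. d2 < q \<Longrightarrow> q < x \<Longrightarrow> 0 \<le> q \<Longrightarrow> dist (f q) l < 1" by auto
    show "\<exists>d>0. \<forall>a b. a \<le> x \<and> x \<le> b \<and> b - a < d \<longrightarrow> P a b"
    proof (intro exI[of _ "min (d1 - x) (x - d2)"] conjI allI impI)
      fix a b assume ab: "a \<le> x \<and> x \<le> b \<and> b - a < min (d1 - x) (x - d2)"
      show "P a b"
        unfolding P_def
      proof (intro exI[of _ "\<bar>f x\<bar> + \<bar>l\<bar> + 1"] ballI impI)
        fix q assume q: "q \<in> {a..b}" "0 \<le> q"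
        consider "q = x" | "x < q" | "q < x" by linarith
        then show "\<bar>f q\<bar> \<le> \<bar>f x\<bar> + \<bar>l\<bar> + 1"
        proof cases
          case 2
          then have "dist (f q) (f x) < 1" using q ab by (intro d1) auto
          then show ?thesis unfolding dist_real_def by linarith
        next
          case 3
          then have "dist (f q) l < 1" using q ab by (intro d2) auto
          then show ?thesis unfolding dist_real_def by linarith
        qed simp
      qed
    qed (use d1 d2 in auto)
  qed
  then show ?thesis by (auto simp: P_def)
qed

section \<open>The vector process and its running supremum\<close>

locale additive_components = prob_space M
  for M :: "'w measure" and X :: "real \<Rightarrow> 'w \<Rightarrow> real ^ 'd"
    and B C :: "'d \<Rightarrow> real \<Rightarrow> real" and \<nu> :: "'d \<Rightarrow> real \<Rightarrow> real measure" +
  assumes component: "\<And>i. additive_levy M (\<nu> i) (B i) (C i) (\<lambda>t \<omega>. X t \<omega> $ i)"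
begin

lemma triplet: "levy_triplet (\<nu> i) (B i) (C i)"
  using component additive_levy.axioms by blast

lemma y_fun_mono: "0 < r \<Longrightarrow> 0 \<le> s \<Longrightarrow> s \<le> t \<Longrightarrow> y_fun B C \<nu> s r \<le> y_fun B C \<nu> t r"
  unfolding y_fun_def by (intro sum_mono levy_triplet.y_real_mono[OF triplet])

lemma y_fun_0: "0 < r \<Longrightarrow> y_fun B C \<nu> 0 r = 0"
  unfolding y_fun_def by (intro sum.neutral ballI levy_triplet.y_real_0[OF triplet])

lemma y_fun_cont: "0 < r \<Longrightarrow> continuous_on {0..} (\<lambda>t. y_fun B C \<nu> t r)"
  unfolding y_fun_def by (intro continuous_on_sum levy_triplet.y_real_cont[OF triplet])

lemma X_vec_measurable [measurable]: "0 \<le> t \<Longrightarrow> X t \<in> borel_measurable M"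
  using additive_levy.X_measurable[OF component]
  by (intro borel_measurable_euclidean_space[THEN iffD2])
     (auto simp: Basis_vec_def inner_axis)

lemma X_right_cont:
  assumes "\<omega> \<in> space M" "0 \<le> t"
  shows "((\<lambda>s. X s \<omega>) \<longlongrightarrow> X t \<omega>) (at_right t)"
  using additive_levy.additive[OF component] assms
  by (intro vec_tendstoI) (auto simp: additive_process_def continuous_within)

lemma norm_X_bdd:
  assumes "\<omega> \<in> space M"
  shows "bdd_above ((\<lambda>s. norm (X s \<omega>)) ` {0..t})"
proof (cases "0 \<le> t")
  case True
  have "\<exists>K. \<forall>q\<in>{0..t}. \<bar>X q \<omega> $ i\<bar> \<le> K" for i
    using additive_levy.additive[OF component, of i] assms True
    by (intro cadlag_bounded) (auto simp: additive_process_def)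
  then obtain K where K: "\<And>i q. q \<in> {0..t} \<Longrightarrow> \<bar>X q \<omega> $ i\<bar> \<le> K i" by metis
  have "norm (X q \<omega>) \<le> (\<Sum>i\<in>UNIV. K i)" if "q \<in> {0..t}" for q
    using norm_le_l1_cart[of "X q \<omega>"] sum_mono[of UNIV "\<lambda>i. \<bar>X q \<omega> $ i\<bar>" K] K[OF that] by force
  then show ?thesis by (intro bdd_aboveI2[where M = "\<Sum>i\<in>UNIV. K i"]) auto
qed simp

lemma norm_le_sup_process: "\<omega> \<in> space M \<Longrightarrow> 0 \<le> s \<Longrightarrow> s \<le> t \<Longrightarrow> norm (X s \<omega>) \<le> sup_process X t \<omega>"
  unfolding sup_process_def by (intro cSUP_upper norm_X_bdd) auto

lemma sup_process_mono: "\<omega> \<in> space M \<Longrightarrow> 0 \<le> s \<Longrightarrow> s \<le> t \<Longrightarrow> sup_process X s \<omega> \<le> sup_process X t \<omega>"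
  unfolding sup_process_def by (intro cSUP_subset_mono norm_X_bdd) auto

lemma sup_process_nonneg: "\<omega> \<in> space M \<Longrightarrow> 0 \<le> t \<Longrightarrow> 0 \<le> sup_process X t \<omega>"
  using norm_le_sup_process[of \<omega> 0 t] norm_ge_zero order_trans by blast

text \<open>Dyadic points of [0,t]. Capping the index makes the sequence monotone on all of nat, the
  form in which independence of increments is available.\<close>

definition grid :: "real \<Rightarrow> nat \<Rightarrow> nat \<Rightarrow> real" where
  "grid t n k = t * real (min k (2 ^ n)) / 2 ^ n"

lemma grid_mono: "0 \<le> t \<Longrightarrow> mono (grid t n)"
  by (auto simp: mono_def grid_def intro!: divide_right_mono mult_left_mono)

lemma grid_bounds: "0 \<le> t \<Longrightarrow> 0 \<le> grid t n k" "0 \<le> t \<Longrightarrow> grid t n k \<le> t"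
proof -
  assume t: "0 \<le> t"
  then show "0 \<le> grid t n k" by (simp add: grid_def)
  have "real (min k (2 ^ n)) \<le> real (2 ^ n)" unfolding of_nat_le_iff by simp
  then have "t * real (min k (2 ^ n)) \<le> t * 2 ^ n" using t by (intro mult_left_mono) auto
  then show "grid t n k \<le> t" by (simp add: grid_def divide_le_eq)
qed

lemma grid_refine: "grid t (Suc n) (2 * k) = grid t n k"
  by (simp add: grid_def min_def)

text \<open>A time q < t is a limit of grid points from the right, where paths are continuous, and t
  itself is a grid point. This yields measurability of the supremum.\<close>

lemma sup_process_le_iff:
  assumes \<omega>: "\<omega> \<in> space M" and t: "0 \<le> t"
  shows "sup_process X t \<omega> \<le> r \<longleftrightarrow> (\<forall>n k. norm (X (grid t n k) \<omega>) \<le> r)"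
proof
  assume "sup_process X t \<omega> \<le> r"
  then show "\<forall>n k. norm (X (grid t n k) \<omega>) \<le> r"
    using norm_le_sup_process[OF \<omega> grid_bounds[OF t]] order_trans by blast
next
  assume *: "\<forall>n k. norm (X (grid t n k) \<omega>) \<le> r"
  have "norm (X q \<omega>) \<le> r" if q: "0 \<le> q" "q \<le> t" for q
  proof (cases "q = t")
    case True
    have "grid t 0 1 = t" by (simp add: grid_def)
    then show ?thesis using *[rule_format, of 0 1] True by simp
  next
    case False
    then have "0 < t" "q < t" using q by auto
    \<comment> \<open>The added 1 places the grid point strictly to the right of q, as the filter
      \<open>at_right q\<close> requires.\<close>
    define k where "k n = nat \<lfloor>q / t * 2 ^ n\<rfloor> + 1" for n
    have kn: "q / t * 2 ^ n < real (k n)" "real (k n) \<le> q / t * 2 ^ n + 1" "k n \<le> 2 ^ n" for n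
    proof -
      have "0 \<le> q / t * 2 ^ n" using q by simp
      then show "q / t * 2 ^ n < real (k n)" "real (k n) \<le> q / t * 2 ^ n + 1"
        unfolding k_def by linarith+
      have "q / t * 2 ^ n < 1 * 2 ^ n" using \<open>q < t\<close> \<open>0 < t\<close> by (intro mult_strict_right_mono) auto
      then have "real (nat \<lfloor>q / t * 2 ^ n\<rfloor>) < real (2 ^ n)"
        using \<open>0 \<le> q / t * 2 ^ n\<close> unfolding of_nat_power of_nat_numeral by linarith
      then have "nat \<lfloor>q / t * 2 ^ n\<rfloor> < 2 ^ n" unfolding of_nat_less_iff .
      then show "k n \<le> 2 ^ n" unfolding k_def by linarith
    qed
    have g: "q < grid t n (k n)" "grid t n (k n) \<le> q + t / 2 ^ n" for n
      using kn[of n] \<open>0 < t\<close> by (auto simp: grid_def field_simps)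
    have "(\<lambda>n. q + t / 2 ^ n) \<longlonglongrightarrow> q + 0"
      by (intro tendsto_intros LIMSEQ_divide_realpow_zero) auto
    then have lim: "(\<lambda>n. q + t / 2 ^ n) \<longlonglongrightarrow> q" by simp
    have "(\<lambda>n. grid t n (k n)) \<longlonglongrightarrow> q"
      by (rule tendsto_sandwich[OF _ _ tendsto_const lim]) (use g in \<open>auto simp: less_imp_le\<close>)
    then have "filterlim (\<lambda>n. grid t n (k n)) (at_right q) sequentially"
      using g(1) by (auto simp: filterlim_at less_imp_neq[symmetric] intro!: always_eventually dest: less_imp_neq)
    from filterlim_compose[OF X_right_cont[OF \<omega> q(1)] this]
    have "(\<lambda>n. norm (X (grid t n (k n)) \<omega>)) \<longlonglongrightarrow> norm (X q \<omega>)" by (rule tendsto_norm)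
    then show ?thesis by (rule LIMSEQ_le_const2) (use * in auto)
  qed
  then show "sup_process X t \<omega> \<le> r"
    unfolding sup_process_def using t by (intro cSUP_least) auto
qed

lemma sup_process_events:
  assumes t: "0 \<le> t"
  shows "{\<omega> \<in> space M. sup_process X t \<omega> \<le> r} \<in> events" "{\<omega> \<in> space M. r < sup_process X t \<omega>} \<in> events"
proof -
  have [measurable]: "X (grid t n k) \<in> borel_measurable M" for n k
    using grid_bounds[OF t] by (intro X_vec_measurable)
  have "{\<omega> \<in> space M. sup_process X t \<omega> \<le> r} = {\<omega> \<in> space M. \<forall>n k. norm (X (grid t n k) \<omega>) \<le> r}"
    using sup_process_le_iff[OF _ t] by blast
  also have "\<dots> \<in> events" by measurable
  finally show *: "{\<omega> \<in> space M. sup_process X t \<omega> \<le> r} \<in> events" .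
  have "{\<omega> \<in> space M. r < sup_process X t \<omega>} = space M - {\<omega> \<in> space M. sup_process X t \<omega> \<le> r}"
    by auto
  then show "{\<omega> \<in> space M. r < sup_process X t \<omega>} \<in> events" using * by auto
qed

text \<open>The exceedance events on successive grids increase to the one for the supremum. A norm
  above r forces some component above r/d by the l1 bound, so \<open>prob_max_gt_le\<close> is used
  with a = 1/d; this produces 3d in the constant.\<close>

lemma prob_sup_gt_le:
  assumes t: "0 \<le> t" and r: "0 < r"
  shows "prob {\<omega> \<in> space M. r < sup_process X t \<omega>} \<le>
    24 * (3 * real CARD('d) + (3 * real CARD('d))\<^sup>2 / 2 + 2) * y_fun B C \<nu> t r"
proof -
  let ?d = "real CARD('d)" and ?c = "24 * (3 * real CARD('d) + (3 * real CARD('d))\<^sup>2 / 2 + 2)"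
  let ?A = "\<lambda>n. {\<omega> \<in> space M. \<exists>k\<le>2 ^ n. r < norm (X (grid t n k) \<omega>)}"
  have grid_cap: "grid t n k = grid t n (min k (2 ^ n))" for n k by (simp add: grid_def)
  have [measurable]: "X (grid t n k) \<in> borel_measurable M" for n k
    using grid_bounds[OF t] by (intro X_vec_measurable)
  have [measurable]: "(\<lambda>\<omega>. X (grid t n k) \<omega> $ i) \<in> borel_measurable M" for n k i
    using grid_bounds[OF t] by (intro additive_levy.X_measurable[OF component])
  have "incseq ?A"
  proof (intro incseq_SucI subsetI)
    fix n \<omega> assume "\<omega> \<in> ?A n"
    then obtain k where "\<omega> \<in> space M" "k \<le> 2 ^ n" "r < norm (X (grid t n k) \<omega>)" by auto
    then show "\<omega> \<in> ?A (Suc n)" using grid_refine[of t n k] by (auto intro!: exI[of _ "2 * k"])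
  qed
  then have "(\<lambda>n. prob (?A n)) \<longlonglongrightarrow> prob (\<Union>n. ?A n)"
    by (intro finite_Lim_measure_incseq) auto
  moreover have "prob (?A n) \<le> ?c * y_fun B C \<nu> t r" for n
  proof -
    let ?Ai = "\<lambda>i. {\<omega> \<in> space M. \<exists>k\<le>2 ^ n. 1 / ?d * r < \<bar>X (grid t n k) \<omega> $ i\<bar>}"
    have "prob (?A n) \<le> prob (\<Union>i\<in>UNIV. ?Ai i)"
    proof (intro finite_measure_mono subsetI)
      fix \<omega> assume "\<omega> \<in> ?A n"
      then obtain k where k: "\<omega> \<in> space M" "k \<le> 2 ^ n" "r < norm (X (grid t n k) \<omega>)" by auto
      have "\<exists>i. 1 / ?d * r < \<bar>X (grid t n k) \<omega> $ i\<bar>"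
      proof (rule ccontr)
        assume "\<not> ?thesis"
        then have "(\<Sum>i\<in>UNIV. \<bar>X (grid t n k) \<omega> $ i\<bar>) \<le> (\<Sum>i\<in>(UNIV::'d set). 1 / ?d * r)"
          by (intro sum_mono) (auto simp: not_less)
        then show False using norm_le_l1_cart[of "X (grid t n k) \<omega>"] k(3) by simp
      qed
      then show "\<omega> \<in> (\<Union>i\<in>UNIV. ?Ai i)" using k by auto
    qed measurable
    also have "\<dots> \<le> (\<Sum>i\<in>UNIV. prob (?Ai i))"
      by (intro finite_measure_subadditive_finite) auto
    also have "\<dots> \<le> (\<Sum>i\<in>UNIV. ?c * y_real (B i) (C i) (\<nu> i) t r)"
    proof (intro sum_mono)
      fix i
      have "prob (?Ai i) \<le> 24 * ((3 / (1 / ?d) + (3 / (1 / ?d))\<^sup>2 / 2 + 2) * y_real (B i) (C i) (\<nu> i) t r)"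
        using r by (intro additive_levy.prob_max_gt_le[OF component, where \<tau> = "grid t n"] grid_mono[OF t] grid_bounds[OF t])
          (auto simp: grid_def)
      moreover have "3 / (1 / ?d) = 3 * ?d" by simp
      ultimately show "prob (?Ai i) \<le> ?c * y_real (B i) (C i) (\<nu> i) t r"
        by (simp only: mult.assoc)
    qed
    finally show ?thesis by (simp add: y_fun_def sum_distrib_left)
  qed
  ultimately have "prob (\<Union>n. ?A n) \<le> ?c * y_fun B C \<nu> t r"
    by (intro LIMSEQ_le_const2) auto
  moreover have "(\<Union>n. ?A n) = {\<omega> \<in> space M. r < sup_process X t \<omega>}"
  proof (intro equalityI subsetI)
    fix \<omega> assume "\<omega> \<in> (\<Union>n. ?A n)"
    then show "\<omega> \<in> {\<omega> \<in> space M. r < sup_process X t \<omega>}"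
      using sup_process_le_iff[OF _ t, of \<omega> r] by (auto simp: not_le[symmetric])
  next
    fix \<omega> assume "\<omega> \<in> {\<omega> \<in> space M. r < sup_process X t \<omega>}"
    then obtain n k where \<omega>: "\<omega> \<in> space M" and "r < norm (X (grid t n k) \<omega>)"
      using sup_process_le_iff[OF _ t, of \<omega> r] by (auto simp: not_le[symmetric])
    then have "r < norm (X (grid t n (min k (2 ^ n))) \<omega>)" using grid_cap by metis
    then show "\<omega> \<in> (\<Union>n. ?A n)" using \<omega>
      by (intro UN_I[of n]) (auto intro!: exI[of _ "min k (2 ^ n)"])
  qed
  ultimately show ?thesis by simp
qed

text \<open>If the norm stays below r, so does every component; the one-component estimate holds for
  the same event and is summed over the components.\<close>

lemma prob_sup_le:
  assumes t: "0 \<le> t" and r: "0 < r"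
  shows "prob {\<omega> \<in> space M. sup_process X t \<omega> \<le> r} * y_fun B C \<nu> t r \<le> 12600 * CARD('d)"
proof -
  let ?E = "{\<omega> \<in> space M. sup_process X t \<omega> \<le> r}"
  have "prob ?E * y_real (B i) (C i) (\<nu> i) t r \<le> 12600" for i
  proof (rule additive_levy.prob_stay_le[OF component t r sup_process_events(1)[OF t]])
    fix \<omega> q assume "\<omega> \<in> ?E" "0 \<le> q" "q \<le> t"
    then have "norm (X q \<omega>) \<le> r" using norm_le_sup_process[of \<omega> q t] by auto
    then show "\<bar>X q \<omega> $ i\<bar> \<le> r" using component_le_norm_cart[of "X q \<omega>" i] by simp
  qed
  then have "(\<Sum>i\<in>UNIV. prob ?E * y_real (B i) (C i) (\<nu> i) t r) \<le> (\<Sum>i\<in>(UNIV::'d set). 12600)"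
    by (intro sum_mono)
  then show ?thesis by (simp add: y_fun_def sum_distrib_left)
qed

end

section \<open>The time change\<close>

text \<open>Only the level b of y enters here, and the whole section is deterministic; the paths
  appear later as a nondecreasing function S.\<close>

locale time_change =
  fixes y :: "real \<Rightarrow> real \<Rightarrow> real" and b :: real and \<phi> v :: "real \<Rightarrow> real"
  assumes y_mono: "\<And>s t. 0 \<le> s \<Longrightarrow> s \<le> t \<Longrightarrow> y s b \<le> y t b"
    and y_0: "y 0 b = 0"
    and y_cont: "continuous_on {0..} (\<lambda>t. y t b)"
    and y_pos: "\<And>t. 0 < t \<Longrightarrow> 0 < y t b"
    and quasiconvex: "quasiconvex \<phi>"
    and time_change: "is_time_change y b \<phi> v"
begin

abbreviation D :: "real set" where "D \<equiv> tc_domain y b \<phi>"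
abbreviation u :: "real \<Rightarrow> real" where "u \<equiv> right_inverse_on D v"

lemma phi_mono: "0 \<le> s \<Longrightarrow> s \<le> t \<Longrightarrow> \<phi> s \<le> \<phi> t"
  using quasiconvex by (auto simp: quasiconvex_def mono_on_def)

lemma phi_pos: "0 < t \<Longrightarrow> 0 < \<phi> t"
  using quasiconvex by (simp add: quasiconvex_def)

lemma phi_small:
  assumes "0 < e"
  shows "\<exists>\<delta>>0. \<forall>t\<in>{0..\<delta>}. \<phi> t < e"
proof -
  have "(\<phi> \<longlongrightarrow> 0) (at_right 0)"
    using quasiconvex by (auto simp: quasiconvex_def continuous_within)
  then have "\<forall>\<^sub>F t in at_right 0. \<phi> t < e" using assms by (rule order_tendstoD)
  then obtain d where d: "0 < d" "\<And>t. 0 < t \<Longrightarrow> t < d \<Longrightarrow> \<phi> t < e"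
    unfolding eventually_at_right_field by auto
  moreover have "\<phi> 0 < e" using quasiconvex assms by (simp add: quasiconvex_def)
  ultimately show ?thesis
    by (intro exI[of _ "d / 2"]) (force simp: le_less)
qed

text \<open>Outside \<open>tc_domain\<close> the function v is unspecified, so one radius is fixed
  up to which it can be used.\<close>

definition \<epsilon> :: real where "\<epsilon> = (SOME \<epsilon>. 0 < \<epsilon> \<and> {0..\<epsilon>} \<subseteq> D)"

text \<open>Near 0 the values of \<phi> lie below y 1 b > 0, so the defining equation has a solution
  in [0,1] by the intermediate value theorem.\<close>

lemma \<epsilon>: "0 < \<epsilon>" "0 \<le> s \<Longrightarrow> s \<le> \<epsilon> \<Longrightarrow> s \<in> D"
proof -
  obtain \<delta> where \<delta>: "0 < \<delta>" "\<And>t. t \<in> {0..\<delta>} \<Longrightarrow> \<phi> t < y 1 b"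
    using phi_small[OF y_pos[OF zero_less_one]] by auto
  have "{0..\<delta>} \<subseteq> D"
  proof
    fix t assume t: "t \<in> {0..\<delta>}"
    have "0 \<le> \<phi> t" using phi_mono[of 0 t] t quasiconvex by (simp add: quasiconvex_def)
    then have "\<exists>s\<ge>0. s \<le> 1 \<and> y s b = \<phi> t"
      using \<delta>(2)[OF t] continuous_on_subset[OF y_cont, of "{0..1}"]
      by (intro IVT'[of "\<lambda>s. y s b"]) (auto simp: y_0)
    then show "t \<in> D" using t by (auto simp: tc_domain_def)
  qed
  then have "\<exists>\<epsilon>. 0 < \<epsilon> \<and> {0..\<epsilon>} \<subseteq> D" using \<delta> by auto
  from someI_ex[OF this] show "0 < \<epsilon>" "0 \<le> s \<Longrightarrow> s \<le> \<epsilon> \<Longrightarrow> s \<in> D"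
    unfolding \<epsilon>_def by auto
qed

lemma v_mono: "s \<in> D \<Longrightarrow> t \<in> D \<Longrightarrow> s \<le> t \<Longrightarrow> v s \<le> v t"
  using time_change by (auto simp: is_time_change_def mono_on_def)

lemma v_nonneg: "s \<in> D \<Longrightarrow> 0 \<le> v s"
  using time_change by (auto simp: is_time_change_def)

lemma y_v: "s \<in> D \<Longrightarrow> y (v s) b = \<phi> s"
  using time_change by (auto simp: is_time_change_def)

lemma v_pos: "s \<in> D \<Longrightarrow> 0 < s \<Longrightarrow> 0 < v s"
  using v_nonneg[of s] y_v[of s] phi_pos[of s] y_0 by (cases "v s = 0") auto

text \<open>If v s \<ge> e, then \<phi> s = y (v s) b \<ge> y e b > 0, which fails for small s.
  Positivity of y at every positive time is essential here, since v may be any nondecreasing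
  solution.\<close>

lemma v_small:
  assumes "0 < e"
  shows "\<exists>\<delta>>0. \<delta> \<le> \<epsilon> \<and> (\<forall>s\<in>{0..\<delta>}. v s < e)"
proof -
  obtain \<delta> where \<delta>: "0 < \<delta>" "\<And>t. t \<in> {0..\<delta>} \<Longrightarrow> \<phi> t < y e b"
    using phi_small[OF y_pos[OF assms]] by auto
  have "v s < e" if "s \<in> {0..min \<delta> \<epsilon>}" for s
  proof (rule ccontr)
    assume "\<not> ?thesis"
    then have "y e b \<le> y (v s) b" using assms by (intro y_mono) auto
    then show False using \<delta>(2)[of s] y_v[of s] \<epsilon>(2)[of s] that by auto
  qed
  then show ?thesis using \<delta> \<epsilon> by (intro exI[of _ "min \<delta> \<epsilon>"]) auto
qed

lemma v_tendsto:
  fixes r :: "nat \<Rightarrow> real"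
  assumes r: "\<And>n. 0 < r n" "r \<longlonglongrightarrow> 0"
  shows "filterlim (\<lambda>n. v (r n)) (at_right 0) sequentially"
proof -
  have ev: "\<forall>\<^sub>F n in sequentially. 0 < v (r n) \<and> v (r n) < e" if e: "0 < e" for e
  proof -
    obtain \<delta> where \<delta>: "0 < \<delta>" "\<delta> \<le> \<epsilon>" "\<And>s. s \<in> {0..\<delta>} \<Longrightarrow> v s < e"
      using v_small[OF e] by auto
    have "\<forall>\<^sub>F n in sequentially. r n < \<delta>" using r(2) \<delta>(1) by (rule order_tendstoD)
    then show ?thesis
    proof eventually_elim
      case (elim n)
      then show ?case using r(1)[of n] \<delta> \<epsilon>(2)[of "r n"] v_pos[of "r n"] by auto
    qed
  qed
  have "(\<lambda>n. v (r n)) \<longlonglongrightarrow> 0"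
  proof (rule order_tendstoI)
    fix a :: real assume "a < 0"
    show "\<forall>\<^sub>F n in sequentially. a < v (r n)"
      using ev[of 1] \<open>a < 0\<close> by (auto elim!: eventually_mono)
  next
    fix a :: real assume "0 < a"
    show "\<forall>\<^sub>F n in sequentially. v (r n) < a"
      using ev[OF \<open>0 < a\<close>] by (auto elim!: eventually_mono)
  qed
  moreover have "\<forall>\<^sub>F n in sequentially. v (r n) \<in> {0<..} \<and> v (r n) \<noteq> 0"
    using ev[of 1] by (auto elim!: eventually_mono)
  ultimately show ?thesis by (auto simp: filterlim_at eventually_conj_iff)
qed

text \<open>The condition t < v \<epsilon> keeps the set in the definition of u nonempty; the real
  infimum of an empty set carries no information.\<close>

lemma u_ge:
  assumes "s \<in> D" "v s \<le> t" "t < v \<epsilon>"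
  shows "s \<le> u t"
  unfolding right_inverse_on_def
proof (rule cInf_greatest)
  show "{s \<in> D. 0 < s \<and> t < v s} \<noteq> {}" using \<epsilon>(1) \<epsilon>(2)[of \<epsilon>] assms by auto
  fix s' assume "s' \<in> {s \<in> D. 0 < s \<and> t < v s}"
  then show "s \<le> s'" using v_mono[of s' s] assms by (cases "s \<le> s'") auto
qed

lemma u_le: "s \<in> D \<Longrightarrow> 0 < s \<Longrightarrow> t < v s \<Longrightarrow> u t \<le> s"
  unfolding right_inverse_on_def by (intro cInf_lower bdd_belowI[of _ 0]) auto

text \<open>The only use of the growth condition: \<open>\<phi>\<close> strictly increases over a fixed ratio.\<close>

lemma u_v_le: "\<exists>c>0. \<forall>r>0. c * r \<le> \<epsilon> \<longrightarrow> u (v r) \<le> c * r"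
proof -
  obtain \<rho> \<sigma> where \<rho>: "0 < \<rho>" "0 < \<sigma>"
    and q: "\<And>t1 t2. 0 < t1 \<Longrightarrow> t1 < t2 \<Longrightarrow> \<rho> * (t2 / t1) powr \<sigma> \<le> \<phi> t2 / \<phi> t1"
    using quasiconvex unfolding quasiconvex_def by blast
  \<comment> \<open>Makes \<rho> c^\<sigma> at least 2, so that \<phi> (c r) is at least twice
    \<phi> r; the 2 in the maximum ensures r < c r.\<close>
  define c where "c = max 2 ((2 / \<rho>) powr (1 / \<sigma>))"
  have c: "2 \<le> c" "2 \<le> \<rho> * c powr \<sigma>"
  proof -
    have "2 / \<rho> = ((2 / \<rho>) powr (1 / \<sigma>)) powr \<sigma>" using \<rho> by (simp add: powr_powr)
    also have "\<dots> \<le> c powr \<sigma>" using \<rho> by (intro powr_mono2) (auto simp: c_def)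
    finally show "2 \<le> \<rho> * c powr \<sigma>" using \<rho> by (simp add: field_simps)
  qed (simp add: c_def)
  have "u (v r) \<le> c * r" if r: "0 < r" "c * r \<le> \<epsilon>" for r
  proof (rule u_le)
    have "r < c * r" using c r by simp
    then have "r \<le> \<epsilon>" using r by linarith
    moreover have "0 \<le> c * r" using c r by simp
    ultimately have D: "c * r \<in> D" "r \<in> D" using r \<epsilon>(2) by auto
    have "2 \<le> \<phi> (c * r) / \<phi> r" using q[of r "c * r"] c r \<open>r < c * r\<close> by simp
    then have "\<phi> r < \<phi> (c * r)" using phi_pos[OF r(1)] by (simp add: pos_le_divide_eq)
    then have "y (v r) b < y (v (c * r)) b" using y_v D by simp
    then show "v r < v (c * r)"
      using y_mono[of "v (c * r)" "v r"] v_nonneg[OF D(1)] by (cases "v r < v (c * r)") auto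
    show "c * r \<in> D" by fact
    show "0 < c * r" using c r by simp
  qed
  then show ?thesis using c by (intro exI[of _ c]) auto
qed

text \<open>As v (\<sigma> n) tends to 0, a small t lies between two consecutive values, and the
  infimum defining u transfers this to u t. The lower bound N on the index lets estimates valid for
  large n be applied.\<close>

lemma bracket:
  assumes \<sigma>: "Sigma_sequence \<sigma>"
  shows "\<forall>\<^sub>F t in at_right 0. \<exists>n\<ge>N. 0 \<le> v (\<sigma> (Suc n)) \<and> v (\<sigma> (Suc n)) \<le> t \<and> t \<le> v (\<sigma> n) \<and>
    \<sigma> (Suc n) \<le> u t \<and> u t \<le> \<sigma> n"
proof -
  have pos: "0 < \<sigma> n" for n using \<sigma> by (simp add: Sigma_sequence_def)
  have dec: "decseq \<sigma>" and lim: "\<sigma> \<longlonglongrightarrow> 0" using \<sigma> by (auto simp: Sigma_sequence_def)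
  have "\<forall>\<^sub>F n in sequentially. \<sigma> n < \<epsilon>" using lim \<epsilon>(1) by (rule order_tendstoD)
  then obtain N' where N': "\<And>n. N' \<le> n \<Longrightarrow> \<sigma> n < \<epsilon>" by (auto simp: eventually_sequentially)
  define K where "K = max N N'"
  have inD: "K \<le> n \<Longrightarrow> \<sigma> n \<in> D" for n using N'[of n] pos[of n] \<epsilon>(2) by (auto simp: K_def)
  have "0 < v (\<sigma> K)" using inD[of K] pos v_pos by auto
  then have "\<forall>\<^sub>F t in at_right 0. 0 < t \<and> t < v (\<sigma> K)"
    by (auto simp: eventually_at_right_field)
  then show ?thesis
  proof eventually_elim
    case (elim t)
    have "\<forall>\<^sub>F n in sequentially. v (\<sigma> n) < t"
    proof -
      obtain \<delta> where \<delta>: "0 < \<delta>" "\<And>s. s \<in> {0..\<delta>} \<Longrightarrow> v s < t"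
        using v_small[of t] elim by auto
      have "\<forall>\<^sub>F n in sequentially. \<sigma> n < \<delta>" using lim \<delta>(1) by (rule order_tendstoD)
      then show ?thesis
      proof eventually_elim
        case (elim n)
        then show ?case using pos[of n] by (intro \<delta>) auto
      qed
    qed
    then obtain m where m: "\<And>n. m \<le> n \<Longrightarrow> v (\<sigma> n) < t" by (auto simp: eventually_sequentially)
    let ?P = "\<lambda>j. v (\<sigma> (K + j)) \<le> t"
    have "?P m" using m[of "K + m"] by simp
    have "\<not> ?P 0" using elim by simp
    have "\<exists>j. \<not> ?P j \<and> ?P (Suc j)"
    proof (rule ccontr)
      assume *: "\<not> ?thesis"
      have "\<not> ?P j" for j
      proof (induction j)
        case (Suc j)
        then show ?case using * by blast
      qed fact
      then show False using \<open>?P m\<close> by blast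
    qed
    then obtain j where j: "\<not> ?P j" "?P (Suc j)" by blast
    let ?n = "K + j"
    have n: "v (\<sigma> (Suc ?n)) \<le> t" "t < v (\<sigma> ?n)" using j by auto
    have "\<sigma> ?n < \<epsilon>" by (rule N') (simp add: K_def)
    then have "v (\<sigma> ?n) \<le> v \<epsilon>"
      using inD[of ?n] \<epsilon>(1) \<epsilon>(2)[of \<epsilon>] by (intro v_mono) auto
    with n(2) have "t < v \<epsilon>" by simp
    then have "\<sigma> (Suc ?n) \<le> u t" using n inD[of "Suc ?n"] by (intro u_ge) auto
    moreover have "u t \<le> \<sigma> ?n" using n inD[of ?n] pos by (intro u_le) auto
    moreover have "0 \<le> v (\<sigma> (Suc ?n))" using inD[of "Suc ?n"] by (intro v_nonneg) auto
    ultimately show ?case using n by (intro exI[of _ ?n]) (auto simp: K_def)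
  qed
qed

lemma u_v_ge_eventually:
  fixes r :: "nat \<Rightarrow> real"
  assumes r: "\<And>n. 0 < r n" "r \<longlonglongrightarrow> 0"
  shows "\<forall>\<^sub>F n in sequentially. r n \<le> u (v (r n))"
proof -
  have "0 < v \<epsilon>" using \<epsilon> v_pos by auto
  then obtain \<delta> where \<delta>: "0 < \<delta>" "\<delta> \<le> \<epsilon>" "\<And>s. s \<in> {0..\<delta>} \<Longrightarrow> v s < v \<epsilon>"
    using v_small by blast
  have "\<forall>\<^sub>F n in sequentially. r n < \<delta>" using r(2) \<delta>(1) by (rule order_tendstoD)
  then show ?thesis
  proof eventually_elim
    case (elim n)
    then show ?case using r(1)[of n] \<delta>(2,3) \<epsilon>(2)[of "r n"] by (intro u_ge) auto
  qed
qed

end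

section \<open>Lower and upper limits at 0 along sequences\<close>

lemma ennreal_pos_dense:
  fixes z :: ennreal
  assumes "0 < z"
  shows "\<exists>e>0. ennreal e < z"
proof -
  obtain q :: rat where q: "0 < ennreal (real_of_rat q)" "ennreal (real_of_rat q) < z"
    using ennreal_rat_dense[OF assms] by auto
  then show ?thesis by (intro exI[of _ "real_of_rat q"]) auto
qed

lemma Liminf_at_right_0_eq_0:
  fixes f :: "real \<Rightarrow> ennreal" and h :: "nat \<Rightarrow> real"
  assumes t: "filterlim t (at_right 0) sequentially" and h: "h \<longlonglongrightarrow> 0"
    and le: "\<forall>\<^sub>F n in sequentially. f (t n) \<le> ennreal (h n)"
  shows "Liminf (at_right 0) f = 0"
proof (rule ccontr)
  assume "Liminf (at_right 0) f \<noteq> 0"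
  then obtain e where e: "0 < e" "ennreal e < Liminf (at_right 0) f"
    using ennreal_pos_dense[of "Liminf (at_right 0) f"] by (auto simp: zero_less_iff_neq_zero)
  have "\<forall>\<^sub>F n in sequentially. ennreal e < f (t n)"
    using less_LiminfD[OF e(2)] t by (auto simp: filterlim_iff)
  moreover have "\<forall>\<^sub>F n in sequentially. h n < e" using h e(1) by (rule order_tendstoD)
  ultimately have "\<forall>\<^sub>F n in sequentially. False"
    using le
  proof eventually_elim
    case (elim n)
    then have "ennreal e < ennreal (h n)" by (auto intro: less_le_trans)
    then show ?case using elim e by (simp add: ennreal_less_iff)
  qed
  then show False by simp
qed

lemma Limsup_at_right_0_eq_top:
  fixes f :: "real \<Rightarrow> ennreal" and h :: "nat \<Rightarrow> real"
  assumes t: "filterlim t (at_right 0) sequentially" and h: "filterlim h at_top sequentially"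
    and le: "\<forall>\<^sub>F n in sequentially. ennreal (h n) \<le> f (t n)"
  shows "Limsup (at_right 0) f = \<infinity>"
proof (rule ccontr)
  assume "Limsup (at_right 0) f \<noteq> \<infinity>"
  then have "Limsup (at_right 0) f < top" by (simp add: less_top)
  then obtain q :: rat where q: "Limsup (at_right 0) f < ennreal (real_of_rat q)"
    using ennreal_rat_dense by blast
  let ?q = "real_of_rat q"
  have "\<forall>\<^sub>F n in sequentially. f (t n) < ennreal ?q"
    using Limsup_lessD[OF q] t by (auto simp: filterlim_iff)
  moreover have "\<forall>\<^sub>F n in sequentially. ?q \<le> h n" using h by (simp add: filterlim_at_top)
  ultimately have "\<forall>\<^sub>F n in sequentially. False"
    using le
  proof eventually_elim
    case (elim n)
    then have "ennreal (h n) < ennreal ?q" by (auto intro: le_less_trans)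
    moreover have "ennreal ?q \<le> ennreal (h n)" using elim by (intro ennreal_leI)
    ultimately show ?case by simp
  qed
  then show False by simp
qed

lemma powr_neg_at_top:
  fixes w :: "nat \<Rightarrow> real"
  assumes "w \<longlonglongrightarrow> 0" and "\<And>n. 0 < w n" and "0 < a"
  shows "filterlim (\<lambda>n. w n powr (- a)) at_top sequentially"
proof -
  have "(\<lambda>n. w n powr a) \<longlonglongrightarrow> 0"
    using assms by (intro tendsto_zero_powrI[of w _ _ a]) (auto intro!: always_eventually less_imp_le)
  then have "filterlim (\<lambda>n. inverse (w n powr a)) at_top sequentially"
    using assms(2) by (intro filterlim_inverse_at_top) (auto simp: less_imp_neq[symmetric])
  then show ?thesis by (simp add: powr_minus)
qed

section \<open>From the times v (r n) to all small times\<close>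

locale time_changed_path = time_change +
  fixes S :: "real \<Rightarrow> real"
  assumes S_mono: "\<And>s t. 0 \<le> s \<Longrightarrow> s \<le> t \<Longrightarrow> S s \<le> S t" and S_nonneg: "\<And>t. 0 \<le> t \<Longrightarrow> 0 \<le> S t"
begin

text \<open>Since u (v (r n)) \<ge> r n eventually, the scaled supremum at time v (r n) is at most r
  n to the positive power 1/\<eta>' - 1/\<eta>.\<close>

lemma Liminf_0:
  fixes r :: "nat \<Rightarrow> real"
  assumes \<eta>: "0 < \<eta>'" "\<eta>' < \<eta>" and r: "\<And>n. 0 < r n" "r \<longlonglongrightarrow> 0"
    and S: "\<forall>\<^sub>F n in sequentially. S (v (r n)) \<le> r n powr (1 / \<eta>')"
  shows "Liminf (at_right 0) (\<lambda>t. ennreal (u t powr (- 1 / \<eta>) * S t)) = 0"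
proof (rule Liminf_at_right_0_eq_0[OF v_tendsto[OF r]])
  have "0 < 1 / \<eta>' - 1 / \<eta>" using \<eta> by (simp add: frac_less2)
  then show "(\<lambda>n. r n powr (1 / \<eta>' - 1 / \<eta>)) \<longlonglongrightarrow> 0"
    using r by (intro tendsto_zero_powrI[of r _ _ "1 / \<eta>' - 1 / \<eta>"]) (auto intro!: always_eventually less_imp_le)
  show "\<forall>\<^sub>F n in sequentially. ennreal (u (v (r n)) powr (- 1 / \<eta>) * S (v (r n))) \<le> ennreal (r n powr (1 / \<eta>' - 1 / \<eta>))"
    using u_v_ge_eventually[OF r] S
  proof eventually_elim
    case (elim n)
    have "u (v (r n)) powr (- 1 / \<eta>) * S (v (r n)) \<le> u (v (r n)) powr (- 1 / \<eta>) * r n powr (1 / \<eta>')"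
      using elim by (intro mult_left_mono) auto
    also have "\<dots> \<le> r n powr (- 1 / \<eta>) * r n powr (1 / \<eta>')"
      using elim r(1)[of n] \<eta> by (intro mult_right_mono powr_mono2') auto
    also have "\<dots> = r n powr (1 / \<eta>' - 1 / \<eta>)" by (simp add: powr_add[symmetric])
    finally show ?case by (rule ennreal_leI)
  qed
qed

text \<open>Now u has to be bounded from above, which is what \<open>u_v_le\<close> is for; its
  constant c only multiplies a power of r n that diverges because \<eta> < \<eta>'.\<close>

lemma Limsup_infinity:
  fixes r :: "nat \<Rightarrow> real"
  assumes \<eta>: "0 < \<eta>" "\<eta> < \<eta>'" and r: "\<And>n. 0 < r n" "r \<longlonglongrightarrow> 0"
    and S: "\<forall>\<^sub>F n in sequentially. r n powr (1 / \<eta>') < S (v (r n))"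
  shows "Limsup (at_right 0) (\<lambda>t. ennreal (u t powr (- 1 / \<eta>) * S t)) = \<infinity>"
proof -
  obtain c where c: "0 < c" "\<And>r. 0 < r \<Longrightarrow> c * r \<le> \<epsilon> \<Longrightarrow> u (v r) \<le> c * r" using u_v_le by auto
  have \<theta>: "0 < 1 / \<eta> - 1 / \<eta>'" using \<eta> by (simp add: frac_less2)
  have small: "\<forall>\<^sub>F n in sequentially. c * r n < \<epsilon>"
  proof -
    have "(\<lambda>n. c * r n) \<longlonglongrightarrow> c * 0" by (intro tendsto_intros r)
    then show ?thesis using \<epsilon>(1) by (intro order_tendstoD) auto
  qed
  show ?thesis
  proof (rule Limsup_at_right_0_eq_top[OF v_tendsto[OF r]])
    have "filterlim (\<lambda>n. r n powr (- (1 / \<eta> - 1 / \<eta>'))) at_top sequentially"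
      using r \<theta> by (intro powr_neg_at_top) auto
    then show "filterlim (\<lambda>n. c powr (- 1 / \<eta>) * r n powr (- (1 / \<eta> - 1 / \<eta>'))) at_top sequentially"
      using c by (intro filterlim_tendsto_pos_mult_at_top[OF tendsto_const]) auto
    show "\<forall>\<^sub>F n in sequentially. ennreal (c powr (- 1 / \<eta>) * r n powr (- (1 / \<eta> - 1 / \<eta>')))
        \<le> ennreal (u (v (r n)) powr (- 1 / \<eta>) * S (v (r n)))"
      using u_v_ge_eventually[OF r] S small
    proof eventually_elim
      case (elim n)
      have "c powr (- 1 / \<eta>) * r n powr (- (1 / \<eta> - 1 / \<eta>')) = (c * r n) powr (- 1 / \<eta>) * r n powr (1 / \<eta>')"
        using c r(1)[of n] by (simp add: powr_mult powr_add[symmetric])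
      also have "\<dots> \<le> u (v (r n)) powr (- 1 / \<eta>) * S (v (r n))"
        using elim r(1)[of n] \<eta> c(2)[of "r n"] by (intro mult_mono powr_mono2') auto
      finally show ?case by (rule ennreal_leI)
    qed
  qed
qed

lemma sigma_ratio:
  assumes \<sigma>: "Sigma_sequence \<sigma>" and "0 < \<theta>"
  shows "(\<lambda>n. \<sigma> n / \<sigma> (Suc n) * \<sigma> (Suc n) powr \<theta>) \<longlonglongrightarrow> 0" "0 < \<sigma> n / \<sigma> (Suc n) * \<sigma> (Suc n) powr \<theta>"
  using assms by (auto simp: Sigma_sequence_def less_imp_neq[symmetric] intro!: divide_pos_pos mult_pos_pos)

text \<open>Between consecutive times the worst case pairs the smaller \<sigma> for u with the
  larger one for S. The resulting quotient is a power 1/\<eta>' of the sequence in the definition of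
  a \<Sigma>-sequence, with exponent 1 - \<eta>'/\<eta>.\<close>

lemma Limsup_0:
  assumes \<eta>: "0 < \<eta>'" "\<eta>' < \<eta>" and \<sigma>: "Sigma_sequence \<sigma>"
    and S: "\<forall>\<^sub>F n in sequentially. S (v (\<sigma> n)) \<le> \<sigma> n powr (1 / \<eta>')"
  shows "Limsup (at_right 0) (\<lambda>t. ennreal (u t powr (- 1 / \<eta>) * S t)) = 0"
proof -
  let ?w = "\<lambda>n. \<sigma> n / \<sigma> (Suc n) * \<sigma> (Suc n) powr (1 - \<eta>' / \<eta>)"
  have \<theta>: "0 < 1 - \<eta>' / \<eta>" using \<eta> by simp
  have pos: "0 < \<sigma> n" for n using \<sigma> by (simp add: Sigma_sequence_def)
  have "Limsup (at_right 0) (\<lambda>t. ennreal (u t powr (- 1 / \<eta>) * S t)) \<le> 0"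
    unfolding Limsup_le_iff
  proof (intro allI impI)
    fix z :: ennreal assume "0 < z"
    then obtain e where e: "0 < e" "ennreal e < z" using ennreal_pos_dense by blast
    have "(\<lambda>n. ?w n powr (1 / \<eta>')) \<longlonglongrightarrow> 0"
      using sigma_ratio[OF \<sigma> \<theta>] \<eta> by (intro tendsto_zero_powrI[of ?w _ _ "1 / \<eta>'"]) (auto intro!: always_eventually less_imp_le)
    then have "\<forall>\<^sub>F n in sequentially. ?w n powr (1 / \<eta>') < e" using e(1) by (rule order_tendstoD)
    then have "\<forall>\<^sub>F n in sequentially. ?w n powr (1 / \<eta>') < e \<and> S (v (\<sigma> n)) \<le> \<sigma> n powr (1 / \<eta>')"
      using S by eventually_elim auto
    then obtain N where N: "\<And>n. N \<le> n \<Longrightarrow> ?w n powr (1 / \<eta>') < e \<and> S (v (\<sigma> n)) \<le> \<sigma> n powr (1 / \<eta>')"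
      by (auto simp: eventually_sequentially)
    show "\<forall>\<^sub>F t in at_right 0. ennreal (u t powr (- 1 / \<eta>) * S t) < z"
      using bracket[OF \<sigma>, of N]
    proof eventually_elim
      case (elim t)
      then obtain n where n: "N \<le> n" "0 \<le> v (\<sigma> (Suc n))" "v (\<sigma> (Suc n)) \<le> t" "t \<le> v (\<sigma> n)"
        "\<sigma> (Suc n) \<le> u t" by auto
      have "S t \<le> S (v (\<sigma> n))" using n by (intro S_mono) auto
      also have "\<dots> \<le> \<sigma> n powr (1 / \<eta>')" using N n by auto
      finally have "u t powr (- 1 / \<eta>) * S t \<le> \<sigma> (Suc n) powr (- 1 / \<eta>) * \<sigma> n powr (1 / \<eta>')"
        using n pos[of "Suc n"] \<eta> S_nonneg[of t] by (intro mult_mono powr_mono2') auto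
      also have "\<dots> = ?w n powr (1 / \<eta>')"
      proof -
        have "\<sigma> (Suc n) powr (- 1 / \<eta>) = \<sigma> (Suc n) powr (- (1 / \<eta>')) * \<sigma> (Suc n) powr ((1 - \<eta>' / \<eta>) * (1 / \<eta>'))"
          using \<eta> by (simp add: powr_add[symmetric] field_simps)
        then show ?thesis
          using pos[of n] pos[of "Suc n"] by (simp add: powr_mult powr_divide powr_powr powr_minus field_simps)
      qed
      also have "\<dots> < e" using N n by auto
      finally have "ennreal (u t powr (- 1 / \<eta>) * S t) \<le> ennreal e" by (intro ennreal_leI) simp
      then show ?case using e(2) by simp
    qed
  qed
  then show ?thesis by simp
qed

text \<open>The opposite pairing, the larger \<sigma> for u and the smaller one for S, gives the
  \<Sigma>-sequence expression with exponent 1 - \<eta>/\<eta>', raised to the power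
  -1/\<eta>.\<close>

lemma Liminf_infinity:
  assumes \<eta>: "0 < \<eta>" "\<eta> < \<eta>'" and \<sigma>: "Sigma_sequence \<sigma>"
    and S: "\<forall>\<^sub>F n in sequentially. \<sigma> n powr (1 / \<eta>') < S (v (\<sigma> n))"
  shows "Liminf (at_right 0) (\<lambda>t. ennreal (u t powr (- 1 / \<eta>) * S t)) = \<infinity>"
proof -
  let ?w = "\<lambda>n. \<sigma> n / \<sigma> (Suc n) * \<sigma> (Suc n) powr (1 - \<eta> / \<eta>')"
  have \<theta>: "0 < 1 - \<eta> / \<eta>'" using \<eta> by simp
  have pos: "0 < \<sigma> n" for n using \<sigma> by (simp add: Sigma_sequence_def)
  have "top \<le> Liminf (at_right 0) (\<lambda>t. ennreal (u t powr (- 1 / \<eta>) * S t))"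
    unfolding le_Liminf_iff
  proof (intro allI impI)
    fix z :: ennreal assume "z < top"
    then obtain K where K: "z = ennreal K" "0 \<le> K" by (cases z) auto
    have "filterlim (\<lambda>n. ?w n powr (- (1 / \<eta>))) at_top sequentially"
      using sigma_ratio[OF \<sigma> \<theta>] \<eta> by (intro powr_neg_at_top) auto
    then have "\<forall>\<^sub>F n in sequentially. K < ?w n powr (- (1 / \<eta>))" by (simp add: filterlim_at_top_dense)
    moreover have "\<forall>\<^sub>F n in sequentially. \<sigma> (Suc n) powr (1 / \<eta>') < S (v (\<sigma> (Suc n)))"
      using S by (subst eventually_sequentially_Suc)
    ultimately have "\<forall>\<^sub>F n in sequentially. K < ?w n powr (- (1 / \<eta>)) \<and> \<sigma> (Suc n) powr (1 / \<eta>') < S (v (\<sigma> (Suc n)))"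
      by eventually_elim auto
    then obtain N where N: "\<And>n. N \<le> n \<Longrightarrow> K < ?w n powr (- (1 / \<eta>)) \<and> \<sigma> (Suc n) powr (1 / \<eta>') < S (v (\<sigma> (Suc n)))"
      by (auto simp: eventually_sequentially)
    show "\<forall>\<^sub>F t in at_right 0. z < ennreal (u t powr (- 1 / \<eta>) * S t)"
      using bracket[OF \<sigma>, of N]
    proof eventually_elim
      case (elim t)
      then obtain n where n: "N \<le> n" "0 \<le> v (\<sigma> (Suc n))" "v (\<sigma> (Suc n)) \<le> t"
        "\<sigma> (Suc n) \<le> u t" "u t \<le> \<sigma> n" by auto
      have "K < ?w n powr (- (1 / \<eta>))" using N n by auto
      also have "\<dots> = \<sigma> n powr (- 1 / \<eta>) * \<sigma> (Suc n) powr (1 / \<eta>')"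
      proof -
        have "\<sigma> (Suc n) powr (1 / \<eta>') = \<sigma> (Suc n) powr (1 / \<eta>) * \<sigma> (Suc n) powr ((1 - \<eta> / \<eta>') * (- (1 / \<eta>)))"
          using \<eta> by (simp add: powr_add[symmetric] field_simps)
        then show ?thesis
          using pos[of n] pos[of "Suc n"] by (simp add: powr_mult powr_divide powr_powr powr_minus field_simps)
      qed
      also have "\<dots> \<le> u t powr (- 1 / \<eta>) * S t"
      proof (rule mult_mono)
        show "\<sigma> n powr (- 1 / \<eta>) \<le> u t powr (- 1 / \<eta>)"
          using n pos[of "Suc n"] \<eta> by (intro powr_mono2') auto
        have "\<sigma> (Suc n) powr (1 / \<eta>') < S (v (\<sigma> (Suc n)))" using N n by auto
        also have "\<dots> \<le> S t" using n by (intro S_mono) auto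
        finally show "\<sigma> (Suc n) powr (1 / \<eta>') \<le> S t" by simp
      qed auto
      finally show ?case using K by (simp add: ennreal_less_iff)
    qed
  qed
  then show ?thesis by (simp add: top_unique)
qed

end

section \<open>Almost sure growth\<close>

text \<open>The bound is asked only eventually because v (r n) is under control only once r n is
  small; earlier events are replaced by the empty set. The majorant takes extended values so that
  the inverse of y may be infinite.\<close>

lemma (in prob_space) borel_cantelli_bound:
  fixes A :: "nat \<Rightarrow> 'a set" and f :: "nat \<Rightarrow> ennreal"
  assumes fin: "(\<Sum>n. f n) < \<infinity>"
    and A: "\<forall>\<^sub>F n in sequentially. A n \<in> events \<and> ennreal (prob (A n)) \<le> ennreal c * f n"
  shows "AE \<omega> in M. \<forall>\<^sub>F n in sequentially. \<omega> \<notin> A n"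
proof -
  obtain N where N: "\<And>n. N \<le> n \<Longrightarrow> A n \<in> events" "\<And>n. N \<le> n \<Longrightarrow> ennreal (prob (A n)) \<le> ennreal c * f n"
    using A by (auto simp: eventually_sequentially)
  define A' where "A' n = (if N \<le> n then A n else {})" for n
  have "(\<Sum>n. ennreal (prob (A' n))) \<le> (\<Sum>n. ennreal c * f n)"
    using N by (intro suminf_le) (auto simp: A'_def)
  also have "\<dots> < top" using fin by (simp add: ennreal_mult_less_top)
  finally have "summable (\<lambda>n. prob (A' n))"
    by (intro summable_suminf_not_top) auto
  then have "AE \<omega> in M. \<forall>\<^sub>F n in sequentially. \<omega> \<in> space M - A' n"
    using N by (intro borel_cantelli_AE1) (auto simp: A'_def emeasure_eq_measure)
  then show ?thesis
  proof eventually_elim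
    case (elim \<omega>)
    then show ?case using eventually_ge_at_top[of N] by eventually_elim (auto simp: A'_def)
  qed
qed

text \<open>A vanishing lower limit lets points be picked with values below 2^-n. This summability
  is what the indices \<open>delta1\<close> and \<open>beta1\<close> contribute to
  Borel-Cantelli.\<close>

lemma Liminf_at_right_0_eq_0_sequence:
  fixes f :: "real \<Rightarrow> ennreal"
  assumes "Liminf (at_right 0) f = 0"
  obtains r :: "nat \<Rightarrow> real" where "\<And>n. 0 < r n" "r \<longlonglongrightarrow> 0" "(\<Sum>n. f (r n)) < \<infinity>"
proof -
  have "\<exists>x. 0 < x \<and> x < 1 / real (Suc n) \<and> f x < ennreal ((1 / 2) ^ n)" for n
  proof (rule ccontr)
    assume *: "\<not> ?thesis"
    have "ennreal ((1 / 2) ^ n) \<le> f x" if "0 < x" "x < 1 / real (Suc n)" for x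
      using * that by (meson not_le)
    then have "\<forall>\<^sub>F x in at_right 0. ennreal ((1 / 2) ^ n) \<le> f x"
      unfolding eventually_at_right_field by (intro exI[of _ "1 / real (Suc n)"]) auto
    then have "ennreal ((1 / 2) ^ n) \<le> Liminf (at_right 0) f" by (rule Liminf_bounded)
    then show False using assms by simp
  qed
  then obtain r where r: "\<And>n. 0 < r n" "\<And>n. r n < 1 / real (Suc n)" "\<And>n. f (r n) < ennreal ((1 / 2) ^ n)"
    by metis
  have "r \<longlonglongrightarrow> 0"
  proof (rule tendsto_sandwich[OF _ _ tendsto_const LIMSEQ_inverse_real_of_nat])
    show "\<forall>\<^sub>F n in sequentially. 0 \<le> r n" using r(1) by (intro always_eventually) (auto intro: less_imp_le)
    show "\<forall>\<^sub>F n in sequentially. r n \<le> inverse (real (Suc n))"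
      using r(2) by (intro always_eventually) (auto intro: less_imp_le simp: inverse_eq_divide)
  qed
  have "(\<Sum>n. f (r n)) \<le> (\<Sum>n. ennreal ((1 / 2) ^ n))"
    using r(3) by (intro suminf_le) (auto intro: less_imp_le)
  also have "(\<Sum>n. ennreal ((1 / 2) ^ n)) < \<infinity>"
    by (simp only: infinity_ennreal_def less_top[symmetric])
       (intro ennreal_suminf_neq_top summable_geometric, auto)
  finally have "(\<Sum>n. f (r n)) < \<infinity>" .
  with \<open>r \<longlonglongrightarrow> 0\<close> show thesis using r(1) that[of r] by blast
qed

section \<open>Borel-Cantelli along the time-changed sequence\<close>

locale additive_time_change = additive_components M X B C \<nu> + time_change "y_fun B C \<nu>" b \<phi> v
  for M :: "'w measure" and X :: "real \<Rightarrow> 'w \<Rightarrow> real ^ 'd"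
    and B C :: "'d \<Rightarrow> real \<Rightarrow> real" and \<nu> :: "'d \<Rightarrow> real \<Rightarrow> real measure"
    and b :: real and \<phi> v :: "real \<Rightarrow> real"
begin

lemma eventually_v_nonneg:
  fixes r :: "nat \<Rightarrow> real"
  assumes "\<And>n. 0 < r n" "r \<longlonglongrightarrow> 0"
  shows "\<forall>\<^sub>F n in sequentially. 0 \<le> v (r n)"
proof -
  have "\<forall>\<^sub>F n in sequentially. r n < \<epsilon>" using assms(2) \<epsilon>(1) by (rule order_tendstoD)
  then show ?thesis
  proof eventually_elim
    case (elim n)
    then show ?case using assms(1)[of n] \<epsilon>(2)[of "r n"] v_nonneg by auto
  qed
qed

lemma AE_sup_process_small:
  fixes r :: "nat \<Rightarrow> real"
  assumes r: "\<And>n. 0 < r n" "r \<longlonglongrightarrow> 0"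
    and sum: "(\<Sum>n. ennreal (y_fun B C \<nu> (v (r n)) (r n powr a))) < \<infinity>"
  shows "AE \<omega> in M. \<forall>\<^sub>F n in sequentially. sup_process X (v (r n)) \<omega> \<le> r n powr a"
proof -
  let ?A = "\<lambda>n. {\<omega> \<in> space M. r n powr a < sup_process X (v (r n)) \<omega>}"
  let ?c = "24 * (3 * real CARD('d) + (3 * real CARD('d))\<^sup>2 / 2 + 2)"
  have "AE \<omega> in M. \<forall>\<^sub>F n in sequentially. \<omega> \<notin> ?A n"
  proof (rule borel_cantelli_bound[OF sum, where c = ?c])
    show "\<forall>\<^sub>F n in sequentially. ?A n \<in> events \<and>
        ennreal (prob (?A n)) \<le> ennreal ?c * ennreal (y_fun B C \<nu> (v (r n)) (r n powr a))"
      using eventually_v_nonneg[OF r]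
    proof eventually_elim
      case (elim n)
      have "prob (?A n) \<le> ?c * y_fun B C \<nu> (v (r n)) (r n powr a)"
        using prob_sup_gt_le[OF elim, of "r n powr a"] r(1)[of n] by simp
      then have "ennreal (prob (?A n)) \<le> ennreal (?c * y_fun B C \<nu> (v (r n)) (r n powr a))"
        by (rule ennreal_leI)
      also have "\<dots> = ennreal ?c * ennreal (y_fun B C \<nu> (v (r n)) (r n powr a))"
        by (rule ennreal_mult') simp
      finally show ?case using sup_process_events(2)[OF elim] by blast
    qed
  qed
  with AE_space show ?thesis
  proof eventually_elim
    case (elim \<omega>)
    from elim(2) show ?case by eventually_elim (use elim(1) in auto)
  qed
qed

lemma AE_sup_process_large:
  fixes r :: "nat \<Rightarrow> real"
  assumes r: "\<And>n. 0 < r n" "r \<longlonglongrightarrow> 0"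
    and sum: "(\<Sum>n. inverse (ennreal (y_fun B C \<nu> (v (r n)) (r n powr a)))) < \<infinity>"
  shows "AE \<omega> in M. \<forall>\<^sub>F n in sequentially. r n powr a < sup_process X (v (r n)) \<omega>"
proof -
  let ?A = "\<lambda>n. {\<omega> \<in> space M. sup_process X (v (r n)) \<omega> \<le> r n powr a}"
  let ?c = "12600 * real CARD('d)"
  have "AE \<omega> in M. \<forall>\<^sub>F n in sequentially. \<omega> \<notin> ?A n"
  proof (rule borel_cantelli_bound[OF sum, where c = ?c])
    show "\<forall>\<^sub>F n in sequentially. ?A n \<in> events \<and>
        ennreal (prob (?A n)) \<le> ennreal ?c * inverse (ennreal (y_fun B C \<nu> (v (r n)) (r n powr a)))"
      using eventually_v_nonneg[OF r]
    proof eventually_elim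
      case (elim n)
      let ?y = "y_fun B C \<nu> (v (r n)) (r n powr a)"
      have "ennreal (prob (?A n)) \<le> ennreal ?c * inverse (ennreal ?y)"
      \<comment> \<open>Here \<open>ennreal ?y\<close> is 0 and its inverse is infinite, so the
        bound is trivial; otherwise one can divide by \<open>?y\<close>.\<close>
      proof (cases "?y \<le> 0")
        case True
        then show ?thesis by (simp add: ennreal_neg ennreal_mult_top)
      next
        case False
        then have "prob (?A n) \<le> ?c / ?y"
          using prob_sup_le[OF elim, of "r n powr a"] r(1)[of n] by (simp add: pos_le_divide_eq)
        then have "ennreal (prob (?A n)) \<le> ennreal (?c / ?y)" by (rule ennreal_leI)
        also have "\<dots> = ennreal ?c * inverse (ennreal ?y)"
          using False by (simp add: divide_ennreal[symmetric] divide_ennreal_def)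
        finally show ?thesis .
      qed
      then show ?case using sup_process_events(1)[OF elim] by simp
    qed
  qed
  with AE_space show ?thesis
  proof eventually_elim
    case (elim \<omega>)
    from elim(2) show ?case by eventually_elim (use elim(1) in auto)
  qed
qed

text \<open>The almost sure limits are extracted at rational exponents only; the gap between such an
  exponent and a given \<open>\<eta>\<close> is absorbed by the deterministic estimates.\<close>

lemma AE_delta1:
  "AE \<omega> in M. \<forall>q::rat. delta1 (y_fun B C \<nu>) v < ennreal (real_of_rat q) \<longrightarrow>
    (\<exists>\<eta>' r. 0 < \<eta>' \<and> \<eta>' < real_of_rat q \<and> (\<forall>n::nat. 0 < r n) \<and> r \<longlonglongrightarrow> 0 \<and>
      (\<forall>\<^sub>F n in sequentially. sup_process X (v (r n)) \<omega> \<le> r n powr (1 / \<eta>')))"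
  (is "AE \<omega> in M. \<forall>q. ?P q \<omega>")
  unfolding AE_all_countable
proof
  fix q :: rat
  show "AE \<omega> in M. ?P q \<omega>"
  proof (cases "delta1 (y_fun B C \<nu>) v < ennreal (real_of_rat q)")
    case True
    then obtain \<eta>' where \<eta>': "0 < \<eta>'" "ennreal \<eta>' < ennreal (real_of_rat q)"
      "Liminf (at_right 0) (\<lambda>r. ennreal (y_fun B C \<nu> (v r) (r powr (1 / \<eta>')))) = 0"
      unfolding delta1_def Inf_less_iff by auto
    obtain r where r: "\<And>n::nat. 0 < r n" "r \<longlonglongrightarrow> 0" "(\<Sum>n. ennreal (y_fun B C \<nu> (v (r n)) (r n powr (1 / \<eta>')))) < \<infinity>"
      using Liminf_at_right_0_eq_0_sequence[OF \<eta>'(3)] by blast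
    have q: "\<eta>' < real_of_rat q" using \<eta>' by (simp add: ennreal_less_iff)
    from AE_sup_process_small[OF r] show ?thesis
      by eventually_elim (use r \<eta>' q in blast)
  qed simp
qed

lemma AE_delta2:
  "AE \<omega> in M. \<forall>q::rat. ennreal (real_of_rat q) < delta2 (y_fun B C \<nu>) v \<longrightarrow>
    (\<exists>\<eta>' \<sigma>. real_of_rat q < \<eta>' \<and> Sigma_sequence \<sigma> \<and>
      (\<forall>\<^sub>F n in sequentially. \<sigma> n powr (1 / \<eta>') < sup_process X (v (\<sigma> n)) \<omega>))"
  (is "AE \<omega> in M. \<forall>q. ?P q \<omega>")
  unfolding AE_all_countable
proof
  fix q :: rat
  show "AE \<omega> in M. ?P q \<omega>"
  proof (cases "ennreal (real_of_rat q) < delta2 (y_fun B C \<nu>) v")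
    case True
    then obtain \<eta>' \<sigma> where \<eta>': "0 < \<eta>'" "ennreal (real_of_rat q) < ennreal \<eta>'" "Sigma_sequence \<sigma>"
      "(\<Sum>n. inverse (ennreal (y_fun B C \<nu> (v (\<sigma> n)) (\<sigma> n powr (1 / \<eta>'))))) < \<infinity>"
      unfolding delta2_def less_Sup_iff by auto
    have \<sigma>: "\<And>n. 0 < \<sigma> n" "\<sigma> \<longlonglongrightarrow> 0" using \<eta>'(3) by (auto simp: Sigma_sequence_def)
    \<comment> \<open>By contraposition, which also covers a negative q, where
      \<open>ennreal\<close> truncates to 0.\<close>
    have q: "real_of_rat q < \<eta>'" using \<eta>' by (metis ennreal_leI not_le)
    from AE_sup_process_large[OF \<sigma> \<eta>'(4)] show ?thesis
      by eventually_elim (use \<eta>' q in blast)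
  qed simp
qed

lemma AE_beta1:
  "AE \<omega> in M. \<forall>q::rat. ennreal (real_of_rat q) < beta1 (y_fun B C \<nu>) v \<longrightarrow>
    (\<exists>\<eta>' r. real_of_rat q < \<eta>' \<and> (\<forall>n::nat. 0 < r n) \<and> r \<longlonglongrightarrow> 0 \<and>
      (\<forall>\<^sub>F n in sequentially. r n powr (1 / \<eta>') < sup_process X (v (r n)) \<omega>))"
  (is "AE \<omega> in M. \<forall>q. ?P q \<omega>")
  unfolding AE_all_countable
proof
  fix q :: rat
  show "AE \<omega> in M. ?P q \<omega>"
  proof (cases "ennreal (real_of_rat q) < beta1 (y_fun B C \<nu>) v")
    case True
    then obtain \<eta>' where \<eta>': "0 < \<eta>'" "ennreal (real_of_rat q) < ennreal \<eta>'"
      "Liminf (at_right 0) (\<lambda>r. inverse (ennreal (y_fun B C \<nu> (v r) (r powr (1 / \<eta>'))))) = 0"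
      unfolding beta1_def less_Sup_iff by auto
    obtain r where r: "\<And>n::nat. 0 < r n" "r \<longlonglongrightarrow> 0"
      "(\<Sum>n. inverse (ennreal (y_fun B C \<nu> (v (r n)) (r n powr (1 / \<eta>'))))) < \<infinity>"
      using Liminf_at_right_0_eq_0_sequence[OF \<eta>'(3)] by blast
    have q: "real_of_rat q < \<eta>'" using \<eta>' by (metis ennreal_leI not_le)
    from AE_sup_process_large[OF r] show ?thesis
      by eventually_elim (use r q in blast)
  qed simp
qed

lemma AE_beta2:
  "AE \<omega> in M. \<forall>q::rat. beta2 (y_fun B C \<nu>) v < ennreal (real_of_rat q) \<longrightarrow>
    (\<exists>\<eta>' \<sigma>. 0 < \<eta>' \<and> \<eta>' < real_of_rat q \<and> Sigma_sequence \<sigma> \<and>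
      (\<forall>\<^sub>F n in sequentially. sup_process X (v (\<sigma> n)) \<omega> \<le> \<sigma> n powr (1 / \<eta>')))"
  (is "AE \<omega> in M. \<forall>q. ?P q \<omega>")
  unfolding AE_all_countable
proof
  fix q :: rat
  show "AE \<omega> in M. ?P q \<omega>"
  proof (cases "beta2 (y_fun B C \<nu>) v < ennreal (real_of_rat q)")
    case True
    then obtain \<eta>' \<sigma> where \<eta>': "0 < \<eta>'" "ennreal \<eta>' < ennreal (real_of_rat q)" "Sigma_sequence \<sigma>"
      "(\<Sum>n. ennreal (y_fun B C \<nu> (v (\<sigma> n)) (\<sigma> n powr (1 / \<eta>')))) < \<infinity>"
      unfolding beta2_def Inf_less_iff by auto
    have \<sigma>: "\<And>n. 0 < \<sigma> n" "\<sigma> \<longlonglongrightarrow> 0" using \<eta>'(3) by (auto simp: Sigma_sequence_def)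
    have q: "\<eta>' < real_of_rat q" using \<eta>' by (simp add: ennreal_less_iff)
    from AE_sup_process_small[OF \<sigma> \<eta>'(4)] show ?thesis
      by eventually_elim (use \<eta>' q in blast)
  qed simp
qed

lemma path_at:
  assumes "\<omega> \<in> space M"
  shows "time_changed_path (y_fun B C \<nu>) b \<phi> v (\<lambda>t. sup_process X t \<omega>)"
  using sup_process_mono[OF assms] sup_process_nonneg[OF assms] by unfold_locales auto

text \<open>One null set has to serve all \<eta>. A rational q is put strictly between the index and
  \<eta>; the countable statements then supply \<eta>' < q < \<eta> for \<open>delta1\<close> and
  \<open>beta2\<close>, and \<eta> < q < \<eta>' for \<open>delta2\<close> and
  \<open>beta1\<close>.\<close>

lemma AE_growth:
  "AE \<omega> in M. \<forall>\<eta>>0.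
     (delta1 (y_fun B C \<nu>) v < ennreal \<eta> \<longrightarrow>
        Liminf (at_right 0) (\<lambda>t. ennreal (u t powr (- 1 / \<eta>) * sup_process X t \<omega>)) = 0) \<and>
     (ennreal \<eta> < delta2 (y_fun B C \<nu>) v \<longrightarrow>
        Liminf (at_right 0) (\<lambda>t. ennreal (u t powr (- 1 / \<eta>) * sup_process X t \<omega>)) = \<infinity>) \<and>
     (beta2 (y_fun B C \<nu>) v < ennreal \<eta> \<longrightarrow>
        Limsup (at_right 0) (\<lambda>t. ennreal (u t powr (- 1 / \<eta>) * sup_process X t \<omega>)) = 0) \<and>
     (ennreal \<eta> < beta1 (y_fun B C \<nu>) v \<longrightarrow>
        Limsup (at_right 0) (\<lambda>t. ennreal (u t powr (- 1 / \<eta>) * sup_process X t \<omega>)) = \<infinity>)"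
proof -
  let ?q = "real_of_rat"
  show ?thesis
    using AE_space AE_delta1 AE_delta2 AE_beta1 AE_beta2
  proof eventually_elim
    case (elim \<omega>)
    interpret time_changed_path "y_fun B C \<nu>" b \<phi> v "\<lambda>t. sup_process X t \<omega>"
      by (rule path_at) fact
    show ?case
    proof (intro allI impI conjI)
      fix \<eta> :: real assume \<eta>: "0 < \<eta>" "delta1 (y_fun B C \<nu>) v < ennreal \<eta>"
      then obtain q where q: "delta1 (y_fun B C \<nu>) v < ennreal (?q q)" "ennreal (?q q) < ennreal \<eta>"
        using ennreal_rat_dense by blast
      then have "?q q < \<eta>" using \<eta> by (metis ennreal_leI not_le)
      moreover obtain \<eta>' r where "0 < \<eta>'" "\<eta>' < ?q q" "\<And>n::nat. 0 < r n" "r \<longlonglongrightarrow> 0"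
        "\<forall>\<^sub>F n in sequentially. sup_process X (v (r n)) \<omega> \<le> r n powr (1 / \<eta>')"
        using elim(2) q(1) by blast
      ultimately show "Liminf (at_right 0) (\<lambda>t. ennreal (u t powr (- 1 / \<eta>) * sup_process X t \<omega>)) = 0"
        by (intro Liminf_0[of \<eta>' \<eta> r]) auto
    next
      fix \<eta> :: real assume \<eta>: "0 < \<eta>" "ennreal \<eta> < delta2 (y_fun B C \<nu>) v"
      then obtain q where q: "ennreal \<eta> < ennreal (?q q)" "ennreal (?q q) < delta2 (y_fun B C \<nu>) v"
        using ennreal_rat_dense by blast
      then have "\<eta> < ?q q" by (metis ennreal_leI not_le)
      moreover obtain \<eta>' \<sigma> where "?q q < \<eta>'" "Sigma_sequence \<sigma>"
        "\<forall>\<^sub>F n in sequentially. \<sigma> n powr (1 / \<eta>') < sup_process X (v (\<sigma> n)) \<omega>"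
        using elim(3) q(2) by blast
      ultimately show "Liminf (at_right 0) (\<lambda>t. ennreal (u t powr (- 1 / \<eta>) * sup_process X t \<omega>)) = \<infinity>"
        using \<eta> by (intro Liminf_infinity[of \<eta> \<eta>' \<sigma>]) auto
    next
      fix \<eta> :: real assume \<eta>: "0 < \<eta>" "beta2 (y_fun B C \<nu>) v < ennreal \<eta>"
      then obtain q where q: "beta2 (y_fun B C \<nu>) v < ennreal (?q q)" "ennreal (?q q) < ennreal \<eta>"
        using ennreal_rat_dense by blast
      then have "?q q < \<eta>" using \<eta> by (metis ennreal_leI not_le)
      moreover obtain \<eta>' \<sigma> where "0 < \<eta>'" "\<eta>' < ?q q" "Sigma_sequence \<sigma>"
        "\<forall>\<^sub>F n in sequentially. sup_process X (v (\<sigma> n)) \<omega> \<le> \<sigma> n powr (1 / \<eta>')"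
        using elim(5) q(1) by blast
      ultimately show "Limsup (at_right 0) (\<lambda>t. ennreal (u t powr (- 1 / \<eta>) * sup_process X t \<omega>)) = 0"
        by (intro Limsup_0[of \<eta>' \<eta> \<sigma>]) auto
    next
      fix \<eta> :: real assume \<eta>: "0 < \<eta>" "ennreal \<eta> < beta1 (y_fun B C \<nu>) v"
      then obtain q where q: "ennreal \<eta> < ennreal (?q q)" "ennreal (?q q) < beta1 (y_fun B C \<nu>) v"
        using ennreal_rat_dense by blast
      then have "\<eta> < ?q q" by (metis ennreal_leI not_le)
      moreover obtain \<eta>' r where "?q q < \<eta>'" "\<And>n::nat. 0 < r n" "r \<longlonglongrightarrow> 0"
        "\<forall>\<^sub>F n in sequentially. r n powr (1 / \<eta>') < sup_process X (v (r n)) \<omega>"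
        using elim(4) q(2) by blast
      ultimately show "Limsup (at_right 0) (\<lambda>t. ennreal (u t powr (- 1 / \<eta>) * sup_process X t \<omega>)) = \<infinity>"
        using \<eta> by (intro Limsup_infinity[of \<eta> \<eta>' r]) auto
    qed
  qed
qed

end

text \<open>The hypothesis \<open>nondegenerate\<close> excludes that y t b vanishes on an initial
  time interval; there v would stay bounded away from 0 at positive arguments and could not describe
  behaviour at small times.\<close>

theorem theorem3p1:
  fixes M :: "'w measure"
    and X :: "real \<Rightarrow> 'w \<Rightarrow> real ^ 'd"
    and B C :: "'d \<Rightarrow> real \<Rightarrow> real"
    and \<nu> :: "'d \<Rightarrow> real \<Rightarrow> real measure"
    and y :: "real \<Rightarrow> real \<Rightarrow> real"
    and \<phi> v u :: "real \<Rightarrow> real"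
    and b :: real
  assumes "prob_space M"
    and additive: "\<And>i. additive_process M (\<lambda>t \<omega>. X t \<omega> $ i)"
    and characteristics: "\<And>i. has_characteristics M (\<lambda>t \<omega>. X t \<omega> $ i) (B i) (C i) (\<nu> i)"
    and y: "y = y_fun B C \<nu>"
    and \<phi>: "quasiconvex \<phi>"
    and b: "0 < b"
    and nondegenerate: "\<And>t. 0 < t \<Longrightarrow> 0 < y t b"
    and v: "is_time_change y b \<phi> v"
    and u: "u = right_inverse_on (tc_domain y b \<phi>) v"
  shows "AE \<omega> in M. \<forall>\<eta>>0.
     (delta1 y v < ennreal \<eta> \<longrightarrow>
        Liminf (at_right 0) (\<lambda>t. ennreal (u t powr (- 1 / \<eta>) * sup_process X t \<omega>)) = 0) \<and>
     (ennreal \<eta> < delta2 y v \<longrightarrow>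
        Liminf (at_right 0) (\<lambda>t. ennreal (u t powr (- 1 / \<eta>) * sup_process X t \<omega>)) = \<infinity>) \<and>
     (beta2 y v < ennreal \<eta> \<longrightarrow>
        Limsup (at_right 0) (\<lambda>t. ennreal (u t powr (- 1 / \<eta>) * sup_process X t \<omega>)) = 0) \<and>
     (ennreal \<eta> < beta1 y v \<longrightarrow>
        Limsup (at_right 0) (\<lambda>t. ennreal (u t powr (- 1 / \<eta>) * sup_process X t \<omega>)) = \<infinity>)"
proof -
  interpret prob_space M by fact
  interpret additive_components M X B C \<nu>
    by (rule additive_components.intro[OF \<open>prob_space M\<close> additive_components_axioms.intro])
       (rule additive_levyI[OF \<open>prob_space M\<close> additive characteristics])
  interpret additive_time_change M X B C \<nu> b \<phi> v
    using b \<phi> v nondegenerate y_fun_mono y_fun_0 y_fun_cont unfolding y by unfold_locales auto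
  show ?thesis
    unfolding u y by (rule AE_growth)
qed

end
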